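(* Assume that, for all $i,j\in\{1,\dots,k\}$, as $n\to\infty$: $n_n^{(i)}/n_n^{(j)}\to\nu_{ij}\in(0,\infty)$; $1/n_n^{(i)}\ll p_n^{(i)}\ll (n_n^{(i)})^{-1/r}$; $q_n^{(ij)}\le\min\{p_n^{(i)},p_n^{(j)}\}$ for all $n$; $q_n^{(ij)}/p_n^{(i)}\to\gamma_{ij}\in[0,1]$ and $p_n^{(i)}/p_n^{(j)}\to\mu_{ij}\in(0,\infty)$; $a_n^{(i)}/g_n^{(i)}\to\alpha_i\ge 0$; the matrix $\chi=(\chi_{ij})_{1\le i,j\le k}$ is irreducible; and $\alpha_1\ge\alpha_2\ge\dots\ge\alpha_k$ with $\alpha_1>0$. Assume moreover the sub-critical condition $$\min_{x\in\mathcal D_\rho}\rho_1(x)<0 .$$ Then for every $\varepsilon>0$ there exists $c(\varepsilon)\in(0,\infty)$ such that, as $n\to\infty$, $$P\left(\left|\frac{A_n^*}{g_n^{(1)}}-x_*\right|>\varepsilon\right)=O\left(e^{-c(\varepsilon)g_n^{(1)}}\right),$$ where $$x_*:=\sum_{i=1}^k x_i(y_{\mathcal E})\,\bigl(\nu_{1i}(\mu_{1i})^r\bigr)^{1/(r-1)} ,$$ and $x(y_{\mathcal E})=(x_1(y_{\mathcal E}),\dots,x_k(y_{\mathcal E}))$ is the exit point of the Cauchy problem described in the context.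
   Context: Fix integers $r\ge2$ and $k\ge1$. All limits are as $n\to\infty$; $f_1\ll f_2$ means $f_1(n)/f_2(n)\to0$. Stochastic block model: for each $n$, a random graph on $n$ nodes partitioned into communities $G_1,\dots,G_k$ of sizes $n_n^{(1)},\dots,n_n^{(k)}\in\{1,2,\dots\}$, $\sum_i n_n^{(i)}=n$. Each pair of distinct nodes, one in $G_i$ and the other in $G_j$ (possibly $i=j$), is joined by an edge independently of the other pairs with probability $q_n^{(ij)}=q_n^{(ji)}\in[0,1)$. Put $p_n^{(i)}:=q_n^{(ii)}$. Bootstrap percolation: in each $G_i$, a set of $a_n^{(i)}$ nodes ($0\le a_n^{(i)}\le n_n^{(i)}$), called seeds, is chosen uniformly at random and declared active; all other nodes are initially inactive. An inactive node becomes active as soon as at least $r$ of its neighbours are active; active nodes stay active forever. The process stops when no more nodes can be activated. $A_n^*$ is the final number of active nodes (seeds included). Definitions: $g_n^{(i)}:=\left(1-\frac1r\right)\left(\frac{(r-1)!}{n_n^{(i)}(p_n^{(i)})^r}\right)^{1/(r-1)}$; $\chi_{ij}:=\lim_{n\to\infty}\frac{q_n^{(ij)}g_n^{(j)}}{p_n^{(i)}g_n^{(i)}}=\gamma_{ij}(\nu_{ij}(\mu_{ij})^r)^{1/(r-1)}$ (so $\chi_{ii}=1$). For $x\in\mathbb R^k$ and $1\le i\le k$, $$\rho_i(x):=\alpha_i-x_i+r^{-1}(1-r^{-1})^{r-1}\Bigl(\sum_{j=1}^k\chi_{ij}x_j\Bigr)^r,\qquad \rho:=(\rho_1,\dots,\rho_k).$$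 $\mathcal D:=\{x\in[0,r/(r-1)]^k: x_i+\sum_{j\ne i}\chi_{ij}x_j\le r/(r-1)\ \forall i\}$ and $\mathcal D_\rho:=\{x\in\mathcal D:\rho_1(x)=\dots=\rho_k(x)\}$. Initial point: let $\mathcal K_0:=\{1\}$, $\mathcal K_1:=\{i\in\{2,\dots,k\}:\chi_{1i}>0\}$ and, for $h\ge2$, $\mathcal K_h:=\{i\in\{2,\dots,k\}:(\chi^h)_{1i}>0,\ (\chi^s)_{1i}=0\ \forall 1\le s\le h-1\}$ ($\chi^h$ is the $h$-th matrix power); $\overline d:=\max\{h:\mathcal K_h\ne\emptyset\}$. Let $\underline\chi:=\min\{\chi_{ij}:\chi_{ij}>0\}$, $\beta_0:=\alpha_1/2$, $\beta_h:=\frac{r^{-1}(1-r^{-1})^{r-1}}2(\underline\chi\beta_{h-1})^r$ for $1\le h\le\overline d$, and let $x_0$ be the vector whose $i$-th component is $\beta_h$ when $i\in\mathcal K_h$. Cauchy problem: consider $\rho$ as a function on the closed ball $B$ centred at $x_0$ with radius the diameter of $\mathcal D$, and let $x(y)$, $y\in[y_0,y_+)$, be the unique solution of $x'(y)=\rho(x(y))$, $x(y_0)=x_0$, where $y_0\in\mathbb R$ is arbitrary and $y_+:=\sup\{y>y_0: x(y)\in B\}$. Let $\mathcal E':=\{x\in\mathcal D:\rho(x)\ge0\text{ componentwise}\}$, $\mathcal E$ the closure of the connected component of $\mathcal E'$ containing $x_0$, $\mathcal E^\circ$ its interior, $y_{\mathcal E}:=\inf\{y\in(y_0,y_+):x(y)\notin\mathcal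 E^\circ\}$ ($:=+\infty$ if this set is empty), and $x(y_{\mathcal E}):=\lim_{y\uparrow y_{\mathcal E}}x(y)$ (the limit exists because $x(\cdot)$ is componentwise increasing in $\mathcal E$). *)

theory Defs
  imports "HOL-Probability.Probability" "HOL-Probability.Product_PMF" "HOL-Library.Landau_Symbols"
begin

text \<open>
  Communities are indexed by a finite linearly ordered type \<open>'k\<close>, so that \<open>CARD('k)\<close> is the
  number of communities, the least index \<open>idx1\<close> is community 1, and vectors indexed by communities live in \<open>real ^ 'k\<close>. Nodes are the
  numbers \<open>0, \<dots>, n - 1\<close>; the partition into communities is given by a map from nodes to indices.
\<close>

type_synonym 'k rvec = "(real, 'k) vec"
type_synonym 'k rmat = "((real, 'k) vec, 'k) vec"

definition idx1 :: "'k::{finite,linorder}" where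
  "idx1 = Min UNIV"

definition community :: "nat \<Rightarrow> (nat \<Rightarrow> 'k) \<Rightarrow> 'k \<Rightarrow> nat set" where
  "community n comm i = {v. v < n \<and> comm v = i}"


section \<open>Stochastic block model and bootstrap percolation\<close>

text \<open>
  A graph on \<open>{..<n}\<close> is encoded by the indicator function of its edges, an unordered pair of
  distinct nodes being represented by the pair \<open>(u, v)\<close> with \<open>u < v\<close>.
\<close>

definition adjacent :: "(nat \<times> nat \<Rightarrow> bool) \<Rightarrow> nat \<Rightarrow> nat \<Rightarrow> bool" where
  "adjacent E u v \<longleftrightarrow> (u < v \<and> E (u, v)) \<or> (v < u \<and> E (v, u))"

definition sbm_pmf :: "nat \<Rightarrow> (nat \<Rightarrow> 'k) \<Rightarrow> ('k \<Rightarrow> 'k \<Rightarrow> real) \<Rightarrow> (nat \<times> nat \<Rightarrow> bool) pmf" where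
  "sbm_pmf n comm q =
     Pi_pmf {(u, v). u < v \<and> v < n} False (\<lambda>(u, v). bernoulli_pmf (q (comm u) (comm v)))"

definition seeds_pmf :: "nat \<Rightarrow> (nat \<Rightarrow> 'k::finite) \<Rightarrow> ('k \<Rightarrow> nat) \<Rightarrow> nat set pmf" where
  "seeds_pmf n comm a =
     map_pmf (\<lambda>S. \<Union>i. S i)
       (Pi_pmf UNIV {} (\<lambda>i. pmf_of_set {S. S \<subseteq> community n comm i \<and> card S = a i}))"

text \<open>
  All inactive nodes with at least \<open>r\<close> active neighbours are activated simultaneously in each
  round; the final active set does not depend on the order of activations.
\<close>

primrec active_after :: "nat \<Rightarrow> nat \<Rightarrow> (nat \<times> nat \<Rightarrow> bool) \<Rightarrow> nat set \<Rightarrow> nat \<Rightarrow> nat set" where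
  "active_after r n E S 0 = S"
| "active_after r n E S (Suc t) = active_after r n E S t \<union>
     {v. v < n \<and> r \<le> card {u \<in> active_after r n E S t. adjacent E u v}}"

definition final_active :: "nat \<Rightarrow> nat \<Rightarrow> (nat \<times> nat \<Rightarrow> bool) \<Rightarrow> nat set \<Rightarrow> nat set" where
  "final_active r n E S = (\<Union>t. active_after r n E S t)"

text \<open>The law of the final number of active nodes; graph and seeds are independent.\<close>

definition final_size_pmf ::
  "nat \<Rightarrow> nat \<Rightarrow> (nat \<Rightarrow> 'k::finite) \<Rightarrow> ('k \<Rightarrow> 'k \<Rightarrow> real) \<Rightarrow> ('k \<Rightarrow> nat) \<Rightarrow> nat pmf" where
  "final_size_pmf r n comm q a =
     map_pmf (\<lambda>(E, S). card (final_active r n E S)) (pair_pmf (sbm_pmf n comm q) (seeds_pmf n comm a))"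


section \<open>Critical scale and limiting parameters\<close>

text \<open>Here \<open>m\<close> is the size and \<open>p\<close> the internal edge probability of a community.\<close>

definition crit_seeds :: "nat \<Rightarrow> nat \<Rightarrow> real \<Rightarrow> real" where
  "crit_seeds r m p =
     (1 - 1 / real r) * (fact (r - 1) / (real m * p ^ r)) powr (1 / (real r - 1))"

definition chi_matrix :: "(nat \<Rightarrow> 'k::finite \<Rightarrow> 'k \<Rightarrow> real) \<Rightarrow> (nat \<Rightarrow> 'k \<Rightarrow> real) \<Rightarrow> 'k rmat" where
  "chi_matrix q g = (\<chi> i j. lim (\<lambda>n. (q n i j * g n j) / (q n i i * g n i)))"

text \<open>The library's \<open>(^)\<close> on vectors is componentwise, hence a separate matrix power.\<close>

primrec mat_pow :: "'k::finite rmat \<Rightarrow> nat \<Rightarrow> 'k rmat" where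
  "mat_pow A 0 = mat 1"
| "mat_pow A (Suc h) = mat_pow A h ** A"

text \<open>Irreducibility of a matrix with nonnegative entries.\<close>

definition irreducible_mat :: "'k::finite rmat \<Rightarrow> bool" where
  "irreducible_mat A \<longleftrightarrow> (\<forall>i j. \<exists>h\<ge>1. mat_pow A h $ i $ j > 0)"


section \<open>The vector field and its domain\<close>

definition rho :: "nat \<Rightarrow> 'k::finite rvec \<Rightarrow> 'k rmat \<Rightarrow> 'k rvec \<Rightarrow> 'k rvec" where
  "rho r \<alpha> X x = (\<chi> i. \<alpha> $ i - x $ i
     + (1 / real r) * (1 - 1 / real r) ^ (r - 1) * (\<Sum>j\<in>UNIV. X $ i $ j * x $ j) ^ r)"

definition dom_D :: "nat \<Rightarrow> 'k::finite rmat \<Rightarrow> 'k rvec set" where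
  "dom_D r X = {x. \<forall>i. 0 \<le> x $ i \<and> x $ i \<le> real r / (real r - 1) \<and>
     x $ i + (\<Sum>j\<in>UNIV - {i}. X $ i $ j * x $ j) \<le> real r / (real r - 1)}"

definition dom_Drho :: "nat \<Rightarrow> 'k::finite rvec \<Rightarrow> 'k rmat \<Rightarrow> 'k rvec set" where
  "dom_Drho r \<alpha> X = {x \<in> dom_D r X. \<forall>i j. rho r \<alpha> X x $ i = rho r \<alpha> X x $ j}"

text \<open>
  The minimum of \<open>\<rho>\<^sub>1\<close> over \<open>\<D>\<^sub>\<rho>\<close> is attained and negative. (The operator \<open>Min\<close> is meaningless
  on infinite sets.)
\<close>

definition subcritical ::
  "nat \<Rightarrow> 'k::{finite,linorder} rvec \<Rightarrow> 'k rmat \<Rightarrow> bool" where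
  "subcritical r \<alpha> X \<longleftrightarrow>
     (\<exists>x. is_arg_min (\<lambda>x. rho r \<alpha> X x $ idx1) (\<lambda>x. x \<in> dom_Drho r \<alpha> X) x \<and> rho r \<alpha> X x $ idx1 < 0)"


section \<open>The initial point\<close>

fun layer :: "'k::{finite,linorder} rmat \<Rightarrow> nat \<Rightarrow> 'k set" where
  "layer X 0 = {idx1}"
| "layer X (Suc h) = {i. i \<noteq> idx1 \<and> mat_pow X (Suc h) $ idx1 $ i > 0 \<and>
     (\<forall>s. 1 \<le> s \<and> s \<le> h \<longrightarrow> mat_pow X s $ idx1 $ i = 0)}"

definition chi_min :: "'k::finite rmat \<Rightarrow> real" where
  "chi_min X = Min {X $ i $ j | i j. X $ i $ j > 0}"

primrec beta :: "nat \<Rightarrow> 'k::{finite,linorder} rvec \<Rightarrow> 'k rmat \<Rightarrow> nat \<Rightarrow> real" where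
  "beta r \<alpha> X 0 = \<alpha> $ idx1 / 2"
| "beta r \<alpha> X (Suc h) =
     ((1 / real r) * (1 - 1 / real r) ^ (r - 1)) / 2 * (chi_min X * beta r \<alpha> X h) ^ r"

text \<open>
  For irreducible \<open>X\<close> the layers partition the index type. Only the values of \<open>beta\<close> at
  indices of nonempty layers are used, so the maximal such index need not be named.
\<close>

definition init_pt :: "nat \<Rightarrow> 'k::{finite,linorder} rvec \<Rightarrow> 'k rmat \<Rightarrow> 'k rvec" where
  "init_pt r \<alpha> X = (\<chi> i. beta r \<alpha> X (THE h. i \<in> layer X h))"


section \<open>The Cauchy problem and its exit point\<close>

definition ball_B :: "nat \<Rightarrow> 'k::{finite,linorder} rvec \<Rightarrow> 'k rmat \<Rightarrow> 'k rvec set" where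
  "ball_B r \<alpha> X = cball (init_pt r \<alpha> X) (diameter (dom_D r X))"

definition solves_in_ball ::
  "nat \<Rightarrow> 'k::{finite,linorder} rvec \<Rightarrow> 'k rmat \<Rightarrow> real \<Rightarrow> real set \<Rightarrow> (real \<Rightarrow> 'k rvec) \<Rightarrow> bool" where
  "solves_in_ball r \<alpha> X y0 J x \<longleftrightarrow> x y0 = init_pt r \<alpha> X \<and>
     (\<forall>y\<in>J. x y \<in> ball_B r \<alpha> X \<and> (x has_vector_derivative rho r \<alpha> X (x y)) (at y within J))"

text \<open>
  \<open>x\<close> is the solution on \<open>[y0, yp)\<close>, where \<open>yp\<close> (possibly \<open>\<infinity>\<close>) is the supremum of the times up to
  which the solution exists inside the ball. By uniqueness, the auxiliary solution \<open>z\<close> extends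
  or restricts \<open>x\<close>. The values of \<open>x\<close> outside \<open>[y0, yp)\<close> are irrelevant.
\<close>

definition cauchy_solution ::
  "nat \<Rightarrow> 'k::{finite,linorder} rvec \<Rightarrow> 'k rmat \<Rightarrow> real \<Rightarrow> ereal \<Rightarrow> (real \<Rightarrow> 'k rvec) \<Rightarrow> bool" where
  "cauchy_solution r \<alpha> X y0 yp x \<longleftrightarrow>
     solves_in_ball r \<alpha> X y0 {y. y0 \<le> y \<and> ereal y < yp} x \<and>
     yp = Sup {ereal y | y. y0 < y \<and> (\<exists>z. solves_in_ball r \<alpha> X y0 {y0..y} z)}"

definition region_E' :: "nat \<Rightarrow> 'k::finite rvec \<Rightarrow> 'k rmat \<Rightarrow> 'k rvec set" where
  "region_E' r \<alpha> X = {x \<in> dom_D r X. \<forall>i. 0 \<le> rho r \<alpha> X x $ i}"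

definition region_E :: "nat \<Rightarrow> 'k::{finite,linorder} rvec \<Rightarrow> 'k rmat \<Rightarrow> 'k rvec set" where
  "region_E r \<alpha> X = closure (connected_component_set (region_E' r \<alpha> X) (init_pt r \<alpha> X))"

text \<open>In \<open>ereal\<close>, the infimum of the empty set is \<open>\<infinity>\<close>.\<close>

definition exit_time ::
  "nat \<Rightarrow> 'k::{finite,linorder} rvec \<Rightarrow> 'k rmat \<Rightarrow> real \<Rightarrow> ereal \<Rightarrow> (real \<Rightarrow> 'k rvec) \<Rightarrow> ereal" where
  "exit_time r \<alpha> X y0 yp x =
     Inf {ereal y | y. y0 < y \<and> ereal y < yp \<and> x y \<notin> interior (region_E r \<alpha> X)}"

definition left_limit :: "(real \<Rightarrow> 'k::finite rvec) \<Rightarrow> ereal \<Rightarrow> 'k rvec" where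
  "left_limit x T = Lim (if T = \<infinity> then at_top else at_left (real_of_ereal T)) x"

definition exit_point ::
  "nat \<Rightarrow> 'k::{finite,linorder} rvec \<Rightarrow> 'k rmat \<Rightarrow> real \<Rightarrow> ereal \<Rightarrow> (real \<Rightarrow> 'k rvec) \<Rightarrow> 'k rvec" where
  "exit_point r \<alpha> X y0 yp x = left_limit x (exit_time r \<alpha> X y0 yp x)"

end

theory Submission
  imports Defs "HOL-Real_Asymp.Real_Asymp"
begin

text \<open>
  Exploring an active node reveals its edges to all other nodes; once it is removed, the remaining
  graph is a fresh block model in which the thresholds of its neighbours have dropped by one.
  By induction along this exploration, the event that bootstrap percolation stops with exactly
  \<open>s\<^sub>i\<close> active nodes in community \<open>i\<close> is at most as likely as the event that exactly
  \<open>s\<^sub>i\<close> nodes are seeds or receive \<open>r\<close> marks when the nodes receive independent marks from \<open>s\<^sub>j\<close>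
  nodes of each community \<open>j\<close>; likewise for the event that some count exceeds \<open>t\<^sub>i\<close>. In the
  independent model the counts are sums of independent indicators with mean about
  \<open>g\<^sub>i \<cdot> drive\<^sub>i(s / g)\<close>, where \<open>\<rho>(x) = drive(x) - x\<close>, so Chernoff bounds apply. If
  \<open>drive(w) < w\<close>, then \<open>w\<close> bounds the rescaled final counts from above. Below such a \<open>w\<close> there
  are polynomially many count vectors, and one that stops the process is an approximate
  supersolution, hence not far below the least one.

  The vector field is cooperative and the initial point is a strict subsolution below every
  supersolution. A monotone Picard iteration yields a global increasing solution that never leaves the
  interior of the region, so the exit time is infinite and the exit point is the least
  supersolution. By convexity, the subcritical point provides strict supersolutions arbitrarily
  close to it.
\<close>

section \<open>Exploration of the block model\<close>

text \<open>Conditioning on how far an activation has spread would bias the edges not yet examined.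
  The comparison avoids this by fixing a target vector \<open>t\<close> beforehand and giving every
  node its marks from exactly \<open>t j\<close> nodes of each community \<open>j\<close>: if the
  process stops at \<open>t\<close>, exactly these marks have been spent, and once it passes
  \<open>t\<close>, the event is decided alike on both sides. One inequality thus serves both tails.
  The price is a union bound over target vectors; their number is polynomial in the scale and is
  paid for with half of the exponential rate.

  The constant in \<open>rho\<close> comes from the normalisation of \<open>g\<close>: the expected
  number of nodes with \<open>r\<close> marks is about
  \<open>N n i * (p n i * g n i) ^ r / fact r\<close> times a power of the rescaled load, and this
  prefactor equals \<open>bp_const r * g n i\<close>.

  The layers of the initial point follow entries of \<open>X\<close> leading away from community 1,
  whereas the drive of \<open>i\<close> sums the entries of row \<open>i\<close>. Symmetry of
  \<open>q\<close> makes the support of \<open>X\<close> symmetric, which reconciles the two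
  directions.\<close>

definition bcount :: "'a set \<Rightarrow> ('a \<Rightarrow> real) \<Rightarrow> nat pmf" where
  "bcount I p = map_pmf (\<lambda>f. card {e\<in>I. f e}) (Pi_pmf I False (\<lambda>e. bernoulli_pmf (p e)))"

lemma bcount_empty [simp]: "bcount {} p = return_pmf 0"
  by (simp add: bcount_def)

lemma bcount_insert:
  assumes "finite I" "e \<notin> I"
  shows "bcount (insert e I) p =
    bind_pmf (bernoulli_pmf (p e)) (\<lambda>b. map_pmf (\<lambda>c. of_bool b + c) (bcount I p))"
proof -
  have *: "card {e'\<in>insert e I. (f(e := b)) e'} = of_bool b + card {e'\<in>I. f e'}" for f b
  proof -
    have "{e'\<in>insert e I. (f(e := b)) e'} = (if b then {e} else {}) \<union> {e'\<in>I. f e'}"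
      using assms by auto
    then show ?thesis using assms by (auto simp: card_insert_if)
  qed
  show ?thesis unfolding bcount_def using assms
    by (simp only: Pi_pmf_insert'[OF assms] map_bind_pmf map_return_pmf *) (simp add: map_pmf_def bind_assoc_pmf bind_return_pmf)
qed

text \<open>
  In the independent model, a node of community \<open>i\<close> receives a mark from each of \<open>m j\<close> nodes of
  community \<open>j\<close> with probability \<open>q i j\<close>; \<open>h\<close> is its activation threshold.
\<close>

definition reach :: "('k::finite \<Rightarrow> 'k \<Rightarrow> real) \<Rightarrow> 'k \<Rightarrow> ('k \<Rightarrow> nat) \<Rightarrow> nat \<Rightarrow> bool pmf" where
  "reach q i m h = map_pmf (\<lambda>c. h \<le> c) (bcount (SIGMA j:UNIV. {..<m j}) (\<lambda>(j, l). q i j))"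

lemma reach_zero_thr [simp]: "reach q i m 0 = return_pmf True"
  by (simp add: reach_def)

lemma reach_no_marks: "reach q i (\<lambda>_. 0) h = return_pmf (h = 0)"
  by (simp add: reach_def)

text \<open>Peels off the last mark source of community \<open>j\<close>. A successful mark lowers
  the threshold by one, and truncated subtraction leaves a threshold already met at 0.\<close>

lemma reach_step:
  assumes "m j = Suc k"
  shows "reach q i m h = bind_pmf (bernoulli_pmf (q i j)) (\<lambda>b. reach q i (m(j := k)) (h - of_bool b))"
proof -
  have eq: "(SIGMA j:UNIV. {..<m j}) = insert (j, k) (SIGMA j':UNIV. {..<(m(j := k)) j'})"
    using assms by (auto simp: less_Suc_eq split: if_splits)
  have nin: "(j, k) \<notin> (SIGMA j':UNIV. {..<(m(j := k)) j'})" by simp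
  have fin: "finite (SIGMA j':UNIV. {..<(m(j := k)) j'})" by (intro finite_SigmaI) auto
  show ?thesis
    unfolding reach_def eq bcount_insert[OF fin nin] map_bind_pmf map_pmf_comp
    by (intro bind_pmf_cong refl map_pmf_cong) auto
qed

section \<open>Block models on a set of nodes and the star of one node\<close>

definition edge_slots :: "nat set \<Rightarrow> (nat \<times> nat) set" where
  "edge_slots V = {(u, v). u < v \<and> u \<in> V \<and> v \<in> V}"

definition sbm_on :: "nat set \<Rightarrow> (nat \<Rightarrow> 'k) \<Rightarrow> ('k \<Rightarrow> 'k \<Rightarrow> real) \<Rightarrow> (nat \<times> nat \<Rightarrow> bool) pmf" where
  "sbm_on V comm q = Pi_pmf (edge_slots V) False (\<lambda>(u, v). bernoulli_pmf (q (comm u) (comm v)))"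

lemma finite_edge_slots [simp]: "finite V \<Longrightarrow> finite (edge_slots V)"
  by (rule finite_subset[of _ "V \<times> V"]) (auto simp: edge_slots_def)

text \<open>Overwrites the slots at \<open>u\<close> by the star \<open>e\<close>. There are two
  branches because a slot lists its smaller node first, so \<open>u\<close> may be either
  coordinate.\<close>

definition add_star :: "nat set \<Rightarrow> nat \<Rightarrow> (nat \<Rightarrow> bool) \<Rightarrow> (nat \<times> nat \<Rightarrow> bool) \<Rightarrow> nat \<times> nat \<Rightarrow> bool" where
  "add_star V u e E = (\<lambda>x. if x \<in> edge_slots V \<and> fst x = u then e (snd x)
     else if x \<in> edge_slots V \<and> snd x = u then e (fst x) else E x)"

lemma adjacent_add_star:
  assumes "u \<in> V" "v \<in> V" "v \<noteq> u"
  shows "adjacent (add_star V u e E) u v \<longleftrightarrow> e v" "adjacent (add_star V u e E) v u \<longleftrightarrow> e v"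
  using assms by (auto simp: adjacent_def add_star_def edge_slots_def)

lemma adjacent_add_star_other:
  assumes "v \<noteq> u" "w \<noteq> u"
  shows "adjacent (add_star V u e E) v w \<longleftrightarrow> adjacent E v w"
  using assms by (auto simp: adjacent_def add_star_def edge_slots_def)

text \<open>Both sides obey the same recursion when a point is inserted. It serves to index the
  edges at a node by their other endpoints.\<close>

lemma Pi_pmf_reindex:
  assumes "finite A" "inj_on h A"
  shows "Pi_pmf (h ` A) d p = map_pmf (\<lambda>f y. if y \<in> h ` A then f (the_inv_into A h y) else d)
           (Pi_pmf A d (\<lambda>x. p (h x)))"
  using assms
proof (induction A rule: finite_induct)
  case empty
  then show ?case by simp
next
  case (insert x A)
  have inj: "inj_on h A" and hx: "h x \<notin> h ` A" using insert.prems insert.hyps(2) by auto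
  have inv: "the_inv_into (insert x A) h (h z) = z" if "z \<in> insert x A" for z
    using the_inv_into_f_f[OF insert.prems that] .
  have inv': "the_inv_into A h (h z) = z" if "z \<in> A" for z
    using the_inv_into_f_f[OF inj that] .
  have upd: "(\<lambda>y. if y \<in> h ` insert x A then (f(x := b)) (the_inv_into (insert x A) h y) else d)
      = (\<lambda>y. if y \<in> h ` A then f (the_inv_into A h y) else d)(h x := b)" for f b
  proof
    fix y
    consider "y = h x" | z where "z \<in> A" "y = h z" "y \<noteq> h x" | "y \<notin> h ` insert x A" by auto
    then show "(if y \<in> h ` insert x A then (f(x := b)) (the_inv_into (insert x A) h y) else d)
      = ((\<lambda>y. if y \<in> h ` A then f (the_inv_into A h y) else d)(h x := b)) y"
      using hx inv inv' by cases (auto simp: insert.hyps)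
  qed
  show ?case
    unfolding image_insert Pi_pmf_insert'[OF finite_imageI[OF insert.hyps(1)] hx]
      Pi_pmf_insert'[OF insert.hyps] insert.IH[OF inj]
    by (simp only: map_bind_pmf map_return_pmf upd[unfolded image_insert])
       (simp add: map_pmf_def bind_assoc_pmf bind_return_pmf del: fun_upd_apply)
qed

lemma sbm_on_split:
  assumes fin: "finite V" and u: "u \<in> V" and sym: "\<And>i j. q i j = q j i"
  shows "sbm_on V comm q =
    bind_pmf (Pi_pmf (V - {u}) False (\<lambda>v. bernoulli_pmf (q (comm v) (comm u))))
      (\<lambda>e. map_pmf (add_star V u e) (sbm_on (V - {u}) comm q))"
proof -
  \<comment> \<open>The slot of the edge between \<open>u\<close> and \<open>v\<close>. Since
    \<open>u\<close> may come first or second in it, symmetry of \<open>q\<close> is what gives all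
    these edges a uniform law.\<close>
  define h where "h v = (min u v, max u v)" for v
  have inj: "inj_on h (V - {u})" by (auto simp: inj_on_def h_def min_def max_def split: if_splits)
  have slots: "edge_slots V = h ` (V - {u}) \<union> edge_slots (V - {u})"
  proof (intro set_eqI iffI)
    fix x assume x: "x \<in> edge_slots V"
    obtain a b where ab: "x = (a, b)" by (cases x)
    show "x \<in> h ` (V - {u}) \<union> edge_slots (V - {u})"
    proof (cases "a = u \<or> b = u")
      case True
      then have "x = h (if a = u then b else a)" "(if a = u then b else a) \<in> V - {u}"
        using x ab by (auto simp: edge_slots_def h_def)
      then show ?thesis by blast
    qed (use x ab in \<open>auto simp: edge_slots_def\<close>)
  qed (use u in \<open>auto simp: edge_slots_def h_def min_def max_def\<close>)
  have disj: "h ` (V - {u}) \<inter> edge_slots (V - {u}) = {}"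
    by (auto simp: edge_slots_def h_def min_def max_def split: if_splits)
  have ber: "(\<lambda>v. (\<lambda>(u, v). bernoulli_pmf (q (comm u) (comm v))) (h v))
      = (\<lambda>v. bernoulli_pmf (q (comm v) (comm u)))"
    by (auto simp: h_def min_def max_def fun_eq_iff sym)
  have comb: "(\<lambda>x. if x \<in> h ` (V - {u}) then
        (\<lambda>y. if y \<in> h ` (V - {u}) then e (the_inv_into (V - {u}) h y) else False) x else E x)
      = add_star V u e E" for e E
  proof
    fix x
    show "(if x \<in> h ` (V - {u}) then
        (\<lambda>y. if y \<in> h ` (V - {u}) then e (the_inv_into (V - {u}) h y) else False) x else E x)
      = add_star V u e E x"
    proof (cases "x \<in> h ` (V - {u})")
      case True
      then obtain v where v: "v \<in> V - {u}" "x = h v" by auto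
      have "the_inv_into (V - {u}) h x = v" using the_inv_into_f_f[OF inj v(1)] v by simp
      then show ?thesis using True v u
        by (auto simp: add_star_def edge_slots_def h_def min_def max_def)
    next
      case False
      have "\<not> (x \<in> edge_slots V \<and> (fst x = u \<or> snd x = u))"
        using False slots by (auto simp: edge_slots_def)
      then show ?thesis using False by (auto simp: add_star_def)
    qed
  qed
  have "sbm_on V comm q = bind_pmf (Pi_pmf (h ` (V - {u})) False (\<lambda>(u, v). bernoulli_pmf (q (comm u) (comm v))))
     (\<lambda>f. map_pmf (\<lambda>E x. if x \<in> h ` (V - {u}) then f x else E x) (sbm_on (V - {u}) comm q))"
    unfolding sbm_on_def slots
    by (subst Pi_pmf_union) (use fin disj in \<open>auto simp: pair_pmf_def map_pmf_def bind_assoc_pmf bind_return_pmf\<close>)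
  also have "\<dots> = bind_pmf (Pi_pmf (V - {u}) False (\<lambda>v. bernoulli_pmf (q (comm v) (comm u))))
      (\<lambda>e. map_pmf (add_star V u e) (sbm_on (V - {u}) comm q))"
    unfolding Pi_pmf_reindex[OF finite_Diff[OF fin] inj] ber bind_map_pmf comb ..
  finally show ?thesis .
qed

section \<open>Percolation with node-dependent thresholds\<close>

definition closed_in :: "nat set \<Rightarrow> (nat \<Rightarrow> nat) \<Rightarrow> (nat \<times> nat \<Rightarrow> bool) \<Rightarrow> nat set \<Rightarrow> bool" where
  "closed_in V \<theta> E W \<longleftrightarrow> W \<subseteq> V \<and> (\<forall>v\<in>V. \<theta> v \<le> card {u\<in>W. adjacent E u v} \<longrightarrow> v \<in> W)"

text \<open>The final active set as a least closed set, a seed being a node of threshold 0.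
  Arbitrary thresholds make this class of processes stable under removing an explored node.\<close>

definition spread :: "nat set \<Rightarrow> (nat \<Rightarrow> nat) \<Rightarrow> (nat \<times> nat \<Rightarrow> bool) \<Rightarrow> nat set" where
  "spread V \<theta> E = \<Inter>{W. closed_in V \<theta> E W}"

lemma spread_subset: "spread V \<theta> E \<subseteq> V"
  by (auto simp: spread_def closed_in_def)

lemma spread_no_source:
  assumes "\<And>v. v \<in> V \<Longrightarrow> \<theta> v \<noteq> 0"
  shows "spread V \<theta> E = {}"
proof -
  have "closed_in V \<theta> E {}" using assms by (auto simp: closed_in_def)
  then show ?thesis by (auto simp: spread_def)
qed

text \<open>A node of threshold 0 lies in every closed set. Removing it is therefore a bijection
  onto the closed sets of the remaining graph, where its contribution to each neighbour is moved
  into the threshold.\<close>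

lemma spread_add_star:
  assumes fin: "finite V" and u: "u \<in> V" and zero: "\<theta> u = 0"
  shows "spread V \<theta> (add_star V u e E) = insert u (spread (V - {u}) (\<lambda>v. \<theta> v - of_bool (e v)) E)"
proof -
  let ?E = "add_star V u e E" and ?th = "\<lambda>v. \<theta> v - of_bool (e v)"
  have card: "card {x\<in>insert u W. adjacent ?E x v} = of_bool (e v) + card {x\<in>W. adjacent E x v}"
    if W: "W \<subseteq> V - {u}" and v: "v \<in> V - {u}" for W v
  proof -
    have "{x\<in>insert u W. adjacent ?E x v} = (if e v then {u} else {}) \<union> {x\<in>W. adjacent E x v}"
    proof -
      have "adjacent ?E x v \<longleftrightarrow> adjacent E x v" if "x \<in> W" for x
        using that W v by (intro adjacent_add_star_other) auto
      moreover have "adjacent ?E u v \<longleftrightarrow> e v" using v u by (intro adjacent_add_star) auto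
      ultimately show ?thesis by auto
    qed
    moreover have "finite W" "u \<notin> W" using W fin by (auto intro: finite_subset)
    ultimately show ?thesis by (auto simp: card_insert_if)
  qed
  have "{W. closed_in V \<theta> ?E W} = insert u ` {W. closed_in (V - {u}) ?th E W}"
  proof (intro set_eqI iffI)
    fix W assume "W \<in> {W. closed_in V \<theta> ?E W}"
    then have W: "closed_in V \<theta> ?E W" by simp
    then have uW: "u \<in> W" using u zero by (auto simp: closed_in_def)
    then have ins: "insert u (W - {u}) = W" by auto
    have "closed_in (V - {u}) ?th E (W - {u})"
      unfolding closed_in_def
    proof (intro conjI ballI impI)
      show sub: "W - {u} \<subseteq> V - {u}" using W by (auto simp: closed_in_def)
      fix v assume v: "v \<in> V - {u}" and "?th v \<le> card {x \<in> W - {u}. adjacent E x v}"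
      then have "\<theta> v \<le> card {x\<in>W. adjacent ?E x v}"
        using card[OF sub v] unfolding ins by simp
      then show "v \<in> W - {u}" using W v by (auto simp: closed_in_def)
    qed
    then show "W \<in> insert u ` {W. closed_in (V - {u}) ?th E W}"
      by - (rule image_eqI[of W "insert u" "W - {u}", OF ins[symmetric]], simp)
  next
    fix W assume "W \<in> insert u ` {W. closed_in (V - {u}) ?th E W}"
    then obtain W' where W': "W = insert u W'" "closed_in (V - {u}) ?th E W'" by auto
    have "closed_in V \<theta> ?E W"
      unfolding closed_in_def
    proof (intro conjI ballI impI)
      show "W \<subseteq> V" using W' u by (auto simp: closed_in_def)
      fix v assume v: "v \<in> V" and le: "\<theta> v \<le> card {x \<in> W. adjacent ?E x v}"
      show "v \<in> W"
      proof (cases "v = u")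
        case False
        then have "?th v \<le> card {x \<in> W'. adjacent E x v}"
          using card[of W' v] le v W' by (simp add: closed_in_def)
        then show ?thesis using W' v False by (auto simp: closed_in_def)
      qed (use W' in auto)
    qed
    then show "W \<in> {W. closed_in V \<theta> ?E W}" by simp
  qed
  \<comment> \<open>Inserting \<open>u\<close> commutes with an intersection only over a nonempty
    family; the full remaining node set is a member.\<close>
  moreover have "closed_in (V - {u}) ?th E (V - {u})" by (auto simp: closed_in_def)
  moreover have "\<Inter> (insert u ` C) = insert u (\<Inter> C)" if "C \<noteq> {}" for C :: "nat set set"
    using that by auto
  ultimately show ?thesis unfolding spread_def by (metis empty_iff mem_Collect_eq)
qed

definition census :: "(nat \<Rightarrow> 'k) \<Rightarrow> nat set \<Rightarrow> 'k \<Rightarrow> nat" where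
  "census comm W i = card {v\<in>W. comm v = i}"

lemma census_empty [simp]: "census comm {} = (\<lambda>_. 0)"
  by (simp add: census_def fun_eq_iff)

lemma census_insert:
  assumes "finite W" "u \<notin> W"
  shows "census comm (insert u W) = (census comm W)(comm u := Suc (census comm W (comm u)))"
proof
  fix i
  have "{v\<in>insert u W. comm v = i} = (if comm u = i then {u} else {}) \<union> {v\<in>W. comm v = i}" by auto
  then show "census comm (insert u W) i = ((census comm W)(comm u := Suc (census comm W (comm u)))) i"
    using assms by (auto simp: census_def)
qed

text \<open>Every round stays inside every closed set. Conversely the union of the rounds is closed:
  it is finite, so all its members are already active in one common round, and the next round
  activates whatever they force.\<close>

lemma final_active_eq_spread:
  assumes "S \<subseteq> {..<n}" "r > 0"
  shows "final_active r n E S = spread {..<n} (\<lambda>v. if v \<in> S then 0 else r) E"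
proof
  let ?th = "\<lambda>v. if v \<in> S then 0 else r"
  have sub: "active_after r n E S t \<subseteq> {..<n}" for t
    by (induction t) (use assms in auto)
  have mono: "active_after r n E S t \<subseteq> active_after r n E S t'" if "t \<le> t'" for t t'
    using that by (induction rule: dec_induct) auto
  have "active_after r n E S t \<subseteq> W" if W: "closed_in {..<n} ?th E W" for t W
  proof (induction t)
    case 0
    then show ?case using W assms by (auto simp: closed_in_def)
  next
    case (Suc t)
    have "v \<in> W" if "v < n" "r \<le> card {u \<in> active_after r n E S t. adjacent E u v}" for v
    proof -
      have "finite W" using W by (auto simp: closed_in_def intro: finite_subset)
      then have "card {u \<in> active_after r n E S t. adjacent E u v} \<le> card {u \<in> W. adjacent E u v}"
        using Suc by (intro card_mono) auto
      then show ?thesis using W that by (auto simp: closed_in_def split: if_splits)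
    qed
    then show ?case using Suc by auto
  qed
  then show "final_active r n E S \<subseteq> spread {..<n} ?th E"
    by (auto simp: final_active_def spread_def)
  have "closed_in {..<n} ?th E (final_active r n E S)"
    unfolding closed_in_def
  proof (intro conjI ballI impI)
    show fsub: "final_active r n E S \<subseteq> {..<n}" using sub by (auto simp: final_active_def)
    fix v assume v: "v \<in> {..<n}" and le: "?th v \<le> card {u \<in> final_active r n E S. adjacent E u v}"
    show "v \<in> final_active r n E S"
    proof (cases "v \<in> S")
      case True
      have "v \<in> active_after r n E S 0" using True by simp
      then show ?thesis unfolding final_active_def by blast
    next
      case False
      have fin: "finite (final_active r n E S)" using fsub by (rule finite_subset) auto
      have "\<exists>t. final_active r n E S \<subseteq> active_after r n E S t"
      proof -
        have "\<forall>x\<in>final_active r n E S. \<exists>t. x \<in> active_after r n E S t"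
          by (auto simp: final_active_def)
        then obtain T where T: "\<And>x. x \<in> final_active r n E S \<Longrightarrow> x \<in> active_after r n E S (T x)"
          by metis
        have "x \<in> active_after r n E S (Max (T ` final_active r n E S))" if "x \<in> final_active r n E S" for x
          using mono[of "T x" "Max (T ` final_active r n E S)"] T[OF that] fin that by auto
        then show ?thesis by blast
      qed
      then obtain t where t: "final_active r n E S \<subseteq> active_after r n E S t" by blast
      have "card {u \<in> final_active r n E S. adjacent E u v} \<le> card {u \<in> active_after r n E S t. adjacent E u v}"
        using t sub[of t] by (intro card_mono) (auto intro: finite_subset)
      then have "v \<in> active_after r n E S (Suc t)" using le v False by auto
      then show ?thesis unfolding final_active_def by blast
    qed
  qed
  then show "spread {..<n} ?th E \<subseteq> final_active r n E S"
    by (auto simp: spread_def)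
qed

lemma emeasure_bind_pmf_mono:
  assumes "\<And>x. x \<in> set_pmf M \<Longrightarrow> emeasure (measure_pmf (f x)) A \<le> emeasure (measure_pmf (g x)) B"
  shows "emeasure (measure_pmf (bind_pmf M f)) A \<le> emeasure (measure_pmf (bind_pmf M g)) B"
  unfolding emeasure_bind_pmf
  by (intro nn_integral_mono_AE) (use assms in \<open>auto simp: AE_measure_pmf_iff\<close>)

text \<open>
  \<open>c\<close> counts the nodes explored so far and \<open>m\<close> those still to be explored before \<open>t\<close> is reached.
  Both sides are compared after revealing the edges of one active node: the left side recurses by
  \<open>spread_add_star\<close>, the right side by \<open>reach_step\<close>.
\<close>

lemma exploration_bound:
  fixes comm :: "nat \<Rightarrow> 'k::finite" and b b' :: bool and t :: "'k \<Rightarrow> nat"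
  defines "B \<equiv> \<lambda>f. b \<and> f = t \<or> b' \<and> \<not> f \<le> t"
  assumes sym: "\<And>i j. q i j = q j i"
    and "finite V" and "\<And>i. c i + m i = t i"
  shows "emeasure (sbm_on V comm q) {E. B (\<lambda>i. c i + census comm (spread V \<theta> E) i)}
    \<le> emeasure (Pi_pmf V False (\<lambda>v. reach q (comm v) m (\<theta> v)))
        {Y. B (\<lambda>i. c i + census comm {v\<in>V. Y v} i)}"
  using assms(3,4)
proof (induction "card V" arbitrary: V \<theta> c m)
  case (0 V)
  then have "V = {}" by simp
  then have "spread V \<theta> E = {}" for E using spread_subset[of V \<theta> E] by simp
  then show ?case using \<open>V = {}\<close> by (simp add: sbm_on_def edge_slots_def)
next
  case (Suc d V)
  note fin = \<open>finite V\<close> and cm = \<open>\<And>i. c i + m i = t i\<close>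
  show ?case
  proof (cases "\<exists>u\<in>V. \<theta> u = 0")
    case False
    then have spread: "spread V \<theta> E = {}" for E by (intro spread_no_source) auto
    show ?thesis
    \<comment> \<open>Without a source the exploration stops at \<open>c\<close>. If all marks are
      spent, no node of positive threshold is marked and both counts are \<open>c\<close>; otherwise
      \<open>c\<close> is below \<open>t\<close> and different from it, so the left event is
      impossible. This is where equality of the two sides is lost.\<close>
    proof (cases "m = (\<lambda>_. 0)")
      case True
      have "Pi_pmf V False (\<lambda>v. reach q (comm v) m (\<theta> v)) = Pi_pmf V False (\<lambda>v. return_pmf False)"
        by (intro Pi_pmf_cong) (use True False in \<open>auto simp: reach_no_marks\<close>)
      also have "\<dots> = return_pmf (\<lambda>_. False)" using fin by simp
      finally show ?thesis by (auto simp: spread indicator_def)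
    next
      case m: False
      have "\<not> B c"
      proof -
        have "c \<le> t" using cm by (simp add: le_fun_def) (metis le_add1)
        moreover have "c \<noteq> t" using cm m by (metis add_eq_self_zero ext)
        ultimately show ?thesis by (simp add: B_def)
      qed
      then show ?thesis by (simp add: spread)
    qed
  next
    case True
    then obtain u where u: "u \<in> V" "\<theta> u = 0" by blast
    define j where "j = comm u"
    define V' where "V' = V - {u}"
    have V': "finite V'" "u \<notin> V'" "V = insert u V'" "d = card V'"
      using fin u Suc.hyps(2) by (auto simp: V'_def)
    define cc where "cc = (\<lambda>W i. c i + census comm W i)"
    have cc_ins: "cc (insert u W) = (\<lambda>i. (c(j := Suc (c j))) i + census comm W i)" if "W \<subseteq> V'" for W
    proof -
      have "finite W" "u \<notin> W" using that V' finite_subset by auto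
      then show ?thesis by (simp add: census_insert cc_def fun_eq_iff j_def)
    qed
    have R: "Pi_pmf V False (\<lambda>v. reach q (comm v) m (\<theta> v))
        = map_pmf (\<lambda>Y. Y(u := True)) (Pi_pmf V' False (\<lambda>v. reach q (comm v) m (\<theta> v)))"
      unfolding V'(3) Pi_pmf_insert'[OF V'(1,2)] using u by (simp add: bind_return_pmf map_pmf_def)
    have Yset: "{v\<in>V. (Y(u := True)) v} = insert u {v\<in>V'. Y v}" for Y
      using V' by auto
    have RR: "emeasure (Pi_pmf V False (\<lambda>v. reach q (comm v) m (\<theta> v))) {Y. B (cc {v\<in>V. Y v})}
      = emeasure (Pi_pmf V' False (\<lambda>v. reach q (comm v) m (\<theta> v)))
         {Y. B (\<lambda>i. (c(j := Suc (c j))) i + census comm {v\<in>V'. Y v} i)}"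
      unfolding R emeasure_map_pmf vimage_def mem_Collect_eq Yset
      by (subst cc_ins) auto
    have sp: "spread V \<theta> (add_star V u e E) = insert u (spread V' (\<lambda>v. \<theta> v - of_bool (e v)) E)" for e E
      unfolding V'_def by (rule spread_add_star[where \<theta> = \<theta>, OF fin u])
    have L: "sbm_on V comm q =
      bind_pmf (Pi_pmf V' False (\<lambda>v. bernoulli_pmf (q (comm v) j)))
        (\<lambda>e. map_pmf (add_star V u e) (sbm_on V' comm q))"
      unfolding V'_def j_def by (rule sbm_on_split[OF fin u(1) sym])
    have LL: "emeasure (map_pmf (add_star V u e) (sbm_on V' comm q)) {E. B (cc (spread V \<theta> E))} =
       emeasure (sbm_on V' comm q)
        {E. B (\<lambda>i. (c(j := Suc (c j))) i + census comm (spread V' (\<lambda>v. \<theta> v - of_bool (e v)) E) i)}" for e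
      unfolding emeasure_map_pmf vimage_def mem_Collect_eq sp
      by (subst cc_ins) (auto simp: spread_subset)
    have "emeasure (sbm_on V comm q) {E. B (cc (spread V \<theta> E))}
      \<le> emeasure (Pi_pmf V False (\<lambda>v. reach q (comm v) m (\<theta> v))) {Y. B (cc {v\<in>V. Y v})}"
    \<comment> \<open>With no mark left for community \<open>j\<close>, its count already equals
      \<open>t j\<close>. Adding \<open>u\<close> exceeds \<open>t\<close> on both sides whatever
      happens later, so the event reduces to \<open>b'\<close>.\<close>
    proof (cases "m j")
      case 0
      then have "c j = t j" using cm[of j] by simp
      then have "\<not> (\<lambda>i. (c(j := Suc (c j))) i + n i) \<le> t" for n
        by (auto simp: le_fun_def intro!: exI[of _ j])
      moreover from this have "(\<lambda>i. (c(j := Suc (c j))) i + n i) \<noteq> t" for n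
        by (metis order_refl)
      ultimately have Bb: "B (\<lambda>i. (c(j := Suc (c j))) i + n i) = b'" for n
        unfolding B_def by blast
      show ?thesis
        unfolding RR L emeasure_bind_pmf LL Bb by (cases b') auto
    next
      case (Suc k)
      have cm': "(c(j := Suc (c j))) i + (m(j := k)) i = t i" for i
        using cm[of i] Suc by auto
      have split: "Pi_pmf V' False (\<lambda>v. reach q (comm v) m (\<theta> v)) =
        bind_pmf (Pi_pmf V' False (\<lambda>v. bernoulli_pmf (q (comm v) j)))
          (\<lambda>e. Pi_pmf V' False (\<lambda>v. reach q (comm v) (m(j := k)) (\<theta> v - of_bool (e v))))"
        unfolding reach_step[of m j k, OF Suc] by (rule Pi_pmf_bind[OF V'(1)])
      show ?thesis
        unfolding RR L split
        by (intro emeasure_bind_pmf_mono) (simp only: LL Suc.hyps(1)[OF V'(4,1) cm'])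
    qed
    then show ?thesis by (simp add: cc_def)
  qed
qed

section \<open>Tail bounds for sums of independent indicators\<close>

lemma measure_bcount_insert:
  assumes "finite I" "e \<notin> I" "0 \<le> p e" "p e \<le> 1"
  shows "measure (bcount (insert e I) p) A =
    p e * measure (bcount I p) {c. Suc c \<in> A} + (1 - p e) * measure (bcount I p) A"
proof -
  have "emeasure (bcount (insert e I) p) A =
      ennreal (measure (bcount I p) {c. Suc c \<in> A}) * ennreal (p e) + ennreal (measure (bcount I p) A) * ennreal (1 - p e)"
    unfolding bcount_insert[OF assms(1,2)] emeasure_bind_pmf using assms(3,4)
    by (simp add: measure_pmf.emeasure_eq_measure vimage_def)
  also have "\<dots> = ennreal (p e * measure (bcount I p) {c. Suc c \<in> A} + (1 - p e) * measure (bcount I p) A)"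
    using assms(3,4) by (simp add: ennreal_mult[symmetric] ennreal_plus[symmetric] mult.commute del: ennreal_plus)
  finally show ?thesis
    using assms(3,4) by (simp add: measure_pmf.emeasure_eq_measure del: ennreal_plus)
qed

text \<open>The sign of \<open>l\<close> selects the tail, so one induction covers both.
  Conditioning on the new trial shifts the level \<open>x\<close> by one, and
  \<open>1 + y \<le> exp y\<close> restores the exponential form.\<close>

lemma bcount_chernoff:
  assumes "finite I" "\<And>e. e \<in> I \<Longrightarrow> 0 \<le> p e \<and> p e \<le> 1"
  shows "measure (bcount I p) {c. 0 \<le> l * (real c - x)} \<le> exp (- l * x + (exp l - 1) * sum p I)"
  using assms
proof (induction I arbitrary: x rule: finite_induct)
  case empty
  then show ?case by (simp add: indicator_def)
next
  case (insert e I)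
  let ?S = "sum p I"
  have p: "0 \<le> p e" "p e \<le> 1" using insert.prems by auto
  have IH: "measure (bcount I p) {c. 0 \<le> l * (real c - x)} \<le> exp (- l * x + (exp l - 1) * ?S)" for x
    using insert.IH insert.prems by auto
  have "measure (bcount (insert e I) p) {c. 0 \<le> l * (real c - x)} =
     p e * measure (bcount I p) {c. 0 \<le> l * (real c - (x - 1))} + (1 - p e) * measure (bcount I p) {c. 0 \<le> l * (real c - x)}"
    unfolding measure_bcount_insert[where p = p, OF insert.hyps p] by (simp add: algebra_simps)
  also have "\<dots> \<le> p e * exp (- l * (x - 1) + (exp l - 1) * ?S) + (1 - p e) * exp (- l * x + (exp l - 1) * ?S)"
    using p by (intro add_mono mult_left_mono IH) auto
  also have "\<dots> = exp (- l * x + (exp l - 1) * ?S) * (1 + p e * (exp l - 1))"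
    by (simp add: algebra_simps exp_add exp_diff exp_minus field_simps)
  also have "\<dots> \<le> exp (- l * x + (exp l - 1) * ?S) * exp (p e * (exp l - 1))"
    by (intro mult_left_mono exp_ge_add_one_self) auto
  also have "\<dots> = exp (- l * x + (exp l - 1) * sum p (insert e I))"
    using insert.hyps by (simp add: exp_add[symmetric] algebra_simps)
  finally show ?case .
qed

lemma exp_le_quadratic:
  assumes "\<bar>x :: real\<bar> \<le> 1"
  shows "exp x \<le> 1 + x + x\<^sup>2"
proof (cases "0 \<le> x")
  case True
  then show ?thesis using exp_bound[of x] assms by simp
next
  case False
  define y where "y = - x"
  have y: "0 < y" "y \<le> 1" using False assms by (auto simp: y_def)
  have "exp x = inverse (exp y)" by (simp add: y_def exp_minus)
  also have "\<dots> \<le> inverse (1 + y)"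
    using exp_ge_add_one_self[of y] y by (intro le_imp_inverse_le) auto
  also have "\<dots> \<le> 1 - y + y\<^sup>2"
  proof -
    \<comment> \<open>The product equals \<open>1 + y ^ 3\<close>.\<close>
    have "1 \<le> (1 - y + y\<^sup>2) * (1 + y)" using y by (simp add: algebra_simps power2_eq_square)
    then show ?thesis using y by (simp add: inverse_eq_divide pos_divide_le_eq)
  qed
  finally show ?thesis by (simp add: y_def)
qed

lemma bcount_upper_tail:
  assumes "finite I" "\<And>e. e \<in> I \<Longrightarrow> 0 \<le> p e \<and> p e \<le> 1"
    and "0 \<le> M" "0 < \<delta>" "0 \<le> g" "sum p I \<le> M * g" "(M + \<delta>) * g \<le> x"
  shows "measure (bcount I p) {c. x \<le> real c} \<le> exp (- (\<delta>\<^sup>2 / (4 * (M + \<delta>))) * g)"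
proof -
  \<comment> \<open>The exponent is at most \<open>- l * \<delta> * g + l * (l * M) * g\<close>.
    This \<open>l\<close> is at most 1, so the quadratic bound for \<open>exp\<close> applies, and
    it keeps \<open>l * M\<close> below \<open>\<delta> / 2\<close>, so half of the linear gain
    survives.\<close>
  define l where "l = \<delta> / (2 * (M + \<delta>))"
  have l: "0 < l" "l \<le> 1" using assms by (auto simp: l_def field_simps)
  have lM: "l * M \<le> \<delta> / 2" using assms by (simp add: l_def field_simps)
  have "measure (bcount I p) {c. x \<le> real c} = measure (bcount I p) {c. 0 \<le> l * (real c - x)}"
    using l by (simp add: zero_le_mult_iff)
  also have "\<dots> \<le> exp (- l * x + (exp l - 1) * sum p I)"
    by (rule bcount_chernoff[OF assms(1,2)])
  also have "- l * x + (exp l - 1) * sum p I \<le> - l * ((M + \<delta>) * g) + (l + l\<^sup>2) * (M * g)"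
    using exp_le_quadratic[of l] l assms(3-7)
    by (intro add_mono mult_mono mult_left_mono_neg sum_nonneg) (use assms(2) in auto)
  also have "\<dots> = - l * \<delta> * g + l * (l * M) * g" by (simp add: algebra_simps power2_eq_square)
  also have "\<dots> \<le> - l * \<delta> * g + l * (\<delta> / 2) * g"
    using l lM assms by (intro add_left_mono mult_right_mono mult_left_mono) auto
  also have "\<dots> = - (\<delta>\<^sup>2 / (4 * (M + \<delta>))) * g"
  proof -
    have "l * \<delta> / 2 = \<delta>\<^sup>2 / (4 * (M + \<delta>))" by (simp add: l_def power2_eq_square)
    then show ?thesis by (simp only: flip: \<open>l * \<delta> / 2 = _\<close>) (simp add: algebra_simps)
  qed
  finally show ?thesis by simp
qed

text \<open>The cap \<open>M * g\<close> is imposed on a lower bound \<open>m\<close> of the mean,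
  as the mean itself may be far larger. Such an \<open>m\<close> may be negative, whence the case
  distinction.\<close>

lemma bcount_lower_tail:
  assumes "finite I" "\<And>e. e \<in> I \<Longrightarrow> 0 \<le> p e \<and> p e \<le> 1"
    and "0 \<le> M" "0 < \<delta>" "0 \<le> g" "m \<le> sum p I" "m \<le> M * g" "x \<le> m - \<delta> * g"
  shows "measure (bcount I p) {c. real c \<le> x} \<le> exp (- (\<delta>\<^sup>2 / (4 * (M + \<delta>))) * g)"
proof -
  define l where "l = \<delta> / (2 * (M + \<delta>))"
  have l: "0 < l" "l \<le> 1" using assms by (auto simp: l_def field_simps)
  have lM: "l * M \<le> \<delta> / 2" using assms by (simp add: l_def field_simps)
  have "measure (bcount I p) {c. real c \<le> x} = measure (bcount I p) {c. 0 \<le> - l * (real c - x)}"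
    using l by (simp add: mult_le_0_iff not_less)
  also have "\<dots> \<le> exp (- (- l) * x + (exp (- l) - 1) * sum p I)"
    by (rule bcount_chernoff[OF assms(1,2)])
  also have "- (- l) * x + (exp (- l) - 1) * sum p I \<le> l * (m - \<delta> * g) + (exp (- l) - 1) * m"
    using l assms by (intro add_mono) (auto intro: mult_left_mono mult_left_mono_neg)
  also have "\<dots> \<le> l * (m - \<delta> * g) + (- l * m + l\<^sup>2 * (M * g))"
  proof (cases "0 \<le> m")
    case True
    have "(exp (- l) - 1) * m \<le> (- l + l\<^sup>2) * m"
      using exp_le_quadratic[of "- l"] l True by (intro mult_right_mono) auto
    also have "\<dots> \<le> - l * m + l\<^sup>2 * (M * g)"
      using mult_left_mono[OF assms(7), of "l\<^sup>2"] by (simp add: algebra_simps)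
    finally show ?thesis by simp
  next
    case False
    have "(exp (- l) - 1) * m \<le> - l * m"
      using exp_ge_add_one_self[of "- l"] False by (intro mult_right_mono_neg) auto
    also have "\<dots> \<le> - l * m + l\<^sup>2 * (M * g)" using assms by simp
    finally show ?thesis by simp
  qed
  also have "\<dots> = - l * \<delta> * g + l * (l * M) * g" by (simp add: algebra_simps power2_eq_square)
  also have "\<dots> \<le> - l * \<delta> * g + l * (\<delta> / 2) * g"
    using l lM assms by (intro add_left_mono mult_right_mono mult_left_mono) auto
  also have "\<dots> = - (\<delta>\<^sup>2 / (4 * (M + \<delta>))) * g"
  proof -
    have "l * \<delta> / 2 = \<delta>\<^sup>2 / (4 * (M + \<delta>))" by (simp add: l_def power2_eq_square)
    then show ?thesis by (simp only: flip: \<open>l * \<delta> / 2 = _\<close>) (simp add: algebra_simps)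
  qed
  finally show ?thesis by simp
qed

section \<open>Polynomial bounds for the probability of at least \<open>r\<close> successes\<close>

lemma power_Suc_diff_le:
  assumes "0 \<le> b" "b \<le> (a :: real)"
  shows "a ^ Suc n - b ^ Suc n \<le> real (Suc n) * (a - b) * a ^ n"
proof (induction n)
  case (Suc n)
  have "a ^ Suc (Suc n) - b ^ Suc (Suc n) = a * (a ^ Suc n - b ^ Suc n) + (a - b) * b ^ Suc n"
    by (simp add: algebra_simps)
  also have "\<dots> \<le> a * (real (Suc n) * (a - b) * a ^ n) + (a - b) * a ^ Suc n"
    using assms by (intro add_mono mult_left_mono Suc.IH power_mono) auto
  also have "\<dots> = real (Suc (Suc n)) * (a - b) * a ^ Suc n" by (simp add: algebra_simps)
  finally show ?case .
qed simp

text \<open>Union bound over the \<open>r\<close>-element sets of successes: the elementary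
  symmetric polynomial of degree \<open>r\<close> in the probabilities is at most the right-hand
  side. In the induction this becomes a Bernoulli-type inequality for
  \<open>(p e + ?S) ^ Suc s\<close>.\<close>

lemma bcount_ge_upper:
  assumes "finite I" "\<And>e. e \<in> I \<Longrightarrow> 0 \<le> p e \<and> p e \<le> 1"
  shows "measure (bcount I p) {c. r \<le> c} \<le> sum p I ^ r / fact r"
  using assms
proof (induction I arbitrary: r rule: finite_induct)
  case empty
  then show ?case by (cases r) auto
next
  case (insert e I)
  let ?S = "sum p I"
  have p: "0 \<le> p e" "p e \<le> 1" "0 \<le> ?S" using insert.prems by (auto intro: sum_nonneg)
  show ?case
  proof (cases r)
    case (Suc s)
    have "measure (bcount (insert e I) p) {c. r \<le> c} =
        p e * measure (bcount I p) {c. s \<le> c} + (1 - p e) * measure (bcount I p) {c. r \<le> c}"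
      unfolding measure_bcount_insert[where p = p, OF insert.hyps p(1,2)] using Suc by simp
    also have "\<dots> \<le> p e * (?S ^ s / fact s) + 1 * (?S ^ r / fact r)"
      using p insert.prems by (intro add_mono mult_mono insert.IH) auto
    also have "\<dots> = (?S ^ Suc s + real (Suc s) * p e * ?S ^ s) / fact r"
    proof -
      obtain n where n: "real (Suc s) = n" "n > 0" by simp
      have "fact r = n * fact s" using Suc n by simp
      then show ?thesis using n(2) Suc unfolding n(1) by (simp add: field_simps)
    qed
    also have "?S ^ Suc s + real (Suc s) * p e * ?S ^ s \<le> (p e + ?S) ^ Suc s"
    proof (induction s)
      case (Suc s)
      have "?S ^ Suc (Suc s) + real (Suc (Suc s)) * p e * ?S ^ Suc s
        = ?S * (?S ^ Suc s + real (Suc s) * p e * ?S ^ s) + p e * ?S ^ Suc s"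
        by (simp add: algebra_simps)
      also have "\<dots> \<le> ?S * (p e + ?S) ^ Suc s + p e * (p e + ?S) ^ Suc s"
        using p Suc.IH by (intro add_mono mult_left_mono power_mono) auto
      finally show ?case by (simp add: algebra_simps)
    qed simp
    finally show ?thesis using insert.hyps Suc by (simp add: divide_right_mono)
  qed simp
qed

text \<open>The probability of exactly \<open>r\<close> successes is at least the product of all
  failure probabilities times the elementary symmetric polynomial of degree \<open>r\<close>.
  Choosing \<open>r\<close> distinct trials one after another loses at most \<open>r * pm\<close> of
  the sum at each choice.\<close>

lemma bcount_eq_lower:
  assumes "finite I" "\<And>e. e \<in> I \<Longrightarrow> 0 \<le> p e \<and> p e \<le> pm" "0 \<le> pm" "pm \<le> 1"
  shows "(\<Prod>e\<in>I. 1 - p e) * (max 0 (sum p I - real r * pm) ^ r / fact r) \<le> measure (bcount I p) {r}"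
  using assms
proof (induction I arbitrary: r rule: finite_induct)
  case (empty r)
  show ?case
  proof (cases r)
    case (Suc s)
    then show ?thesis using empty by (simp add: max_absorb1)
  qed simp
next
  case (insert e I)
  let ?S = "sum p I" and ?P = "\<Prod>e\<in>I. 1 - p e"
  have p: "0 \<le> p e" "p e \<le> 1" "p e \<le> pm" "0 \<le> ?S" using insert.prems by (force intro: sum_nonneg)+
  have P: "0 \<le> ?P" using insert.prems by (intro prod_nonneg) force
  have IH: "?P * (max 0 (?S - real r * pm) ^ r / fact r) \<le> measure (bcount I p) {r}" for r
    using insert.IH insert.prems by auto
  show ?case
  proof (cases r)
    case 0
    have "measure (bcount (insert e I) p) {0} = (1 - p e) * measure (bcount I p) {0}"
      unfolding measure_bcount_insert[where p = p, OF insert.hyps p(1,2)] by simp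
    then show ?thesis using IH[of 0] insert.hyps p 0 by (simp add: mult_left_mono mult.assoc)
  next
    case (Suc s)
    define y where "y = ?S - real r * pm"
    \<comment> \<open>Passing from \<open>r\<close> to \<open>s\<close> successes raises the shifted
      sum by one \<open>pm\<close>, which is just enough to cover the increment \<open>p e\<close>
      in the mean value bound.\<close>
    have ineq: "max 0 (y + p e) ^ Suc s \<le> max 0 y ^ Suc s + real (Suc s) * p e * max 0 (y + pm) ^ s"
    proof -
      have "max 0 (y + p e) ^ Suc s - max 0 y ^ Suc s
        \<le> real (Suc s) * (max 0 (y + p e) - max 0 y) * max 0 (y + p e) ^ s"
        using p by (intro power_Suc_diff_le) auto
      also have "\<dots> \<le> real (Suc s) * p e * max 0 (y + pm) ^ s"
        using p by (intro mult_mono power_mono) auto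
      finally show ?thesis by simp
    qed
    have "(\<Prod>e\<in>insert e I. 1 - p e) * (max 0 (sum p (insert e I) - real r * pm) ^ r / fact r)
      = (1 - p e) * ?P * (max 0 (y + p e) ^ Suc s / fact r)"
      using insert.hyps Suc by (simp add: y_def algebra_simps)
    also have "\<dots> \<le> (1 - p e) * ?P * ((max 0 y ^ Suc s + real (Suc s) * p e * max 0 (y + pm) ^ s) / fact r)"
      using p P ineq by (intro mult_left_mono divide_right_mono) auto
    also have "\<dots> = (1 - p e) * (?P * (max 0 (?S - real r * pm) ^ r / fact r))
        + (1 - p e) * p e * (?P * (max 0 (?S - real s * pm) ^ s / fact s))"
    proof -
      obtain n where n: "real (Suc s) = n" "n > 0" by simp
      have r: "fact r = n * fact s" using Suc n by simp
      have "y + pm = ?S - real s * pm" using Suc by (simp add: y_def algebra_simps)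
      then show ?thesis
        unfolding y_def[symmetric] \<open>y + pm = _\<close>[symmetric] r n(1) unfolding Suc
        using n(2) by (simp add: field_simps)
    qed
    also have "\<dots> \<le> (1 - p e) * measure (bcount I p) {r} + 1 * p e * measure (bcount I p) {s}"
      using p P by (intro add_mono mult_mono IH) auto
    also have "\<dots> = measure (bcount (insert e I) p) {r}"
      unfolding measure_bcount_insert[where p = p, OF insert.hyps p(1,2)] using Suc by simp
    finally show ?thesis .
  qed
qed

lemma prod_one_minus_ge:
  assumes "finite I" "\<And>e. e \<in> I \<Longrightarrow> 0 \<le> p e \<and> p e \<le> (1::real)"
  shows "1 - sum p I \<le> (\<Prod>e\<in>I. 1 - p e)"
  using assms
proof (induction I rule: finite_induct)
  case (insert e I)
  have p: "0 \<le> p e" "p e \<le> 1" "0 \<le> sum p I" using insert.prems by (auto intro: sum_nonneg)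
  have "1 - sum p (insert e I) \<le> (1 - p e) * (1 - sum p I)"
    using insert.hyps p by (simp add: algebra_simps)
  also have "\<dots> \<le> (1 - p e) * (\<Prod>e\<in>I. 1 - p e)"
    using p insert by (intro mult_left_mono) auto
  finally show ?case using insert.hyps by simp
qed simp

lemma bcount_ge_lower:
  assumes "finite I" "\<And>e. e \<in> I \<Longrightarrow> 0 \<le> p e \<and> p e \<le> pm" "0 \<le> pm" "pm \<le> 1"
  shows "(1 - sum p I) * (max 0 (sum p I - real r * pm) ^ r / fact r) \<le> measure (bcount I p) {c. r \<le> c}"
proof -
  have "(1 - sum p I) * (max 0 (sum p I - real r * pm) ^ r / fact r)
    \<le> (\<Prod>e\<in>I. 1 - p e) * (max 0 (sum p I - real r * pm) ^ r / fact r)"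
    using assms by (intro mult_right_mono prod_one_minus_ge) force+
  also have "\<dots> \<le> measure (bcount I p) {r}"
    using assms by (intro bcount_eq_lower) auto
  also have "\<dots> \<le> measure (bcount I p) {c. r \<le> c}"
    by (intro measure_pmf.finite_measure_mono) auto
  finally show ?thesis .
qed

section \<open>Bounds for the final active set\<close>

definition act_prob :: "nat \<Rightarrow> ('k::finite \<Rightarrow> 'k \<Rightarrow> real) \<Rightarrow> ('k \<Rightarrow> nat) \<Rightarrow> 'k \<Rightarrow> real" where
  "act_prob r q m i = measure (bcount (SIGMA j:UNIV. {..<m j}) (\<lambda>(j, l). q i j)) {c. r \<le> c}"

lemma reach_eq_bernoulli: "reach q i m r = bernoulli_pmf (act_prob r q m i)"
proof (rule pmf_eqI)
  have T: "pmf (reach q i m r) True = act_prob r q m i"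
    unfolding reach_def pmf_map act_prob_def by (simp add: vimage_def)
  fix b
  show "pmf (reach q i m r) b = pmf (bernoulli_pmf (act_prob r q m i)) b"
  proof (cases b)
    case True
    then show ?thesis using T by (simp add: act_prob_def)
  next
    case False
    have "pmf (reach q i m r) False = 1 - pmf (reach q i m r) True"
      by (rule pmf_False_conv_True)
    then show ?thesis using T False by (simp add: act_prob_def)
  qed
qed

lemma act_prob_range: "0 \<le> act_prob r q m i" "act_prob r q m i \<le> 1"
  by (simp_all add: act_prob_def)

lemma card_Pi_pmf_eq_bcount:
  assumes "finite V" "I \<subseteq> V" "\<And>v. v \<in> I \<Longrightarrow> p v = bernoulli_pmf (f v)"
  shows "map_pmf (\<lambda>Y. card {v\<in>I. Y v}) (Pi_pmf V False p) = bcount I f"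
proof -
  have "bcount I f = map_pmf (\<lambda>Y. card {v\<in>I. Y v}) (Pi_pmf I False p)"
    unfolding bcount_def using assms
    by (intro arg_cong[where f = "map_pmf _"] Pi_pmf_cong) (auto intro: finite_subset)
  also have "\<dots> = map_pmf (\<lambda>Y. card {v\<in>I. Y v}) (Pi_pmf V False p)"
    unfolding Pi_pmf_subset[OF assms(1,2)] map_pmf_comp by (intro map_pmf_cong refl arg_cong[where f = card]) auto
  finally show ?thesis by simp
qed

lemma sbm_pmf_eq_on: "sbm_pmf n comm q = sbm_on {..<n} comm q"
  by (auto simp: sbm_pmf_def sbm_on_def edge_slots_def intro!: arg_cong[where f = "\<lambda>A. Pi_pmf A _ _"])

context
  fixes n r :: nat and comm :: "nat \<Rightarrow> 'k::finite" and q :: "'k \<Rightarrow> 'k \<Rightarrow> real" and S :: "nat set"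
  assumes sym: "\<And>i j. q i j = q j i" and S: "S \<subseteq> {..<n}" and r: "0 < r"
begin

lemma final_census_exploration:
  fixes b b' :: bool and t :: "'k \<Rightarrow> nat"
  defines "B \<equiv> \<lambda>f. b \<and> f = t \<or> b' \<and> \<not> f \<le> t"
  shows "measure (sbm_pmf n comm q) {E. B (census comm (final_active r n E S))}
    \<le> measure (Pi_pmf {..<n} False (\<lambda>v. reach q (comm v) t (if v \<in> S then 0 else r)))
        {Y. B (census comm {v\<in>{..<n}. Y v})}"
proof -
  have "emeasure (sbm_on {..<n} comm q)
      {E. b \<and> (\<lambda>i. (\<lambda>_. 0) i + census comm (spread {..<n} (\<lambda>v. if v \<in> S then 0 else r) E) i) = t
         \<or> b' \<and> \<not> (\<lambda>i. (\<lambda>_. 0) i + census comm (spread {..<n} (\<lambda>v. if v \<in> S then 0 else r) E) i) \<le> t}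
    \<le> emeasure (Pi_pmf {..<n} False (\<lambda>v. reach q (comm v) t (if v \<in> S then 0 else r)))
        {Y. b \<and> (\<lambda>i. (\<lambda>_. 0) i + census comm {v\<in>{..<n}. Y v} i) = t
         \<or> b' \<and> \<not> (\<lambda>i. (\<lambda>_. 0) i + census comm {v\<in>{..<n}. Y v} i) \<le> t}"
    by (rule exploration_bound[OF sym]) auto
  then show ?thesis
    unfolding B_def sbm_pmf_eq_on final_active_eq_spread[OF S r]
    by (simp add: measure_pmf.emeasure_eq_measure)
qed

lemma census_split:
  fixes Y
  shows "census comm {v\<in>{..<n}. Y v} i = card {v\<in>S \<inter> community n comm i. Y v} + card {v\<in>community n comm i - S. Y v}"
proof -
  have "{v\<in>{v\<in>{..<n}. Y v}. comm v = i} = {v\<in>S \<inter> community n comm i. Y v} \<union> {v\<in>community n comm i - S. Y v}"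
    by (auto simp: community_def)
  moreover have "finite (community n comm i)" by (simp add: community_def)
  ultimately show ?thesis unfolding census_def by (simp only:) (intro card_Un_disjoint; auto)
qed

lemma nonseed_count:
  "map_pmf (\<lambda>Y. card {v\<in>community n comm i - S. Y v})
    (Pi_pmf {..<n} False (\<lambda>v. reach q (comm v) t (if v \<in> S then 0 else r)))
    = bcount (community n comm i - S) (\<lambda>_. act_prob r q t i)"
  by (rule card_Pi_pmf_eq_bcount) (auto simp: community_def reach_eq_bernoulli)

lemma final_census_exceeds:
  "measure (sbm_pmf n comm q) {E. \<not> census comm (final_active r n E S) \<le> t}
    \<le> (\<Sum>i\<in>UNIV. measure (bcount (community n comm i - S) (\<lambda>_. act_prob r q t i))
         {c. t i < card (S \<inter> community n comm i) + c})"
proof -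
  let ?P = "Pi_pmf {..<n} False (\<lambda>v. reach q (comm v) t (if v \<in> S then 0 else r))"
  have "measure (sbm_pmf n comm q) {E. \<not> census comm (final_active r n E S) \<le> t}
      \<le> measure ?P {Y. \<not> census comm {v\<in>{..<n}. Y v} \<le> t}"
    using final_census_exploration[of False t True] by simp
  also have "\<dots> \<le> measure ?P (\<Union>i. {Y. t i < card (S \<inter> community n comm i) + card {v\<in>community n comm i - S. Y v}})"
  proof (intro measure_pmf.finite_measure_mono subsetI)
    fix Y assume "Y \<in> {Y. \<not> census comm {v\<in>{..<n}. Y v} \<le> t}"
    then obtain i where "t i < census comm {v\<in>{..<n}. Y v} i" by (auto simp: le_fun_def not_le)
    also have "\<dots> \<le> card (S \<inter> community n comm i) + card {v\<in>community n comm i - S. Y v}"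
      unfolding census_split by (intro add_right_mono card_mono) (auto simp: community_def)
    finally show "Y \<in> (\<Union>i. {Y. t i < card (S \<inter> community n comm i) + card {v\<in>community n comm i - S. Y v}})"
      by blast
  qed simp
  also have "\<dots> \<le> (\<Sum>i\<in>UNIV. measure ?P {Y. t i < card (S \<inter> community n comm i) + card {v\<in>community n comm i - S. Y v}})"
    by (intro measure_pmf.finite_measure_subadditive_finite) auto
  also have "\<dots> = (\<Sum>i\<in>UNIV. measure (bcount (community n comm i - S) (\<lambda>_. act_prob r q t i))
         {c. t i < card (S \<inter> community n comm i) + c})"
    unfolding nonseed_count[symmetric] measure_map_pmf by (simp add: vimage_def)
  finally show ?thesis .
qed

text \<open>Equality of the whole vector is relaxed to one coordinate \<open>i\<close>, to be chosen
  where the count lies well below the number of nodes that should have been activated.\<close>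

lemma final_census_eq:
  "measure (sbm_pmf n comm q) {E. census comm (final_active r n E S) = t}
    \<le> measure (bcount (community n comm i - S) (\<lambda>_. act_prob r q t i))
         {c. card (S \<inter> community n comm i) + c \<le> t i}"
proof -
  let ?P = "Pi_pmf {..<n} False (\<lambda>v. reach q (comm v) t (if v \<in> S then 0 else r))"
  have "measure (sbm_pmf n comm q) {E. census comm (final_active r n E S) = t}
      \<le> measure ?P {Y. census comm {v\<in>{..<n}. Y v} = t}"
    using final_census_exploration[of True t False] by simp
  also have "\<dots> \<le> measure ?P {Y. card (S \<inter> community n comm i) + card {v\<in>community n comm i - S. Y v} \<le> t i}"
  \<comment> \<open>The inclusion holds only almost surely: seeds have threshold 0, so they are
    marked throughout the support of the law, but not in every configuration.\<close>
  proof (rule measure_pmf.finite_measure_mono_AE)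
    have "Y v" if "Y \<in> set_pmf ?P" "v \<in> S" for Y v
    proof -
      have "Y v \<in> set_pmf (reach q (comm v) t (if v \<in> S then 0 else r))"
        using that S by (auto simp: set_Pi_pmf PiE_dflt_def)
      then show ?thesis using that by simp
    qed
    then have seeds: "{v\<in>S \<inter> community n comm i. Y v} = S \<inter> community n comm i" if "Y \<in> set_pmf ?P" for Y
      using that by blast
    have "card (S \<inter> community n comm i) + card {v\<in>community n comm i - S. Y v} \<le> t i"
      if Y: "Y \<in> set_pmf ?P" and eq: "census comm {v\<in>{..<n}. Y v} = t" for Y
      using census_split[of Y i, unfolded eq seeds[OF Y]] by (rule eq_refl[OF HOL.sym])
    then show "AE Y in ?P. Y \<in> {Y. census comm {v\<in>{..<n}. Y v} = t} \<longrightarrow>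
        Y \<in> {Y. card (S \<inter> community n comm i) + card {v\<in>community n comm i - S. Y v} \<le> t i}"
      unfolding AE_measure_pmf_iff mem_Collect_eq by blast
  qed simp
  also have "\<dots> = measure (bcount (community n comm i - S) (\<lambda>_. act_prob r q t i))
         {c. card (S \<inter> community n comm i) + c \<le> t i}"
    unfolding nonseed_count[symmetric] measure_map_pmf by (simp add: vimage_def)
  finally show ?thesis .
qed

end

text \<open>The law of the final size is a mixture over the seed sets, so a bound uniform in the
  seeds survives.\<close>

lemma final_size_le:
  assumes "\<And>S. S \<in> set_pmf (seeds_pmf n comm a) \<Longrightarrow>
      measure (sbm_pmf n comm q) {E. card (final_active r n E S) \<in> A} \<le> b"
  shows "measure (final_size_pmf r n comm q a) A \<le> b"
proof -
  have b: "0 \<le> b"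
    using assms set_pmf_not_empty[of "seeds_pmf n comm a"] by (meson all_not_in_conv measure_nonneg order_trans)
  have eq: "final_size_pmf r n comm q a =
      bind_pmf (seeds_pmf n comm a) (\<lambda>S. map_pmf (\<lambda>E. card (final_active r n E S)) (sbm_pmf n comm q))"
    unfolding final_size_pmf_def pair_pmf_def map_bind_pmf map_return_pmf
    by (subst bind_commute_pmf) (simp add: map_pmf_def)
  have "emeasure (final_size_pmf r n comm q a) A \<le> (\<integral>\<^sup>+S. ennreal b \<partial>seeds_pmf n comm a)"
    unfolding eq emeasure_bind_pmf
    by (intro nn_integral_mono_AE)
       (use assms in \<open>auto simp: AE_measure_pmf_iff measure_pmf.emeasure_eq_measure vimage_def intro!: ennreal_leI\<close>)
  then show ?thesis using b by (simp add: measure_pmf.emeasure_eq_measure)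
qed

lemma set_seeds_pmf:
  assumes a: "\<And>i. a i \<le> card (community n comm i)" and S: "S \<in> set_pmf (seeds_pmf n comm a)"
  shows "S \<subseteq> {..<n}" "card (S \<inter> community n comm i) = a i"
proof -
  let ?C = "\<lambda>i. {S. S \<subseteq> community n comm i \<and> card S = a i}"
  have fin: "finite (community n comm i)" for i by (simp add: community_def)
  have "finite (?C i)" for i using fin by simp
  \<comment> \<open>The uniform law on a set of candidates is meaningful only if the set is
    nonempty, which is what the bound on \<open>a\<close> provides.\<close>
  moreover have "?C i \<noteq> {}" for i
  proof -
    obtain U where "U \<subseteq> community n comm i" "card U = a i"
      by (rule obtain_subset_with_card_n[OF a[of i]])
    then show ?thesis by auto
  qed
  ultimately have "set_pmf (pmf_of_set (?C i)) = ?C i" for i by (rule set_pmf_of_set[rotated])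
  note C = this
  obtain T where T: "S = (\<Union>i. T i)" "T \<in> set_pmf (Pi_pmf UNIV {} (\<lambda>i. pmf_of_set (?C i)))"
    using S unfolding seeds_pmf_def set_map_pmf by (rule imageE)
  have "T i \<in> set_pmf (pmf_of_set (?C i))" for i
    using T(2) unfolding set_Pi_pmf[OF finite] PiE_dflt_def by simp
  then have "T i \<in> ?C i" for i unfolding C .
  note T = T(1) this
  show "S \<subseteq> {..<n}" using T by (auto simp: community_def)
  have "S \<inter> community n comm i = T i"
  proof (intro equalityI subsetI)
    fix v assume "v \<in> S \<inter> community n comm i"
    then obtain j where "v \<in> T j" "comm v = i" using T(1) by (auto simp: community_def)
    moreover from this have "j = i" using T(2)[of j] by (auto simp: community_def)
    ultimately show "v \<in> T i" by simp
  qed (use T in auto)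
  then show "card (S \<inter> community n comm i) = a i" using T(2)[of i] by simp
qed

lemma sum_census:
  fixes comm :: "nat \<Rightarrow> 'k::finite"
  assumes "finite W"
  shows "(\<Sum>i\<in>UNIV. census comm W i) = card W"
proof -
  have "card W = card (\<Union>i. {v\<in>W. comm v = i})" by (rule arg_cong[where f = card]) auto
  also have "\<dots> = (\<Sum>i\<in>UNIV. card {v\<in>W. comm v = i})"
    by (rule card_UN_disjoint) (use assms in auto)
  finally show ?thesis by (simp add: census_def)
qed

lemma card_functions_le:
  fixes t :: "'k::finite \<Rightarrow> nat"
  shows "finite {s. s \<le> t}" "card {s. s \<le> t} = (\<Prod>i\<in>UNIV. Suc (t i))"
proof -
  have "{s. s \<le> t} = PiE UNIV (\<lambda>i. {..t i})" by (auto simp: le_fun_def PiE_UNIV_domain)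
  then show "finite {s. s \<le> t}" "card {s. s \<le> t} = (\<Prod>i\<in>UNIV. Suc (t i))"
    by (simp_all add: finite_PiE card_PiE)
qed

text \<open>A deviating outcome either exceeds \<open>t\<close> in some community or ends at one of
  the finitely many vectors below \<open>t\<close> whose total is less than \<open>lo\<close>; a
  union bound treats the second case. The nonseed nodes vary with the seeds, so \<open>U\<close> and
  \<open>L\<close> refer to an index set only through its cardinality.\<close>

lemma final_size_deviation:
  fixes comm :: "nat \<Rightarrow> 'k::finite"
  assumes sym: "\<And>i j. q i j = q j i" and r: "0 < r"
    and a: "\<And>i. a i \<le> card (community n comm i)"
    and above: "\<And>A. A \<in> D \<Longrightarrow> A \<le> (\<Sum>i\<in>UNIV. t i) \<Longrightarrow> real A < lo"
    and U: "\<And>i I. card I = card (community n comm i) - a i \<Longrightarrow> finite I \<Longrightarrow>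
        measure (bcount I (\<lambda>_::nat. act_prob r q t i)) {c. t i < a i + c} \<le> u"
    and L: "\<And>s. s \<le> t \<Longrightarrow> real (\<Sum>i\<in>UNIV. s i) < lo \<Longrightarrow>
        \<exists>i. \<forall>I. card I = card (community n comm i) - a i \<longrightarrow> finite I \<longrightarrow>
          measure (bcount I (\<lambda>_::nat. act_prob r q s i)) {c. a i + c \<le> s i} \<le> l"
    and l: "0 \<le> l"
  shows "measure (final_size_pmf r n comm q a) D \<le> real CARD('k) * u + (\<Prod>i\<in>UNIV. real (Suc (t i))) * l"
proof (rule final_size_le)
  fix S assume "S \<in> set_pmf (seeds_pmf n comm a)"
  then have S: "S \<subseteq> {..<n}" "card (S \<inter> community n comm i) = a i" for i
    using set_seeds_pmf[OF a] by auto
  have fin: "finite (community n comm i)" for i by (simp add: community_def)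
  have card: "card (community n comm i - S) = card (community n comm i) - a i" for i
    using S(2)[of i] fin[of i] by (simp add: card_Diff_subset_Int Int_commute)
  let ?F = "\<lambda>E. census comm (final_active r n E S)"
  let ?bad = "{s. s \<le> t \<and> real (\<Sum>i\<in>UNIV. s i) < lo}"
  have finF: "finite (final_active r n E S)" for E
    unfolding final_active_eq_spread[OF S(1) r] by (rule finite_subset[OF spread_subset]) simp
  have finbad: "finite ?bad" by (rule finite_subset[OF _ card_functions_le(1)[of t]]) auto
  have "measure (sbm_pmf n comm q) {E. card (final_active r n E S) \<in> D}
    \<le> measure (sbm_pmf n comm q) ({E. \<not> ?F E \<le> t} \<union> (\<Union>s\<in>?bad. {E. ?F E = s}))"
  proof (intro measure_pmf.finite_measure_mono subsetI)
    fix E assume E: "E \<in> {E. card (final_active r n E S) \<in> D}"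
    show "E \<in> {E. \<not> ?F E \<le> t} \<union> (\<Union>s\<in>?bad. {E. ?F E = s})"
    proof (cases "?F E \<le> t")
      case True
      have eq: "(\<Sum>i\<in>UNIV. ?F E i) = card (final_active r n E S)" by (rule sum_census[OF finF])
      have "(\<Sum>i\<in>UNIV. ?F E i) \<le> (\<Sum>i\<in>UNIV. t i)"
        using True by (intro sum_mono) (simp add: le_fun_def)
      then have "real (\<Sum>i\<in>UNIV. ?F E i) < lo" using above E unfolding eq by simp
      then show ?thesis using True by auto
    qed auto
  qed simp
  also have "\<dots> \<le> measure (sbm_pmf n comm q) {E. \<not> ?F E \<le> t} + measure (sbm_pmf n comm q) (\<Union>s\<in>?bad. {E. ?F E = s})"
    by (rule measure_Un_le) auto
  also have "\<dots> \<le> real CARD('k) * u + (\<Prod>i\<in>UNIV. real (Suc (t i))) * l"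
  proof (rule add_mono)
    have "measure (sbm_pmf n comm q) {E. \<not> ?F E \<le> t} \<le> (\<Sum>i\<in>(UNIV :: 'k set). u)"
      using final_census_exceeds[of q S n r comm t, OF sym S(1) r] unfolding S(2)
      by (rule order_trans) (intro sum_mono U card finite_Diff fin)
    then show "measure (sbm_pmf n comm q) {E. \<not> ?F E \<le> t} \<le> real CARD('k) * u" by simp
    have "measure (sbm_pmf n comm q) (\<Union>s\<in>?bad. {E. ?F E = s}) \<le> (\<Sum>s\<in>?bad. measure (sbm_pmf n comm q) {E. ?F E = s})"
      by (intro measure_pmf.finite_measure_subadditive_finite finbad) auto
    also have "\<dots> \<le> (\<Sum>s\<in>?bad. l)"
    proof (rule sum_mono)
      fix s assume "s \<in> ?bad"
      then obtain i where i: "\<And>I. card I = card (community n comm i) - a i \<Longrightarrow> finite I \<Longrightarrow>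
          measure (bcount I (\<lambda>_::nat. act_prob r q s i)) {c. a i + c \<le> s i} \<le> l"
        using L[of s] by auto
      show "measure (sbm_pmf n comm q) {E. ?F E = s} \<le> l"
        using final_census_eq[of q S n r comm s i, OF sym S(1) r] unfolding S(2)
        by (rule order_trans) (intro i card finite_Diff fin)
    qed
    also have "\<dots> \<le> real (card {s. s \<le> t}) * l"
      using l by (simp add: mult_right_mono card_mono card_functions_le(1) Collect_mono)
    finally show "measure (sbm_pmf n comm q) (\<Union>s\<in>?bad. {E. ?F E = s}) \<le> (\<Prod>i\<in>UNIV. real (Suc (t i))) * l"
      by (simp only: card_functions_le(2) of_nat_prod)
  qed
  finally show "measure (sbm_pmf n comm q) {E. card (final_active r n E S) \<in> D}
    \<le> real CARD('k) * u + (\<Prod>i\<in>UNIV. real (Suc (t i))) * l" .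
qed

section \<open>The cooperative flow\<close>

text \<open>The value at time \<open>t\<close> of the solution of \<open>x' = \<phi> - x\<close> with \<open>x 0 = b\<close>.\<close>

definition relax :: "real \<Rightarrow> (real \<Rightarrow> real) \<Rightarrow> real \<Rightarrow> real" where
  "relax b \<phi> t = exp (- t) * (b + integral {0..t} (\<lambda>s. exp s * \<phi> s))"

lemma has_integral_exp_scaled:
  assumes "a \<le> (b :: real)"
  shows "((\<lambda>s. exp s * d) has_integral (exp b - exp a) * d) {a..b}"
proof -
  have "((\<lambda>s. exp s) has_integral (exp b - exp a)) {a..b}"
    by (rule fundamental_theorem_of_calculus)
       (use assms in \<open>auto intro!: derivative_eq_intros simp: has_real_derivative_iff_has_vector_derivative[symmetric]\<close>)
  then show ?thesis by (rule has_integral_mult_left)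
qed

lemma integrable_exp_mult:
  fixes \<phi> :: "real \<Rightarrow> real"
  assumes "continuous_on {0..} \<phi>" "0 \<le> a"
  shows "(\<lambda>s. exp s * \<phi> s) integrable_on {a..b}"
proof (rule integrable_continuous_real)
  have "continuous_on {a..b} \<phi>" by (rule continuous_on_subset[OF assms(1)]) (use assms(2) in auto)
  then show "continuous_on {a..b} (\<lambda>s. exp s * \<phi> s)" by (intro continuous_intros)
qed

lemma relax_0 [simp]: "relax b \<phi> 0 = b"
  by (simp add: relax_def)

text \<open>Variation of constants restarted at time \<open>t\<close>: the value at
  \<open>t'\<close> is the value at \<open>t\<close> with weight \<open>exp (t - t')\<close> plus an
  average of the drive with the complementary weight. Most later comparisons are such convex
  combinations.\<close>

lemma relax_shift_ge:
  assumes "continuous_on {0..} \<phi>" "0 \<le> t" "t \<le> t'" "\<And>s. s \<in> {t..t'} \<Longrightarrow> d \<le> \<phi> s"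
  shows "exp (t - t') * relax b \<phi> t + (1 - exp (t - t')) * d \<le> relax b \<phi> t'"
proof -
  let ?f = "\<lambda>s. exp s * \<phi> s"
  have split: "integral {0..t'} ?f = integral {0..t} ?f + integral {t..t'} ?f"
    using assms by (intro Henstock_Kurzweil_Integration.integral_combine[symmetric] integrable_exp_mult) auto
  have "(exp t' - exp t) * d = integral {t..t'} (\<lambda>s. exp s * d)"
    using has_integral_exp_scaled[of t t' d] assms by (simp add: integral_unique)
  also have "\<dots> \<le> integral {t..t'} ?f"
    using assms has_integral_exp_scaled[of t t' d]
    by (intro integral_le integrable_exp_mult) (auto simp: integrable_on_def)
  finally have "exp (- t') * ((exp t' - exp t) * d) \<le> exp (- t') * integral {t..t'} ?f"
    by (intro mult_left_mono) auto
  moreover have "exp (- t') * ((exp t' - exp t) * d) = (1 - exp (t - t')) * d"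
    by (simp add: algebra_simps exp_diff exp_minus divide_inverse)
  moreover have "exp (t - t') * relax b \<phi> t = exp (- t') * (b + integral {0..t} ?f)"
    by (simp add: relax_def exp_diff exp_minus field_simps)
  ultimately show ?thesis unfolding relax_def split by (simp add: algebra_simps)
qed

lemma relax_ge:
  assumes "continuous_on {0..} \<phi>" "0 \<le> t" "\<And>s. s \<in> {0..t} \<Longrightarrow> d \<le> \<phi> s"
  shows "exp (- t) * b + (1 - exp (- t)) * d \<le> relax b \<phi> t"
  using relax_shift_ge[of \<phi> 0 t d b] assms by simp

lemma relax_uminus: "relax (- b) (\<lambda>s. - \<phi> s) t = - relax b \<phi> t"
  by (simp add: relax_def algebra_simps)

lemma relax_le:
  assumes "continuous_on {0..} \<phi>" "0 \<le> t" "\<And>s. s \<in> {0..t} \<Longrightarrow> \<phi> s \<le> d"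
  shows "relax b \<phi> t \<le> exp (- t) * b + (1 - exp (- t)) * d"
proof -
  have "exp (- t) * (- b) + (1 - exp (- t)) * (- d) \<le> relax (- b) (\<lambda>s. - \<phi> s) t"
    using assms by (intro relax_ge continuous_intros) auto
  then show ?thesis unfolding relax_uminus by (simp add: algebra_simps)
qed

lemma relax_mono:
  assumes "continuous_on {0..} \<phi>" "continuous_on {0..} \<psi>" "\<And>s. s \<in> {0..t} \<Longrightarrow> \<phi> s \<le> \<psi> s"
  shows "relax b \<phi> t \<le> relax b \<psi> t"
  unfolding relax_def using assms
  by (intro mult_left_mono add_left_mono integral_le integrable_exp_mult) auto

text \<open>Starting below a nondecreasing drive, the solution always lags behind the drive and is
  therefore pulled upwards. The restart estimate with the constant \<open>\<phi> t\<close> gives the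
  monotonicity without differentiation.\<close>

lemma relax_nondecreasing:
  assumes cont: "continuous_on {0..} \<phi>" and mono: "\<And>s s'. 0 \<le> s \<Longrightarrow> s \<le> s' \<Longrightarrow> \<phi> s \<le> \<phi> s'"
    and b: "b \<le> \<phi> 0" and t: "0 \<le> t" "t \<le> t'"
  shows "relax b \<phi> t \<le> \<phi> t" "relax b \<phi> t \<le> relax b \<phi> t'"
proof -
  have "relax b \<phi> t \<le> exp (- t) * b + (1 - exp (- t)) * \<phi> t"
    using t by (intro relax_le cont mono) auto
  also have "\<dots> \<le> exp (- t) * \<phi> t + (1 - exp (- t)) * \<phi> t"
    using b mono[of 0 t] t by (intro add_right_mono mult_left_mono) auto
  finally show le: "relax b \<phi> t \<le> \<phi> t" by (simp add: algebra_simps)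
  have "relax b \<phi> t = exp (t - t') * relax b \<phi> t + (1 - exp (t - t')) * relax b \<phi> t"
    by (simp add: algebra_simps)
  also have "\<dots> \<le> exp (t - t') * relax b \<phi> t + (1 - exp (t - t')) * \<phi> t"
    using le t by (intro add_left_mono mult_left_mono) auto
  also have "\<dots> \<le> relax b \<phi> t'"
    using t by (intro relax_shift_ge cont mono) auto
  finally show "relax b \<phi> t \<le> relax b \<phi> t'" .
qed

lemma continuous_on_Ici:
  assumes "\<And>T. 0 \<le> T \<Longrightarrow> continuous_on {0..T} (f :: real \<Rightarrow> real)"
  shows "continuous_on {0..} f"
proof (rule continuous_on_eq_continuous_within[THEN iffD2], rule ballI)
  fix t :: real assume t: "t \<in> {0..}"
  have "continuous (at t within {0..t + 1}) f"
    using assms[of "t + 1"] t by (auto simp: continuous_on_eq_continuous_within)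
  moreover have "at t within {0..t + 1} = at t within {0..}"
    by (rule at_within_nhd[of t "{t - 1<..<t + 1}"]) (use t in auto)
  ultimately show "continuous (at t within {0..}) f" by simp
qed

lemma relax_continuous:
  assumes "\<And>T. 0 \<le> T \<Longrightarrow> (\<lambda>s. exp s * \<phi> s) integrable_on {0..T}"
  shows "continuous_on {0..} (relax b \<phi>)"
proof (rule continuous_on_Ici)
  fix T :: real assume "0 \<le> T"
  then show "continuous_on {0..T} (relax b \<phi>)"
    unfolding relax_def[abs_def]
    by (intro continuous_intros indefinite_integral_continuous_1 assms)
qed

lemma relax_has_derivative:
  assumes "continuous_on {0..} \<phi>" "0 \<le> t"
  shows "(relax b \<phi> has_real_derivative \<phi> t - relax b \<phi> t) (at t within {0..})"
proof -
  have "continuous_on {0..t + 1} (\<lambda>s. exp s * \<phi> s)"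
    by (intro continuous_intros continuous_on_subset[OF assms(1)]) auto
  then have "((\<lambda>x. integral {0..x} (\<lambda>s. exp s * \<phi> s)) has_real_derivative exp t * \<phi> t) (at t within {0..t + 1})"
    by (rule integral_has_real_derivative) (use assms in auto)
  then have *: "((\<lambda>x. integral {0..x} (\<lambda>s. exp s * \<phi> s)) has_real_derivative exp t * \<phi> t) (at t within {0..})"
    using at_within_nhd[of t "{t - 1<..<t + 1}" "{0..t + 1}" "{0..}"] assms(2) by force
  show ?thesis
    unfolding relax_def[abs_def]
    by (rule derivative_eq_intros * refl | simp)+
       (simp add: algebra_simps exp_minus_inverse flip: exp_add mult.assoc)
qed

section \<open>The vector field and the layers of the initial point\<close>

definition bp_const :: "nat \<Rightarrow> real" where
  "bp_const r = (1 / real r) * (1 - 1 / real r) ^ (r - 1)"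

definition drive :: "nat \<Rightarrow> 'k::finite rvec \<Rightarrow> 'k rmat \<Rightarrow> 'k rvec \<Rightarrow> 'k \<Rightarrow> real" where
  "drive r \<alpha> X v i = \<alpha> $ i + bp_const r * (\<Sum>j\<in>UNIV. X $ i $ j * v $ j) ^ r"

lemma rho_eq_drive: "rho r \<alpha> X v $ i = drive r \<alpha> X v i - v $ i"
  by (simp add: rho_def drive_def bp_const_def)

lemma continuous_on_drive [continuous_intros]:
  assumes "\<And>j. continuous_on S (\<lambda>t. f t $ j)"
  shows "continuous_on S (\<lambda>t. drive r \<alpha> X (f t) i)"
  unfolding drive_def by (intro continuous_intros assms)

lemma tendsto_drive [tendsto_intros]:
  assumes "\<And>j. ((\<lambda>t. f t $ j) \<longlongrightarrow> v $ j) G"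
  shows "((\<lambda>t. drive r \<alpha> X (f t) i) \<longlongrightarrow> drive r \<alpha> X v i) G"
  unfolding drive_def by (intro tendsto_intros assms)

text \<open>Positive entries of \<open>mat_pow X h\<close> record walks of length \<open>h\<close>
  in the support of \<open>X\<close>. The last but one vertex of a shortest walk from
  \<open>idx1\<close> to \<open>i\<close> lies one layer earlier.\<close>

lemma layer_Suc_pred:
  assumes nonneg: "\<And>i j. 0 \<le> (X :: 'k::{finite,linorder} rmat) $ i $ j" and i: "i \<in> layer X (Suc h)"
  obtains j where "j \<in> layer X h" "0 < X $ j $ i"
proof -
  have pow: "0 \<le> mat_pow X s $ a $ b" for s a b
    by (induction s arbitrary: a b)
       (auto simp: mat_def matrix_matrix_mult_def intro!: sum_nonneg mult_nonneg_nonneg nonneg)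
  have step: "mat_pow X (Suc s) $ a $ c > 0" if "mat_pow X s $ a $ b > 0" "X $ b $ c > 0" for s a b c
  proof -
    have "0 < mat_pow X s $ a $ b * X $ b $ c" using that by simp
    also have "\<dots> \<le> (\<Sum>k\<in>UNIV. mat_pow X s $ a $ k * X $ k $ c)"
      by (rule member_le_sum) (auto intro: mult_nonneg_nonneg pow nonneg)
    finally show ?thesis by (simp add: matrix_matrix_mult_def)
  qed
  have "0 < (\<Sum>k\<in>UNIV. mat_pow X h $ idx1 $ k * X $ k $ i)"
    using i by (simp add: matrix_matrix_mult_def)
  then obtain j where "0 < mat_pow X h $ idx1 $ j * X $ j $ i"
    by (meson not_less sum_nonpos)
  then have j: "mat_pow X h $ idx1 $ j > 0" "X $ j $ i > 0"
    using pow[of h idx1 j] nonneg[of j i] by (auto simp: zero_less_mult_iff)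
  have zero: "mat_pow X s $ idx1 $ i = 0" if "1 \<le> s" "s \<le> h" for s using i that by simp
  have "j \<in> layer X h"
  proof (cases h)
    case 0
    then show ?thesis using j(1) by (auto simp: mat_def split: if_splits)
  next
    case (Suc h')
    have "j \<noteq> idx1"
    proof
      assume "j = idx1"
      then have "mat_pow X (Suc 0) $ idx1 $ i > 0"
        using j(2) by (intro step[of 0 idx1 j]) (simp_all add: mat_def)
      then show False using zero[of 1] Suc by simp
    qed
    moreover have "mat_pow X s $ idx1 $ j = 0" if "1 \<le> s" "s \<le> h'" for s
      using step[of s idx1 j i] j(2) zero[of "Suc s"] that Suc pow[of s idx1 j]
      by (cases "mat_pow X s $ idx1 $ j = 0") auto
    ultimately show ?thesis using j(1) Suc by simp
  qed
  then show thesis using j(2) that by blast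
qed

text \<open>For \<open>i\<close> other than \<open>idx1\<close> the layer is the least positive
  length of a walk from \<open>idx1\<close>, which exists by irreducibility; \<open>idx1\<close>
  itself is excluded from later layers despite closed walks. This justifies the \<open>THE\<close>
  in \<open>init_pt\<close>.\<close>

lemma ex1_layer:
  assumes nonneg: "\<And>i j. 0 \<le> (X :: 'k::{finite,linorder} rmat) $ i $ j" and irred: "irreducible_mat X"
  shows "\<exists>!h. i \<in> layer X h"
proof (cases "i = idx1")
  case True
  show ?thesis
  proof (rule ex1I[of _ 0])
    fix h assume "i \<in> layer X h"
    then show "h = 0" using True by (cases h) auto
  qed (use True in simp)
next
  case False
  have pow: "0 \<le> mat_pow X s $ a $ b" for s a b
    by (induction s arbitrary: a b)
       (auto simp: mat_def matrix_matrix_mult_def intro!: sum_nonneg mult_nonneg_nonneg nonneg)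
  define P where "P h \<longleftrightarrow> 1 \<le> h \<and> mat_pow X h $ idx1 $ i > 0" for h
  have "\<exists>h. P h" using irred by (auto simp: irreducible_mat_def P_def)
  then have L: "P (LEAST h. P h)" by (meson LeastI)
  have iff: "i \<in> layer X h \<longleftrightarrow> P h \<and> (\<forall>s<h. \<not> P s)" for h
  proof (cases h)
    case 0
    then show ?thesis using False by (simp add: P_def)
  next
    case (Suc h')
    have "mat_pow X s $ idx1 $ i = 0 \<longleftrightarrow> \<not> 0 < mat_pow X s $ idx1 $ i" for s
      using pow[of s idx1 i] by linarith
    then show ?thesis
      unfolding Suc layer.simps P_def using False by (simp del: mat_pow.simps) (metis less_Suc_eq_le)
  qed
  show ?thesis unfolding iff
    by (metis L not_less_Least linorder_neqE_nat)
qed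

locale subcritical_flow =
  fixes r :: nat and \<alpha> :: "'k::{finite,linorder} rvec" and X :: "'k rmat" and z :: "'k rvec"
  assumes r: "2 \<le> r"
    and X_nonneg: "\<And>i j. 0 \<le> X $ i $ j"
    and X_sym: "\<And>i j. 0 < X $ i $ j \<Longrightarrow> 0 < X $ j $ i"
    and alpha_nonneg: "\<And>i. 0 \<le> \<alpha> $ i"
    and alpha1_pos: "0 < \<alpha> $ idx1"
    and irred: "irreducible_mat X"
    and z_dom: "z \<in> dom_D r X"
    and z_super: "\<And>i. drive r \<alpha> X z i < z $ i"
begin

abbreviation "x0 \<equiv> init_pt r \<alpha> X"

abbreviation "drv \<equiv> drive r \<alpha> X"

lemma const_pos: "0 < bp_const r"
  unfolding bp_const_def using r by (intro mult_pos_pos zero_less_power) auto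

lemma drv_mono:
  assumes "\<And>j. 0 \<le> u $ j" "\<And>j. u $ j \<le> v $ j"
  shows "drv u i \<le> drv v i"
  unfolding drive_def using const_pos assms
  by (intro add_left_mono mult_left_mono power_mono sum_mono sum_nonneg mult_nonneg_nonneg X_nonneg) auto

lemma drv_ge_edge:
  assumes "\<And>j. 0 \<le> u $ j"
  shows "bp_const r * (X $ i $ j * u $ j) ^ r \<le> drv u i"
proof -
  have "X $ i $ j * u $ j \<le> (\<Sum>j\<in>UNIV. X $ i $ j * u $ j)"
    by (rule member_le_sum) (auto intro: mult_nonneg_nonneg X_nonneg assms)
  then have "bp_const r * (X $ i $ j * u $ j) ^ r \<le> bp_const r * (\<Sum>j\<in>UNIV. X $ i $ j * u $ j) ^ r"
    using const_pos assms X_nonneg by (intro mult_left_mono power_mono mult_nonneg_nonneg) auto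
  then show ?thesis unfolding drive_def using alpha_nonneg[of i] by linarith
qed

lemma drv_ge_alpha:
  assumes "\<And>j. 0 \<le> u $ j"
  shows "\<alpha> $ i \<le> drv u i"
  unfolding drive_def using const_pos assms
  by (simp add: mult_nonneg_nonneg sum_nonneg X_nonneg)

lemma finite_entries: "finite {X $ i $ j | i j. 0 < X $ i $ j}"
proof (rule finite_subset)
  show "{X $ i $ j | i j. 0 < X $ i $ j} \<subseteq> range (\<lambda>(i, j). X $ i $ j)" by auto
qed simp

lemma chi_min_le: "0 < X $ i $ j \<Longrightarrow> chi_min X \<le> X $ i $ j"
  unfolding chi_min_def by (rule Min_le) (auto simp: finite_entries)

lemma chi_min_pos: "0 < X $ i $ j \<Longrightarrow> 0 < chi_min X"
  unfolding chi_min_def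
  by (subst Min_gr_iff) (auto simp: finite_entries)

lemma in_layer_init: "i \<in> layer X h \<Longrightarrow> x0 $ i = beta r \<alpha> X h"
  by (simp add: init_pt_def the1_equality[OF ex1_layer[OF X_nonneg irred]])

lemma beta_pos: "i \<in> layer X h \<Longrightarrow> 0 < beta r \<alpha> X h"
proof (induction h arbitrary: i)
  case (Suc h)
  obtain j where j: "j \<in> layer X h" "0 < X $ j $ i"
    using layer_Suc_pred[OF X_nonneg Suc.prems] .
  then have "0 < bp_const r / 2 * (chi_min X * beta r \<alpha> X h) ^ r"
    using Suc.IH[OF j(1)] chi_min_pos[OF j(2)] const_pos by simp
  then show ?case by (simp add: bp_const_def)
qed (use alpha1_pos in simp)

lemma init_pos: "0 < x0 $ i"
  using ex1_layer[OF X_nonneg irred, of i] in_layer_init beta_pos by metis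

text \<open>The factor 1/2 in the recursion of \<open>beta\<close> makes the inequality strict, and
  \<open>chi_min\<close> bounds the entry on the edge used from below.\<close>

lemma beta_Suc_less:
  assumes "0 < X $ i $ j" "0 < beta r \<alpha> X h" "beta r \<alpha> X h \<le> u $ j" "\<And>j. 0 \<le> u $ j"
  shows "beta r \<alpha> X (Suc h) < drv u i"
proof -
  have c: "0 < chi_min X" "chi_min X \<le> X $ i $ j" using assms chi_min_le chi_min_pos by auto
  have "0 < bp_const r * (chi_min X * beta r \<alpha> X h) ^ r" using c const_pos assms by simp
  then have "beta r \<alpha> X (Suc h) < bp_const r * (chi_min X * beta r \<alpha> X h) ^ r"
    by (simp add: bp_const_def)
  also have "\<dots> \<le> bp_const r * (X $ i $ j * u $ j) ^ r"
    using c const_pos assms by (intro mult_left_mono power_mono mult_mono) auto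
  also have "\<dots> \<le> drv u i" by (rule drv_ge_edge) (use assms in auto)
  finally show ?thesis .
qed

text \<open>Any nonnegative supersolution is at least \<open>\<alpha> $ idx1\<close> in community 1,
  and its drive then passes a positive lower bound from each layer to the next. The numbers
  \<open>beta\<close> stay strictly under these bounds.\<close>

lemma init_below_super:
  assumes v: "\<And>i. 0 \<le> v $ i" "\<And>i. drv v i \<le> v $ i"
  shows "x0 $ i < v $ i"
proof -
  have "beta r \<alpha> X h < v $ i" if "i \<in> layer X h" for h i
    using that
  proof (induction h arbitrary: i)
    case 0
    then show ?case using drv_ge_alpha[OF v(1), of i] v(2)[of i] alpha1_pos by simp
  next
    case (Suc h)
    obtain j where j: "j \<in> layer X h" "0 < X $ j $ i"
      using layer_Suc_pred[OF X_nonneg Suc.prems] .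
    have "beta r \<alpha> X (Suc h) < drv v i"
      using X_sym[OF j(2)] beta_pos[OF j(1)] Suc.IH[OF j(1)] by (intro beta_Suc_less[of i j] v) auto
    then show ?case using v(2)[of i] by simp
  qed
  then show ?thesis using ex1_layer[OF X_nonneg irred, of i] in_layer_init by metis
qed

lemma init_sub: "x0 $ i < drv x0 i"
proof -
  obtain h where h: "i \<in> layer X h" using ex1_layer[OF X_nonneg irred, of i] by blast
  have pos: "0 \<le> x0 $ j" for j using init_pos[of j] by simp
  show ?thesis
  proof (cases h)
    case 0
    then show ?thesis
      using drv_ge_alpha[of x0 i, OF pos] h alpha1_pos in_layer_init[OF h] by simp
  next
    case (Suc h')
    obtain j where j: "j \<in> layer X h'" "0 < X $ j $ i"
      using layer_Suc_pred[OF X_nonneg] h Suc by blast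
    have "beta r \<alpha> X (Suc h') < drv x0 i"
      using X_sym[OF j(2)] beta_pos[OF j(1)] in_layer_init[OF j(1)]
      by (intro beta_Suc_less[of i j] pos) auto
    then show ?thesis using in_layer_init[OF h] Suc by simp
  qed
qed

section \<open>Monotone Picard iteration\<close>

lemma z_nonneg: "0 \<le> z $ i"
  using z_dom by (simp add: dom_D_def)

text \<open>Each step solves \<open>x' = drive(previous) - x\<close> exactly instead of integrating
  the whole field. The remaining nonlinearity is monotone, so the iterates increase and every
  supersolution bounds them.\<close>

primrec picard :: "nat \<Rightarrow> real \<Rightarrow> 'k rvec" where
  "picard 0 t = x0"
| "picard (Suc m) t = (\<chi> i. relax (x0 $ i) (\<lambda>s. drv (picard m s) i) t)"

lemma continuous_picard: "continuous_on {0..} (\<lambda>t. picard m t $ i)"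
proof (induction m arbitrary: i)
  case (Suc m)
  have "continuous_on {0..} (relax (x0 $ i) (\<lambda>s. drv (picard m s) i))"
    by (intro relax_continuous integrable_exp_mult continuous_on_drive Suc) auto
  then show ?case by simp
qed simp

lemma continuous_drv_picard: "continuous_on {0..} (\<lambda>t. drv (picard m t) i)"
  by (intro continuous_on_drive continuous_picard)

lemma init_le_picard: "0 \<le> t \<Longrightarrow> x0 $ i \<le> picard m t $ i"
proof (induction m arbitrary: i t)
  case (Suc m)
  have "x0 $ i = exp (- t) * x0 $ i + (1 - exp (- t)) * x0 $ i" by (simp add: algebra_simps)
  also have "\<dots> \<le> exp (- t) * x0 $ i + (1 - exp (- t)) * drv x0 i"
    using init_sub[of i] Suc.prems by (intro add_left_mono mult_left_mono) auto
  also have "\<dots> \<le> picard (Suc m) t $ i"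
    unfolding picard.simps vec_lambda_beta using Suc init_pos
    by (intro relax_ge continuous_drv_picard drv_mono less_imp_le[OF init_pos]) auto
  finally show ?case .
qed simp

lemma picard_nonneg: "0 \<le> t \<Longrightarrow> 0 \<le> picard m t $ i"
  using init_le_picard[of t i m] init_pos[of i] by simp

lemma picard_le_super:
  assumes v: "\<And>i. 0 \<le> v $ i" "\<And>i. drv v i \<le> v $ i" and t: "0 \<le> t"
  shows "picard m t $ i \<le> v $ i"
  using t
proof (induction m arbitrary: i t)
  case (Suc m)
  have "picard (Suc m) t $ i \<le> exp (- t) * x0 $ i + (1 - exp (- t)) * drv v i"
    unfolding picard.simps vec_lambda_beta using Suc
    by (intro relax_le continuous_drv_picard drv_mono picard_nonneg) auto
  also have "\<dots> \<le> exp (- t) * v $ i + (1 - exp (- t)) * v $ i"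
    using init_below_super[of v i] v Suc.prems
    by (intro add_mono mult_left_mono v less_imp_le[OF init_below_super[of v i]]) auto
  finally show ?case by (simp add: algebra_simps)
qed (use init_below_super[of v] v in \<open>auto intro: less_imp_le\<close>)

lemma picard_incseq: "0 \<le> t \<Longrightarrow> picard m t $ i \<le> picard (Suc m) t $ i"
proof (induction m arbitrary: i t)
  case 0
  then show ?case using init_le_picard[of t i "Suc 0"] by simp
next
  case (Suc m)
  have "relax (x0 $ i) (\<lambda>s. drv (picard m s) i) t \<le> relax (x0 $ i) (\<lambda>s. drv (picard (Suc m) s) i) t"
    using Suc by (intro relax_mono continuous_drv_picard drv_mono picard_nonneg Suc.IH) auto
  then show ?case by (subst picard.simps) (simp del: picard.simps add: picard.simps(2)[of m])
qed

lemma picard_mono_time: "0 \<le> t \<Longrightarrow> t \<le> t' \<Longrightarrow> picard m t $ i \<le> picard m t' $ i"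
proof (induction m arbitrary: i t t')
  case (Suc m)
  have "x0 $ i \<le> drv (picard m 0) i"
    using init_sub[of i] drv_mono[of x0 "picard m 0" i] init_le_picard[of 0 _ m] init_pos
    by (meson less_imp_le order_trans order_refl)
  then show ?case
    unfolding picard.simps vec_lambda_beta using Suc
    by (intro relax_nondecreasing(2) continuous_drv_picard drv_mono picard_nonneg) auto
qed simp

definition flow :: "real \<Rightarrow> 'k rvec" where
  "flow t = (\<chi> i. lim (\<lambda>m. picard m t $ i))"

lemma picard_tendsto: "0 \<le> t \<Longrightarrow> (\<lambda>m. picard m t $ i) \<longlonglongrightarrow> flow t $ i"
proof -
  assume t: "0 \<le> t"
  have "incseq (\<lambda>m. picard m t $ i)" by (intro incseq_SucI picard_incseq t)
  moreover have "picard m t $ i \<le> z $ i" for m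
    by (intro picard_le_super z_nonneg t less_imp_le[OF z_super])
  ultimately have "convergent (\<lambda>m. picard m t $ i)"
    by (meson Bseq_mono_convergent incseq_convergent convergentI)
  then show ?thesis by (simp add: flow_def convergent_LIMSEQ_iff)
qed

lemma flow_ge_init: "0 \<le> t \<Longrightarrow> x0 $ i \<le> flow t $ i"
  by (rule LIMSEQ_le_const[OF picard_tendsto]) (auto simp: init_le_picard)

lemma flow_le_super:
  assumes "\<And>i. 0 \<le> v $ i" "\<And>i. drv v i \<le> v $ i" "0 \<le> t"
  shows "flow t $ i \<le> v $ i"
  by (rule LIMSEQ_le_const2[OF picard_tendsto]) (use assms in \<open>auto intro!: picard_le_super\<close>)

lemma flow_mono: "0 \<le> t \<Longrightarrow> t \<le> t' \<Longrightarrow> flow t $ i \<le> flow t' $ i"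
  by (rule LIMSEQ_le[OF picard_tendsto picard_tendsto]) (auto intro!: picard_mono_time)

lemma flow_nonneg: "0 \<le> t \<Longrightarrow> 0 \<le> flow t $ i"
  using flow_ge_init[of t i] init_pos[of i] by simp

lemma drv_picard_bound:
  assumes "0 \<le> t"
  shows "\<bar>drv (picard m t) i\<bar> \<le> drv z i"
proof -
  have "0 \<le> drv (picard m t) i"
    using drv_ge_alpha[of "picard m t" i] alpha_nonneg[of i] picard_nonneg[OF assms] by (meson order_trans)
  moreover have "drv (picard m t) i \<le> drv z i"
    using assms by (intro drv_mono picard_nonneg picard_le_super z_nonneg less_imp_le[OF z_super])
  ultimately show ?thesis by simp
qed

text \<open>The convergence is only known pointwise, so dominated convergence with the bound
  \<open>drv z i\<close> is used. Continuity of the limit is deduced later from its integral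
  equation.\<close>

lemma flow_integrable_limit:
  assumes T: "0 \<le> T"
  shows "(\<lambda>s. exp s * drv (flow s) i) integrable_on {0..T}"
    and "(\<lambda>m. integral {0..T} (\<lambda>s. exp s * drv (picard m s) i)) \<longlonglongrightarrow> integral {0..T} (\<lambda>s. exp s * drv (flow s) i)"
proof -
  have *: "(\<lambda>s. exp s * drv (picard m s) i) integrable_on {0..T}" for m
    by (intro integrable_exp_mult continuous_drv_picard) auto
  have h: "(\<lambda>s. exp s * drv z i) integrable_on {0..T}"
    by (intro integrable_exp_mult) auto
  have dom: "norm (exp s * drv (picard m s) i) \<le> exp s * drv z i" if "s \<in> {0..T}" for m s
    using drv_picard_bound[of s m i] that by (simp add: abs_mult)
  have lim: "(\<lambda>m. exp s * drv (picard m s) i) \<longlonglongrightarrow> exp s * drv (flow s) i" if "s \<in> {0..T}" for s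
    using that by (intro tendsto_intros picard_tendsto) auto
  show "(\<lambda>s. exp s * drv (flow s) i) integrable_on {0..T}"
    and "(\<lambda>m. integral {0..T} (\<lambda>s. exp s * drv (picard m s) i)) \<longlonglongrightarrow> integral {0..T} (\<lambda>s. exp s * drv (flow s) i)"
    using dominated_convergence[OF * h dom lim] by auto
qed

lemma flow_relax:
  assumes "0 \<le> t"
  shows "flow t $ i = relax (x0 $ i) (\<lambda>s. drv (flow s) i) t"
proof (rule LIMSEQ_unique)
  show "(\<lambda>m. picard (Suc m) t $ i) \<longlonglongrightarrow> flow t $ i"
    using picard_tendsto[OF assms] by (rule LIMSEQ_Suc)
  show "(\<lambda>m. picard (Suc m) t $ i) \<longlonglongrightarrow> relax (x0 $ i) (\<lambda>s. drv (flow s) i) t"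
    unfolding picard.simps vec_lambda_beta relax_def
    by (intro tendsto_intros flow_integrable_limit assms)
qed

lemma continuous_flow: "continuous_on {0..} (\<lambda>t. flow t $ i)"
proof -
  have "continuous_on {0..} (relax (x0 $ i) (\<lambda>s. drv (flow s) i))"
    by (intro relax_continuous flow_integrable_limit)
  then show ?thesis by (rule continuous_on_eq) (simp add: flow_relax)
qed

lemma flow_0: "flow 0 = x0"
  by (simp add: vec_eq_iff flow_relax)

lemma flow_has_derivative:
  assumes "0 \<le> t"
  shows "((\<lambda>t. flow t $ i) has_real_derivative rho r \<alpha> X (flow t) $ i) (at t within {0..})"
proof -
  have "(relax (x0 $ i) (\<lambda>s. drv (flow s) i) has_real_derivative drv (flow t) i - flow t $ i) (at t within {0..})"
    using relax_has_derivative[of "\<lambda>s. drv (flow s) i" t "x0 $ i"] assms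
    by (simp add: continuous_on_drive continuous_flow flow_relax)
  then show ?thesis
    unfolding rho_eq_drive
    by (rule has_field_derivative_transform_within[of _ _ _ _ 1]) (use assms in \<open>auto simp: flow_relax\<close>)
qed

text \<open>Up to time \<open>t\<close> the drive is at most its value at \<open>t\<close>, so the
  flow is bounded by a convex combination of \<open>x0\<close> and that value. The weight of
  \<open>x0\<close> is positive and \<open>x0\<close> is a strict subsolution, hence
  strictness.\<close>

lemma rho_flow_pos:
  assumes t: "0 \<le> t"
  shows "0 < rho r \<alpha> X (flow t) $ i"
proof -
  have le: "drv x0 i \<le> drv (flow t) i"
    using t by (intro drv_mono flow_ge_init less_imp_le[OF init_pos])
  have "flow t $ i \<le> exp (- t) * x0 $ i + (1 - exp (- t)) * drv (flow t) i"
    unfolding flow_relax[OF t]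
    using t by (intro relax_le continuous_on_drive continuous_flow drv_mono flow_nonneg)
      (auto simp: flow_relax[symmetric] intro!: drv_mono flow_nonneg flow_mono)
  also have "\<dots> < exp (- t) * drv (flow t) i + (1 - exp (- t)) * drv (flow t) i"
    using init_sub[of i] le by (intro add_strict_right_mono mult_strict_left_mono) auto
  finally show ?thesis by (simp add: rho_eq_drive algebra_simps)
qed

text \<open>Strictness comes from the initial point, which is strictly below \<open>z\<close> and
  keeps the positive weight \<open>exp (- t)\<close>.\<close>

lemma flow_less_z:
  assumes t: "0 \<le> t"
  shows "flow t $ i < z $ i"
proof -
  have "flow t $ i \<le> exp (- t) * x0 $ i + (1 - exp (- t)) * drv z i"
    unfolding flow_relax[OF t] using t
    by (intro relax_le continuous_on_drive continuous_flow drv_mono flow_nonneg flow_le_super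
        z_nonneg less_imp_le[OF z_super]) auto
  also have "\<dots> < exp (- t) * z $ i + (1 - exp (- t)) * z $ i"
    using init_below_super[of z i] z_nonneg z_super[of i] t less_imp_le[OF z_super]
    by (intro add_less_le_mono mult_strict_left_mono mult_left_mono) auto
  finally show ?thesis by (simp add: algebra_simps)
qed

section \<open>The limit of the flow as least supersolution\<close>

definition limit_pt :: "'k rvec" where
  "limit_pt = (\<chi> i. lim (\<lambda>n. flow (real n) $ i))"

lemma flow_seq_tendsto: "(\<lambda>n. flow (real n) $ i) \<longlonglongrightarrow> limit_pt $ i"
proof -
  have "incseq (\<lambda>n. flow (real n) $ i)" by (intro incseq_SucI flow_mono) auto
  moreover have "flow (real n) $ i \<le> z $ i" for n using flow_less_z[of "real n" i] by simp
  ultimately have "convergent (\<lambda>n. flow (real n) $ i)"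
    by (meson incseq_convergent convergentI)
  then show ?thesis by (simp add: limit_pt_def convergent_LIMSEQ_iff)
qed

lemma flow_le_limit: "0 \<le> t \<Longrightarrow> flow t $ i \<le> limit_pt $ i"
proof (rule LIMSEQ_le_const[OF flow_seq_tendsto])
  assume t: "0 \<le> t"
  show "\<exists>N. \<forall>n\<ge>N. flow t $ i \<le> flow (real n) $ i"
    using t real_nat_ceiling_ge[of t] by (intro exI[of _ "nat \<lceil>t\<rceil>"] allI impI flow_mono) linarith+
qed

lemma flow_tendsto: "((\<lambda>t. flow t $ i) \<longlongrightarrow> limit_pt $ i) at_top"
proof (rule order_tendstoI)
  fix a assume "a < limit_pt $ i"
  then obtain n where n: "a < flow (real n) $ i"
    using order_tendstoD(1)[OF flow_seq_tendsto[of i]] by (auto simp: eventually_sequentially)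
  then have "a < flow t $ i" if "real n \<le> t" for t
    using flow_mono[of "real n" t i] that by simp
  then show "\<forall>\<^sub>F t in at_top. a < flow t $ i" by (auto simp: eventually_at_top_linorder)
next
  fix a assume "limit_pt $ i < a"
  then have "flow t $ i < a" if "0 \<le> t" for t using flow_le_limit[OF that, of i] by simp
  then show "\<forall>\<^sub>F t in at_top. flow t $ i < a" by (auto simp: eventually_at_top_linorder)
qed

lemma limit_nonneg: "0 \<le> limit_pt $ i"
  using flow_le_limit[of 0 i] flow_nonneg[of 0 i] by simp

lemma limit_le_super:
  assumes "\<And>i. 0 \<le> v $ i" "\<And>i. drv v i \<le> v $ i"
  shows "limit_pt $ i \<le> v $ i"
  by (rule LIMSEQ_le_const2[OF flow_seq_tendsto]) (use assms in \<open>auto intro!: flow_le_super\<close>)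

lemma drv_limit: "drv limit_pt i = limit_pt $ i"
proof (rule antisym)
  have lim: "(\<lambda>n. drv (flow (real n)) i) \<longlonglongrightarrow> drv limit_pt i"
    by (intro tendsto_intros flow_seq_tendsto)
  show "limit_pt $ i \<le> drv limit_pt i"
    using rho_flow_pos by (intro LIMSEQ_le[OF flow_seq_tendsto lim]) (auto simp: rho_eq_drive less_imp_le)
  \<comment> \<open>After time \<open>t\<close> the drive never falls below its value at
    \<open>t\<close>, so the flow relaxes at least to that value; afterwards \<open>t\<close> itself
    tends to infinity.\<close>
  have "drv (flow t) i \<le> limit_pt $ i" if t: "0 \<le> t" for t
  proof -
    have ge: "exp (t - t') * flow t $ i + (1 - exp (t - t')) * drv (flow t) i \<le> limit_pt $ i" if "t \<le> t'" for t'
    proof -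
      have "exp (t - t') * flow t $ i + (1 - exp (t - t')) * drv (flow t) i \<le> flow t' $ i"
        unfolding flow_relax[OF t] flow_relax[OF order_trans[OF t that]]
        using t that
        by (intro relax_shift_ge continuous_on_drive continuous_flow)
          (auto simp: flow_relax[symmetric] intro!: drv_mono flow_nonneg flow_mono)
      then show ?thesis using flow_le_limit[of t' i] t that by simp
    qed
    have "((\<lambda>t'. exp (t - t') * flow t $ i + (1 - exp (t - t')) * drv (flow t) i)
        \<longlongrightarrow> 0 * flow t $ i + (1 - 0) * drv (flow t) i) at_top"
      by (intro tendsto_intros; real_asymp)
    then have "0 * flow t $ i + (1 - 0) * drv (flow t) i \<le> limit_pt $ i"
      by (rule tendsto_upperbound) (auto simp: eventually_at_top_linorder intro!: exI[of _ t] ge)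
    then show ?thesis by simp
  qed
  then show "drv limit_pt i \<le> limit_pt $ i"
    by (intro LIMSEQ_le_const2[OF lim]) auto
qed

end

section \<open>Uniqueness of solutions\<close>

lemma ode_solution_unique:
  fixes f g :: "real \<Rightarrow> 'a::real_inner"
  assumes lip: "\<And>u v. u \<in> B \<Longrightarrow> v \<in> B \<Longrightarrow> norm (h u - h v) \<le> L * norm (u - v)"
    and f: "\<And>y. a \<le> y \<Longrightarrow> f y \<in> B" "\<And>y. a \<le> y \<Longrightarrow> (f has_vector_derivative h (f y)) (at y within {a..})"
    and g: "\<And>y. a \<le> y \<Longrightarrow> g y \<in> B" "\<And>y. a \<le> y \<Longrightarrow> (g has_vector_derivative h (g y)) (at y within {a..})"
    and init: "f a = g a" and y: "a \<le> y"
  shows "f y = g y"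
proof (cases "a = y")
  case False
  define d where "d y = f y - g y" for y
  \<comment> \<open>Gronwall's argument: the squared distance grows at rate at most
    \<open>2 * L\<close>, so this weight makes it nonincreasing, starting from 0.\<close>
  define \<phi> where "\<phi> t = exp (- 2 * L * t) * (d t \<bullet> d t)" for t
  have der: "(\<phi> has_real_derivative exp (- 2 * L * t) * (2 * (d t \<bullet> (h (f t) - h (g t)))) - 2 * L * exp (- 2 * L * t) * (d t \<bullet> d t))
      (at t within {a..})" if "a \<le> t" for t
  proof -
    have "(d has_vector_derivative (h (f t) - h (g t))) (at t within {a..})"
      unfolding d_def using that by (intro derivative_intros f g)
    then have "((\<lambda>t. d t \<bullet> d t) has_vector_derivative
        (d t \<bullet> (h (f t) - h (g t)) + (h (f t) - h (g t)) \<bullet> d t)) (at t within {a..})"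
      by (intro bounded_bilinear.has_vector_derivative[OF bounded_bilinear_inner])
    then have "((\<lambda>t. d t \<bullet> d t) has_real_derivative 2 * (d t \<bullet> (h (f t) - h (g t)))) (at t within {a..})"
      by (simp add: has_real_derivative_iff_has_vector_derivative inner_commute)
    note this [derivative_intros]
    show ?thesis unfolding \<phi>_def
      by (rule derivative_eq_intros refl | simp add: algebra_simps)+
  qed
  have "\<phi> y \<le> \<phi> a"
  proof (rule DERIV_nonpos_imp_decreasing_open[of a y \<phi>])
    show "a \<le> y" by (rule y)
    fix t assume t: "a < t" "t < y"
    have "at t within {a..} = at t" using t by (intro at_within_interior) auto
    moreover have "d t \<bullet> (h (f t) - h (g t)) \<le> L * (d t \<bullet> d t)"
    proof -
      have "d t \<bullet> (h (f t) - h (g t)) \<le> norm (d t) * norm (h (f t) - h (g t))"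
        by (rule norm_cauchy_schwarz)
      also have "\<dots> \<le> norm (d t) * (L * norm (d t))"
        using lip[of "f t" "g t"] f(1)[of t] g(1)[of t] t by (intro mult_left_mono) (auto simp: d_def)
      finally show ?thesis by (simp add: dot_square_norm power2_eq_square algebra_simps)
    qed
    then have "exp (- 2 * L * t) * (2 * (d t \<bullet> (h (f t) - h (g t)))) \<le> exp (- 2 * L * t) * (2 * (L * (d t \<bullet> d t)))"
      by (intro mult_left_mono) auto
    ultimately show "\<exists>u. (\<phi> has_real_derivative u) (at t) \<and> u \<le> 0"
      using der[of t] t by (intro exI conjI) (auto simp: algebra_simps)
  next
    have "continuous_on {a..} \<phi>"
      using der by (auto simp: continuous_on_eq_continuous_within intro: DERIV_continuous)
    then show "continuous_on {a..y} \<phi>" by (rule continuous_on_subset) auto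
  qed
  also have "\<phi> a = 0" by (simp add: \<phi>_def d_def init)
  finally have "d y \<bullet> d y \<le> 0" by (simp add: \<phi>_def mult_le_0_iff not_le)
  then have "d y \<bullet> d y = 0" by (intro antisym inner_ge_zero)
  then have "d y = 0" by simp
  then show ?thesis by (simp add: d_def)
qed (use init in simp)

text \<open>With \<open>1 \<le> K\<close> the factor \<open>K ^ n\<close> may replace the sharper
  power with exponent one less, which keeps the induction uniform from \<open>n = 0\<close>.\<close>

lemma abs_power_diff_le:
  assumes "\<bar>a :: real\<bar> \<le> K" "\<bar>b\<bar> \<le> K" "1 \<le> K"
  shows "\<bar>a ^ n - b ^ n\<bar> \<le> real n * K ^ n * \<bar>a - b\<bar>"
proof (induction n)
  case (Suc n)
  have "\<bar>a ^ Suc n - b ^ Suc n\<bar> = \<bar>a * (a ^ n - b ^ n) + (a - b) * b ^ n\<bar>"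
    by (simp add: algebra_simps)
  also have "\<dots> \<le> \<bar>a\<bar> * \<bar>a ^ n - b ^ n\<bar> + \<bar>a - b\<bar> * \<bar>b\<bar> ^ n"
    by (metis abs_mult abs_triangle_ineq power_abs)
  also have "\<dots> \<le> K * (real n * K ^ n * \<bar>a - b\<bar>) + \<bar>a - b\<bar> * K ^ Suc n"
  proof -
    have "\<bar>b\<bar> ^ n \<le> K ^ n" using assms by (intro power_mono) auto
    also have "\<dots> \<le> K ^ Suc n" using assms by (intro power_increasing) auto
    finally show ?thesis using assms Suc by (intro add_mono mult_mono) auto
  qed
  finally show ?case by (simp add: algebra_simps)
qed simp

lemma has_vector_derivative_vec:
  assumes "\<And>i. ((\<lambda>t. f t $ i) has_real_derivative f' $ i) (at t within S)"
  shows "(f has_vector_derivative (f' :: 'k::finite rvec)) (at t within S)"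
proof -
  have eq: "(\<Sum>i\<in>UNIV. (v $ i) *\<^sub>R axis i 1) = v" for v :: "'k rvec"
    using basis_expansion[of v] by (simp add: scalar_mult_eq_scaleR)
  have "((\<lambda>t. \<Sum>i\<in>UNIV. (f t $ i) *\<^sub>R axis i 1) has_vector_derivative
      (\<Sum>i\<in>UNIV. (f' $ i) *\<^sub>R axis i 1 :: 'k rvec)) (at t within S)"
    using assms by (auto intro!: has_vector_derivative_sum derivative_eq_intros)
  then show ?thesis unfolding eq .
qed

lemma rho_lipschitz_on_bounded:
  assumes "bounded B"
  obtains L where "\<And>u v. u \<in> B \<Longrightarrow> v \<in> B \<Longrightarrow> norm (rho r \<alpha> X u - rho r \<alpha> X v) \<le> L * norm (u - v)"
proof -
  obtain M where M: "\<And>u. u \<in> B \<Longrightarrow> norm u \<le> M" "0 < M" using assms bounded_pos by metis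
  define A where "A i = (\<Sum>j\<in>UNIV. \<bar>X $ i $ j\<bar>)" for i
  define K where "K i = max 1 (A i * M)" for i
  define C where "C i = \<bar>bp_const r\<bar> * (real r * K i ^ r) * A i" for i
  have lin: "\<bar>\<Sum>j\<in>UNIV. X $ i $ j * w $ j\<bar> \<le> A i * norm w" for i and w :: "'a rvec"
  proof -
    have "\<bar>\<Sum>j\<in>UNIV. X $ i $ j * w $ j\<bar> \<le> (\<Sum>j\<in>UNIV. \<bar>X $ i $ j\<bar> * norm w)"
      by (rule order_trans[OF sum_abs])
         (auto simp: abs_mult intro!: sum_mono mult_left_mono component_le_norm_cart)
    then show ?thesis by (simp add: A_def sum_distrib_right)
  qed
  have A: "0 \<le> A i" for i by (simp add: A_def sum_nonneg)
  have "norm (rho r \<alpha> X u - rho r \<alpha> X v) \<le> (\<Sum>i\<in>UNIV. C i + 1) * norm (u - v)" if uv: "u \<in> B" "v \<in> B" for u v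
  proof -
    have "\<bar>(rho r \<alpha> X u - rho r \<alpha> X v) $ i\<bar> \<le> (C i + 1) * norm (u - v)" for i
    proof -
      define a b where "a = (\<Sum>j\<in>UNIV. X $ i $ j * u $ j)" and "b = (\<Sum>j\<in>UNIV. X $ i $ j * v $ j)"
      have K: "\<bar>a\<bar> \<le> K i" "\<bar>b\<bar> \<le> K i"
        unfolding a_def b_def K_def using lin[of i u] lin[of i v] M uv A[of i]
        by (meson max.coboundedI2 mult_left_mono order_trans)+
      have ab: "a - b = (\<Sum>j\<in>UNIV. X $ i $ j * (u - v) $ j)"
        by (simp add: a_def b_def sum_subtractf algebra_simps)
      have "\<bar>a ^ r - b ^ r\<bar> \<le> real r * K i ^ r * \<bar>a - b\<bar>"
        by (rule abs_power_diff_le[OF K]) (simp add: K_def)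
      also have "\<dots> \<le> real r * K i ^ r * (A i * norm (u - v))"
        unfolding ab by (intro mult_left_mono lin) (auto simp: K_def)
      finally have "\<bar>bp_const r\<bar> * \<bar>a ^ r - b ^ r\<bar> \<le> C i * norm (u - v)"
        unfolding C_def by (simp add: mult_left_mono mult.assoc)
      moreover have "\<bar>(u - v) $ i\<bar> \<le> norm (u - v)" by (rule component_le_norm_cart)
      moreover have "(rho r \<alpha> X u - rho r \<alpha> X v) $ i = bp_const r * (a ^ r - b ^ r) - (u - v) $ i"
        by (simp add: rho_eq_drive drive_def a_def b_def algebra_simps)
      ultimately show ?thesis
        using abs_triangle_ineq4[of "bp_const r * (a ^ r - b ^ r)" "(u - v) $ i"]
        by (simp add: distrib_right abs_mult)
    qed
    then have "(\<Sum>i\<in>UNIV. \<bar>(rho r \<alpha> X u - rho r \<alpha> X v) $ i\<bar>) \<le> (\<Sum>i\<in>UNIV. (C i + 1) * norm (u - v))"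
      by (rule sum_mono)
    then show ?thesis using norm_le_l1_cart[of "rho r \<alpha> X u - rho r \<alpha> X v"]
      by (simp add: sum_distrib_right)
  qed
  then show thesis by (rule that)
qed

section \<open>Identification of the flow with the given Cauchy solution\<close>

context subcritical_flow
begin

text \<open>Since \<open>X\<close> is nonnegative, all constraints of the domain other than
  nonnegativity are inherited by smaller vectors.\<close>

lemma below_z_dom:
  assumes "\<And>i. 0 \<le> v $ i" "\<And>i. v $ i \<le> z $ i"
  shows "v \<in> dom_D r X"
  unfolding dom_D_def mem_Collect_eq
proof (intro allI conjI)
  fix i
  show "0 \<le> v $ i" by (rule assms)
  show "v $ i \<le> real r / (real r - 1)"
    using assms(2)[of i] z_dom by (auto simp: dom_D_def intro: order_trans)
  have "v $ i + (\<Sum>j\<in>UNIV - {i}. X $ i $ j * v $ j) \<le> z $ i + (\<Sum>j\<in>UNIV - {i}. X $ i $ j * z $ j)"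
    by (intro add_mono sum_mono mult_left_mono assms X_nonneg)
  also have "\<dots> \<le> real r / (real r - 1)" using z_dom by (simp add: dom_D_def)
  finally show "v $ i + (\<Sum>j\<in>UNIV - {i}. X $ i $ j * v $ j) \<le> real r / (real r - 1)" .
qed

lemma bounded_dom: "bounded (dom_D r X)"
proof (rule bounded_subset[OF bounded_cbox])
  show "dom_D r X \<subseteq> cbox 0 (\<chi> i. real r / (real r - 1))"
    by (auto simp: dom_D_def mem_box_cart)
qed

lemma flow_in_dom: "0 \<le> t \<Longrightarrow> flow t \<in> dom_D r X"
  by (intro below_z_dom flow_nonneg less_imp_le[OF flow_less_z])

text \<open>The centre \<open>x0\<close> is itself in the domain, so a ball whose radius is the
  diameter contains the whole domain.\<close>

lemma flow_in_ball: "0 \<le> t \<Longrightarrow> flow t \<in> ball_B r \<alpha> X"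
  using diameter_bounded_bound[OF bounded_dom flow_in_dom[of 0] flow_in_dom[of t]]
  by (simp add: ball_B_def flow_0)

lemma flow_vector_derivative:
  assumes "y0 \<le> y"
  shows "((\<lambda>y. flow (y - y0)) has_vector_derivative rho r \<alpha> X (flow (y - y0))) (at y within {y0..})"
proof -
  have "(flow has_vector_derivative rho r \<alpha> X (flow (y - y0))) (at (y - y0) within {0..})"
    using assms by (intro has_vector_derivative_vec flow_has_derivative) auto
  then have "(flow has_vector_derivative rho r \<alpha> X (flow (y - y0))) (at (y - y0) within (\<lambda>y. y - y0) ` {y0..})"
    by (rule has_vector_derivative_within_subset) auto
  then have "(flow \<circ> (\<lambda>y. y - y0) has_vector_derivative 1 *\<^sub>R rho r \<alpha> X (flow (y - y0))) (at y within {y0..})"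
    by (intro vector_diff_chain_within) (auto intro!: derivative_eq_intros)
  then show ?thesis by (simp add: o_def)
qed

lemma flow_solves: "solves_in_ball r \<alpha> X y0 {y0..y} (\<lambda>y. flow (y - y0))"
  unfolding solves_in_ball_def
  by (auto simp: flow_0 intro!: flow_in_ball has_vector_derivative_within_subset[OF flow_vector_derivative])

text \<open>The flow solves the problem inside the ball on every bounded interval, so the supremum
  defining \<open>yp\<close> is infinite. Uniqueness on the ball, where the field is Lipschitz, then
  identifies \<open>x\<close>.\<close>

lemma cauchy_solution_flow:
  assumes "cauchy_solution r \<alpha> X y0 yp x"
  shows "yp = \<infinity>" "\<And>y. y0 \<le> y \<Longrightarrow> x y = flow (y - y0)"
proof -
  have yp: "yp = Sup {ereal y | y. y0 < y \<and> (\<exists>z. solves_in_ball r \<alpha> X y0 {y0..y} z)}"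
    and sol: "solves_in_ball r \<alpha> X y0 {y. y0 \<le> y \<and> ereal y < yp} x"
    using assms by (auto simp: cauchy_solution_def)
  have "ereal y \<le> yp" for y
  proof -
    \<comment> \<open>Only times after \<open>y0\<close> enter the supremum, hence the maximum with
      \<open>y0 + 1\<close>.\<close>
    have "ereal (max y (y0 + 1)) \<le> yp"
      unfolding yp
      by (intro Sup_upper CollectI exI[of _ "max y (y0 + 1)"] conjI exI[of _ "\<lambda>y. flow (y - y0)"] flow_solves) auto
    then show ?thesis by (rule order_trans[rotated]) simp
  qed
  then show inf: "yp = \<infinity>" by (rule ereal_top)
  have J: "{y. y0 \<le> y \<and> ereal y < yp} = {y0..}" using inf by auto
  obtain L where L: "\<And>u v. u \<in> ball_B r \<alpha> X \<Longrightarrow> v \<in> ball_B r \<alpha> X \<Longrightarrow>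
      norm (rho r \<alpha> X u - rho r \<alpha> X v) \<le> L * norm (u - v)"
    using rho_lipschitz_on_bounded[of "ball_B r \<alpha> X" r \<alpha> X] unfolding ball_B_def by (metis bounded_cball)
  fix y assume y: "y0 \<le> y"
  show "x y = flow (y - y0)"
    by (rule ode_solution_unique[where h = "rho r \<alpha> X" and B = "ball_B r \<alpha> X" and g = "\<lambda>y. flow (y - y0)" and a = y0, OF L])
       (use sol[unfolded J solves_in_ball_def] y in \<open>auto simp: flow_0 flow_in_ball flow_vector_derivative\<close>)
qed

text \<open>All constraints hold strictly along the flow, so a ball around \<open>flow t\<close>
  lies in the admissible region. The trajectory from \<open>x0\<close> connects that ball to the
  initial point, which puts it in the right component.\<close>

lemma flow_interior: 
  assumes t: "0 \<le> t"
  shows "flow t \<in> interior (region_E r \<alpha> X)"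
proof -
  define U where "U = {v :: 'k rvec. \<forall>i. 0 < v $ i \<and> v $ i < z $ i \<and> 0 < drv v i - v $ i}"
  have cont: "continuous_on UNIV (\<lambda>v. drv v i - v $ i)" for i
    by (intro continuous_intros continuous_on_drive continuous_on_component)
  have oU: "open U"
    unfolding U_def Collect_all_eq
    by (intro open_INT ballI finite_UNIV open_Collect_conj open_Collect_less cont)
       (auto intro!: continuous_intros)
  have flowU: "flow s \<in> U" if "0 \<le> s" for s
    unfolding U_def mem_Collect_eq rho_eq_drive[symmetric]
    by (intro allI conjI flow_less_z rho_flow_pos less_le_trans[OF init_pos flow_ge_init] that)
  have "\<exists>e>0. ball (flow t) e \<subseteq> U"
    by (rule bspec[OF oU[unfolded open_contains_ball] flowU[OF t]])
  then obtain e where e: "0 < e" "ball (flow t) e \<subseteq> U" by (elim exE conjE)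
  have UE: "U \<subseteq> region_E' r \<alpha> X"
  proof
    fix v assume "v \<in> U"
    then have v: "0 < v $ i" "v $ i < z $ i" "0 < drv v i - v $ i" for i by (simp_all add: U_def)
    have "v \<in> dom_D r X" by (rule below_z_dom) (rule less_imp_le[OF v(1)], rule less_imp_le[OF v(2)])
    moreover have "0 \<le> rho r \<alpha> X v $ i" for i using v(3)[of i] by (simp add: rho_eq_drive)
    ultimately show "v \<in> region_E' r \<alpha> X" by (simp add: region_E'_def)
  qed
  have cont_flow: "continuous_on {0..t} flow"
  proof (rule continuous_on_subset)
    show "continuous_on {0..} flow"
      unfolding continuous_on_eq_continuous_within
      by (intro ballI has_vector_derivative_continuous[OF has_vector_derivative_vec[OF flow_has_derivative]]) auto
  qed auto
  define S where "S = flow ` {0..t} \<union> ball (flow t) e"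
  have "flow t \<in> flow ` {0..t} \<inter> ball (flow t) e" using e t by simp
  then have "flow ` {0..t} \<inter> ball (flow t) e \<noteq> {}" by blast
  then have "connected S"
    unfolding S_def
    by (intro connected_Un connected_continuous_image[OF cont_flow] connected_ball) auto
  moreover have "x0 \<in> S" using t by (auto simp: S_def flow_0[symmetric])
  moreover have "S \<subseteq> region_E' r \<alpha> X"
    using e UE flowU by (auto simp: S_def)
  ultimately have "S \<subseteq> connected_component_set (region_E' r \<alpha> X) x0"
    by (simp add: connected_component_maximal)
  then have "ball (flow t) e \<subseteq> region_E r \<alpha> X"
    unfolding region_E_def S_def using closure_subset by blast
  then show ?thesis using e by (auto simp: mem_interior)
qed

lemma exit_point_eq_limit:
  assumes "cauchy_solution r \<alpha> X y0 yp x"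
  shows "exit_point r \<alpha> X y0 yp x = limit_pt"
proof -
  note x = cauchy_solution_flow[OF assms]
  have "exit_time r \<alpha> X y0 yp x = Inf {}"
    unfolding exit_time_def using x flow_interior by (intro arg_cong[where f = Inf]) force
  then have T: "exit_time r \<alpha> X y0 yp x = \<infinity>" by (simp add: top_ereal_def)
  have "(flow \<longlongrightarrow> limit_pt) at_top" by (rule vec_tendstoI) (rule flow_tendsto)
  moreover have "filterlim (\<lambda>y. y - y0) at_top at_top" by real_asymp
  ultimately have "((\<lambda>y. flow (y - y0)) \<longlongrightarrow> limit_pt) at_top" by (rule filterlim_compose)
  then have "(x \<longlongrightarrow> limit_pt) at_top"
    by (rule Lim_transform_eventually) (use x(2) in \<open>auto simp: eventually_at_top_linorder intro!: exI[of _ y0]\<close>)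
  then show ?thesis unfolding exit_point_def left_limit_def T by (simp add: tendsto_Lim)
qed

end

section \<open>Strict supersolutions and excess below the limit\<close>

context subcritical_flow
begin

lemma limit_less_z: "limit_pt $ i < z $ i"
proof -
  have "limit_pt $ j \<le> z $ j" for j
    by (intro limit_le_super z_nonneg less_imp_le[OF z_super])
  then have "drv limit_pt i \<le> drv z i" by (intro drv_mono limit_nonneg)
  then show ?thesis using z_super[of i] by (simp add: drv_limit)
qed

text \<open>Each component of the drive is convex on nonnegative vectors. \<open>limit_pt\<close> is
  a fixed point and \<open>z\<close> a strict supersolution, so points of the segment between them,
  other than \<open>limit_pt\<close>, are strict supersolutions too.\<close>

lemma super_near_limit:
  assumes "0 < \<epsilon>"
  obtains w where "\<And>i. limit_pt $ i \<le> w $ i" "\<And>i. w $ i \<le> limit_pt $ i + \<epsilon>" "\<And>i. drv w i < w $ i"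
proof -
  \<comment> \<open>Bounds every coordinate of \<open>z - limit_pt\<close>; the summand 1 makes the
    division in \<open>\<tau>\<close> safe.\<close>
  define C where "C = 1 + (\<Sum>i\<in>UNIV. z $ i - limit_pt $ i)"
  have d: "0 \<le> z $ i - limit_pt $ i" for i using limit_less_z[of i] by simp
  have C: "1 \<le> C" "z $ i - limit_pt $ i \<le> C" for i
    using member_le_sum[of i UNIV "\<lambda>i. z $ i - limit_pt $ i"] d by (simp_all add: C_def sum_nonneg)
  define \<tau> where "\<tau> = min 1 (\<epsilon> / C)"
  have \<tau>: "0 < \<tau>" "\<tau> \<le> 1" "\<tau> * C \<le> \<epsilon>" using assms C by (auto simp: \<tau>_def min_def field_simps)
  define w where "w = (\<chi> i. (1 - \<tau>) * limit_pt $ i + \<tau> * z $ i)"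
  have w: "w $ i = limit_pt $ i + \<tau> * (z $ i - limit_pt $ i)" for i by (simp add: w_def algebra_simps)
  show thesis
  proof
    fix i
    show "limit_pt $ i \<le> w $ i" unfolding w using \<tau> d[of i] by simp
    have "\<tau> * (z $ i - limit_pt $ i) \<le> \<tau> * C" using C \<tau> by (intro mult_left_mono) auto
    then show "w $ i \<le> limit_pt $ i + \<epsilon>" unfolding w using \<tau>(3) by linarith
    define a b where "a = (\<Sum>j\<in>UNIV. X $ i $ j * limit_pt $ j)" and "b = (\<Sum>j\<in>UNIV. X $ i $ j * z $ j)"
    have ab: "0 \<le> a" "0 \<le> b"
      by (auto simp: a_def b_def intro!: sum_nonneg mult_nonneg_nonneg X_nonneg limit_nonneg z_nonneg)
    have "(\<Sum>j\<in>UNIV. X $ i $ j * w $ j) = (1 - \<tau>) * a + \<tau> * b"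
      unfolding a_def b_def sum_distrib_left sum.distrib[symmetric]
      by (rule sum.cong) (simp_all add: w_def algebra_simps)
    moreover have "((1 - \<tau>) * a + \<tau> * b) ^ r \<le> (1 - \<tau>) * a ^ r + \<tau> * b ^ r"
    proof -
      have "convex_on {0..} (\<lambda>x::real. x ^ r)"
        by (cases "even r") (auto intro: convex_power_odd convex_on_subset[OF convex_power_even])
      from convex_onD[OF this, of \<tau> a b] show ?thesis using \<tau> ab by simp
    qed
    ultimately have "drv w i \<le> \<alpha> $ i + bp_const r * ((1 - \<tau>) * a ^ r + \<tau> * b ^ r)"
      unfolding drive_def using const_pos by (intro add_left_mono mult_left_mono) auto
    also have "\<dots> = (1 - \<tau>) * drv limit_pt i + \<tau> * drv z i"
      by (simp add: drive_def a_def b_def algebra_simps)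
    also have "\<dots> < (1 - \<tau>) * limit_pt $ i + \<tau> * z $ i"
      using \<tau> z_super[of i] by (simp add: drv_limit)
    finally show "drv w i < w $ i" by (simp add: w_def)
  qed
qed

text \<open>Compactness: among the nonnegative vectors below \<open>w\<close> with some coordinate
  at least \<open>\<epsilon>\<close> under the limit there is no supersolution, as the limit is the
  least one. The total positive excess \<open>f\<close> is thus bounded away from 0, and some
  coordinate carries at least the average.\<close>

lemma excess_below_limit:
  assumes "0 < \<epsilon>"
  obtains \<eta> where "0 < \<eta>"
    "\<And>v j. (\<And>i. 0 \<le> v $ i) \<Longrightarrow> (\<And>i. v $ i \<le> w $ i) \<Longrightarrow> v $ j \<le> limit_pt $ j - \<epsilon> \<Longrightarrow>
      \<exists>i. \<eta> \<le> drv v i - v $ i"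
proof -
  define K where "K = (\<Union>j. cbox 0 w \<inter> {v. v $ j \<le> limit_pt $ j - \<epsilon>})"
  define f where "f v = (\<Sum>i\<in>UNIV. max 0 (drv v i - v $ i))" for v
  have "compact K"
    unfolding K_def
    by (intro compact_UN compact_Int_closed compact_cbox closed_Collect_le continuous_intros) simp_all
  moreover have "continuous_on K f"
    unfolding f_def by (intro continuous_intros continuous_on_drive)
  moreover have f_pos: "0 < f v" if vK: "v \<in> K" for v
  proof (rule ccontr)
    assume "\<not> 0 < f v"
    moreover have "max 0 (drv v i - v $ i) \<le> f v" for i
      unfolding f_def by (rule member_le_sum) auto
    ultimately have "drv v i \<le> v $ i" for i by (smt (verit))
    moreover have "0 \<le> v $ i" for i using vK by (auto simp: K_def mem_box_cart)
    ultimately have "limit_pt $ j \<le> v $ j" for j by (intro limit_le_super)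
    moreover obtain j where "v $ j \<le> limit_pt $ j - \<epsilon>" using vK by (auto simp: K_def)
    ultimately show False using assms by (smt (verit))
  qed
  ultimately obtain m where m: "0 < m" "\<And>v. v \<in> K \<Longrightarrow> m \<le> f v"
  proof (cases "K = {}")
    case False
    then obtain v0 where "v0 \<in> K" "\<And>v. v \<in> K \<Longrightarrow> f v0 \<le> f v"
      using continuous_attains_inf[OF \<open>compact K\<close> False \<open>continuous_on K f\<close>] by blast
    then show ?thesis using that f_pos by blast
  qed (use that[of 1] in auto)
  show thesis
  proof (rule that)
    show "0 < m / real CARD('k)" using m by simp
    fix v j assume v: "\<And>i. 0 \<le> v $ i" "\<And>i. v $ i \<le> w $ i" "v $ j \<le> limit_pt $ j - \<epsilon>"
    then have "v \<in> K" by (auto simp: K_def mem_box_cart)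
    show "\<exists>i. m / real CARD('k) \<le> drv v i - v $ i"
    proof (rule ccontr)
      assume "\<not> ?thesis"
      then have "max 0 (drv v i - v $ i) < m / real CARD('k)" for i using m by (auto simp: not_le)
      then have "f v < (\<Sum>i\<in>(UNIV :: 'k set). m / real CARD('k))"
        unfolding f_def by (intro sum_strict_mono) auto
      then show False using m(2)[OF \<open>v \<in> K\<close>] by simp
    qed
  qed
qed

end

text \<open>On \<open>dom_Drho\<close> all components of \<open>rho\<close> agree, so one negative
  component makes all of them negative.\<close>

lemma subcritical_imp_super:
  assumes "subcritical r \<alpha> X"
  obtains z where "z \<in> dom_D r X" "\<And>i. drive r \<alpha> X z i < z $ i"
proof -
  obtain z where z: "z \<in> dom_Drho r \<alpha> X" "rho r \<alpha> X z $ idx1 < 0"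
    using assms by (auto simp: subcritical_def is_arg_min_def)
  have "rho r \<alpha> X z $ i = rho r \<alpha> X z $ idx1" for i using z(1) by (simp add: dom_Drho_def)
  then have "rho r \<alpha> X z $ i < 0" for i using z(2) by metis
  then show thesis using z by (intro that[of z]) (auto simp: dom_Drho_def rho_eq_drive)
qed

section \<open>Asymptotics of the critical scale\<close>

lemma tendsto_zero_of_power:
  fixes f :: "'a \<Rightarrow> real"
  assumes "((\<lambda>x. f x ^ m) \<longlongrightarrow> 0) F" "0 < m"
  shows "(f \<longlongrightarrow> 0) F"
proof -
  have "((\<lambda>x. \<bar>f x\<bar> ^ m) \<longlongrightarrow> 0) F"
    using tendsto_rabs[OF assms(1)] by (simp add: power_abs)
  then have "((\<lambda>x. root m (\<bar>f x\<bar> ^ m)) \<longlongrightarrow> root m 0) F" by (rule tendsto_real_root)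
  then show ?thesis using assms(2) by (simp add: real_root_power_cancel tendsto_rabs_zero_iff)
qed

lemma sum_slots: "(\<Sum>(j, l)\<in>(SIGMA j:(UNIV :: 'k::finite set). {..<m j :: nat}). f j) = (\<Sum>j\<in>UNIV. real (m j) * f j)"
  by (subst sum.Sigma[symmetric]) auto

lemma act_prob_le:
  assumes "\<And>j. 0 \<le> q i j \<and> q i j \<le> 1"
  shows "act_prob r q m i \<le> (\<Sum>j\<in>UNIV. real (m j) * q i j) ^ r / fact r"
  unfolding act_prob_def sum_slots[symmetric]
  by (rule bcount_ge_upper) (use assms in auto)

lemma act_prob_ge:
  assumes "\<And>j. 0 \<le> q i j \<and> q i j \<le> pm" "pm \<le> 1"
  shows "(1 - (\<Sum>j\<in>UNIV. real (m j) * q i j)) * (max 0 ((\<Sum>j\<in>UNIV. real (m j) * q i j) - real r * pm) ^ r / fact r)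
    \<le> act_prob r q m i"
  unfolding act_prob_def sum_slots[symmetric]
proof (rule bcount_ge_lower)
  show "0 \<le> pm" using assms(1)[of undefined] by simp
qed (use assms in auto)

locale sbm_limit =
  fixes r :: nat
    and q :: "nat \<Rightarrow> 'k::{finite,linorder} \<Rightarrow> 'k \<Rightarrow> real"
    and a N :: "nat \<Rightarrow> 'k \<Rightarrow> nat"
    and p g :: "nat \<Rightarrow> 'k \<Rightarrow> real"
    and \<nu> \<mu> \<gamma> :: "'k \<Rightarrow> 'k \<Rightarrow> real"
    and \<alpha> :: "'k rvec" and X :: "'k rmat"
  assumes r: "r \<ge> 2"
    and p_def: "\<And>n i. p n i = q n i i"
    and g_def: "\<And>n i. g n i = crit_seeds r (N n i) (p n i)"
    and N_pos: "\<And>n i. n \<ge> CARD('k) \<Longrightarrow> N n i \<ge> 1"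
    and q_range: "\<And>n i j. n \<ge> CARD('k) \<Longrightarrow> 0 \<le> q n i j \<and> q n i j < 1"
    and q_sym: "\<And>n i j. n \<ge> CARD('k) \<Longrightarrow> q n i j = q n j i"
    and seeds_le: "\<And>n i. n \<ge> CARD('k) \<Longrightarrow> a n i \<le> N n i"
    and nu: "\<And>i j. 0 < \<nu> i j" "\<And>i j. (\<lambda>n. real (N n i) / real (N n j)) \<longlonglongrightarrow> \<nu> i j"
    and p_lower: "\<And>i. (\<lambda>n. 1 / real (N n i)) \<in> o(\<lambda>n. p n i)"
    and p_upper: "\<And>i. (\<lambda>n. p n i) \<in> o(\<lambda>n. real (N n i) powr (- 1 / real r))"
    and q_le: "\<And>n i j. n \<ge> CARD('k) \<Longrightarrow> q n i j \<le> min (p n i) (p n j)"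
    and gamma: "\<And>i j. 0 \<le> \<gamma> i j \<and> \<gamma> i j \<le> 1" "\<And>i j. (\<lambda>n. q n i j / p n i) \<longlonglongrightarrow> \<gamma> i j"
    and mu: "\<And>i j. 0 < \<mu> i j" "\<And>i j. (\<lambda>n. p n i / p n j) \<longlonglongrightarrow> \<mu> i j"
    and alpha: "\<And>i. 0 \<le> \<alpha> $ i" "\<And>i. (\<lambda>n. real (a n i) / g n i) \<longlonglongrightarrow> \<alpha> $ i"
    and X_def: "X = chi_matrix q g"
begin

lemma zero_power_r: "(0 :: real) ^ r = 0"
  using r by simp

text \<open>The model assumptions hold from \<open>CARD('k)\<close> on, but positivity of
  \<open>p\<close> holds only eventually, as a consequence of \<open>1 / N\<close> being of smaller
  order.\<close>

definition regular :: "nat \<Rightarrow> bool" where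
  "regular n \<longleftrightarrow> CARD('k) \<le> n \<and> (\<forall>i. 0 < p n i)"

text \<open>The limit of \<open>g n j / g n i\<close>, converting the scale of community
  \<open>j\<close> into that of \<open>i\<close>.\<close>

definition scale :: "'k \<Rightarrow> 'k \<Rightarrow> real" where
  "scale i j = (\<nu> i j * \<mu> i j ^ r) powr (1 / (real r - 1))"

lemma scale_pos: "0 < scale i j"
proof -
  have "0 < \<nu> i j * \<mu> i j ^ r" using nu(1)[of i j] mu(1)[of i j] by simp
  then show ?thesis unfolding scale_def by (metis order_less_irrefl powr_gt_zero)
qed

lemma ev_regular: "\<forall>\<^sub>F n in sequentially. regular n"
  unfolding regular_def
proof (intro eventually_conj eventually_ge_at_top eventually_all_finite)
  fix i
  have "\<forall>\<^sub>F n in sequentially. norm (1 / real (N n i)) \<le> 1 * norm (p n i)"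
    by (rule landau_o.smallD[OF p_lower]) simp
  then show "\<forall>\<^sub>F n in sequentially. 0 < p n i"
    using eventually_ge_at_top[of "CARD('k)"]
  proof eventually_elim
    case (elim n)
    have "0 < 1 / real (N n i)" using N_pos[OF elim(2), of i] by simp
    also have "\<dots> \<le> p n i" using elim(1) q_range[OF elim(2), of i i] by (simp add: p_def)
    finally show ?case .
  qed
qed

lemma regular_large: "regular n \<Longrightarrow> CARD('k) \<le> n"
  by (simp add: regular_def)

lemma regularD:
  assumes "regular n"
  shows "0 < p n i" "p n i \<le> 1" "0 < N n i" "0 < g n i"
    "0 \<le> q n i j" "q n i j \<le> p n i"
proof -
  have n: "CARD('k) \<le> n" by (rule regular_large[OF assms])
  show p: "0 < p n i" using assms by (auto simp: regular_def)
  show "p n i \<le> 1" using q_range[OF n, of i i] by (simp add: p_def)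
  show N: "0 < N n i" using N_pos[OF n, of i] by simp
  show "0 \<le> q n i j" "q n i j \<le> p n i" using q_range[OF n, of i j] q_le[OF n, of i j] by auto
  have "0 < fact (r - 1) / (real (N n i) * p n i ^ r)" using p N by simp
  then have "0 < (fact (r - 1) / (real (N n i) * p n i ^ r)) powr (1 / (real r - 1))"
    by (metis order_less_irrefl powr_gt_zero)
  moreover have "0 < 1 - 1 / real r" using r by simp
  ultimately show "0 < g n i" unfolding g_def crit_seeds_def by (intro mult_pos_pos)
qed

lemma g_power:
  assumes "regular n"
  shows "g n i ^ (r - 1) = (1 - 1 / real r) ^ (r - 1) * (fact (r - 1) / (real (N n i) * p n i ^ r))"
proof -
  define b where "b = fact (r - 1) / (real (N n i) * p n i ^ r)"
  have b: "0 < b" using regularD[OF assms, of i] by (simp add: b_def)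
  have "(b powr (1 / (real r - 1))) ^ (r - 1) = b powr (1 / (real r - 1) * real (r - 1))"
    using b by (simp add: powr_powr powr_realpow[symmetric])
  also have "1 / (real r - 1) * real (r - 1) = 1" using r by (simp add: of_nat_diff)
  finally have "(b powr (1 / (real r - 1))) ^ (r - 1) = b" using b by simp
  then show ?thesis unfolding g_def crit_seeds_def b_def[symmetric] by (simp add: power_mult_distrib)
qed

text \<open>By the choice of \<open>g\<close>, the power \<open>g n i ^ (r - 1)\<close> cancels
  \<open>N n i * p n i ^ r\<close>. One factor \<open>g n i\<close> survives, and
  \<open>fact (r - 1) / fact r\<close> supplies the \<open>1 / r\<close> of
  \<open>bp_const\<close>.\<close>

lemma g_identity:
  assumes "regular n"
  shows "real (N n i) * ((p n i * g n i) ^ r / fact r) = bp_const r * g n i"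
proof -
  note pos = regularD[OF assms, of i]
  obtain k where k: "r = Suc k" using r by (cases r) auto
  have "real (N n i) * ((p n i * g n i) ^ r / fact r)
      = real (N n i) * p n i ^ r * g n i ^ (r - 1) * g n i / fact r"
    by (simp add: k power_mult_distrib)
  also have "\<dots> = (1 - 1 / real r) ^ (r - 1) * (fact (r - 1) / fact r) * g n i"
    unfolding g_power[OF assms] using pos by simp
  also have "fact (r - 1) / fact r = (1 / real r :: real)" by (simp add: k)
  finally show ?thesis by (simp add: bp_const_def mult_ac)
qed

lemma Np_tendsto: "(\<lambda>n. 1 / (real (N n i) * p n i)) \<longlonglongrightarrow> 0"
  using smalloD_tendsto[OF p_lower[of i]] by (simp add: divide_divide_eq_left)

lemma Npr_tendsto: "(\<lambda>n. real (N n i) * p n i ^ r) \<longlonglongrightarrow> 0"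
proof -
  have "(\<lambda>n. (p n i / real (N n i) powr (- 1 / real r)) ^ r) \<longlonglongrightarrow> 0 ^ r"
    by (intro tendsto_power smalloD_tendsto p_upper)
  then have "(\<lambda>n. (p n i / real (N n i) powr (- 1 / real r)) ^ r) \<longlonglongrightarrow> 0" by (simp only: zero_power_r)
  then show ?thesis
  proof (rule Lim_transform_eventually)
    show "\<forall>\<^sub>F n in sequentially. (p n i / real (N n i) powr (- 1 / real r)) ^ r = real (N n i) * p n i ^ r"
      using ev_regular
    proof eventually_elim
      case (elim n)
      have "0 < N n i" using regularD[OF elim] by simp
      then have "(real (N n i) powr (- 1 / real r)) ^ r = real (N n i) powr (- 1 / real r * real r)"
        by (simp add: powr_powr powr_realpow[symmetric])
      also have "\<dots> = 1 / real (N n i)" using r \<open>0 < N n i\<close> by (simp add: powr_minus_divide)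
      finally show ?case by (simp add: power_divide)
    qed
  qed
qed

lemma g_at_top: "filterlim (\<lambda>n. g n i) at_top sequentially"
proof -
  have "filterlim (\<lambda>n. real (N n i) * p n i ^ r) (at_right 0) sequentially"
  proof (rule tendsto_imp_filterlim_at_right[OF Npr_tendsto])
    show "\<forall>\<^sub>F n in sequentially. 0 < real (N n i) * p n i ^ r"
      using ev_regular
    proof eventually_elim
      case (elim n)
      show ?case using regularD(1,3)[OF elim, of i] by simp
    qed
  qed
  then have "filterlim (\<lambda>n. inverse (real (N n i) * p n i ^ r)) at_top sequentially"
    by (rule filterlim_compose[OF filterlim_inverse_at_top_right])
  then have "filterlim (\<lambda>n. fact (r - 1) * inverse (real (N n i) * p n i ^ r)) at_top sequentially"
    by (intro filterlim_tendsto_pos_mult_at_top[OF tendsto_const]) auto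
  then have *: "filterlim (\<lambda>n. fact (r - 1) / (real (N n i) * p n i ^ r)) at_top sequentially"
    by (simp add: divide_inverse)
  have "filterlim (\<lambda>x::real. x powr (1 / (real r - 1))) at_top at_top"
  proof -
    have "filterlim (\<lambda>x::real. x powr e) at_top at_top" if "0 < e" for e using that by real_asymp
    then show ?thesis using r by simp
  qed
  from filterlim_compose[OF this *] show ?thesis
    unfolding g_def crit_seeds_def
    by (intro filterlim_tendsto_pos_mult_at_top[OF tendsto_const]) (use r in auto)
qed

text \<open>Raising to the power \<open>r - 1\<close> removes the root in \<open>g\<close> and
  leaves a constant times \<open>1 / (N n i * p n i)\<close>. The ratio \<open>g n i / N n i\<close>
  is treated likewise, with the \<open>r\<close>-th power of the same quantity.\<close>

lemma pg_tendsto: "(\<lambda>n. p n i * g n i) \<longlonglongrightarrow> 0"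
proof (rule tendsto_zero_of_power)
  have "(\<lambda>n. (1 - 1 / real r) ^ (r - 1) * fact (r - 1) * (1 / (real (N n i) * p n i))) \<longlonglongrightarrow>
      (1 - 1 / real r) ^ (r - 1) * fact (r - 1) * 0"
    by (intro tendsto_intros Np_tendsto)
  then have "(\<lambda>n. (1 - 1 / real r) ^ (r - 1) * fact (r - 1) * (1 / (real (N n i) * p n i))) \<longlonglongrightarrow> 0" by simp
  then show "(\<lambda>n. (p n i * g n i) ^ (r - 1)) \<longlonglongrightarrow> 0"
  proof (rule Lim_transform_eventually)
    show "\<forall>\<^sub>F n in sequentially. (1 - 1 / real r) ^ (r - 1) * fact (r - 1) * (1 / (real (N n i) * p n i)) = (p n i * g n i) ^ (r - 1)"
      using ev_regular
    proof eventually_elim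
      case (elim n)
      obtain k where k: "r = Suc k" using r by (cases r) auto
      show ?case unfolding power_mult_distrib g_power[OF elim] using regularD[OF elim, of i] by (simp add: k)
    qed
  qed
qed (use r in simp)

lemma gN_tendsto: "(\<lambda>n. g n i / real (N n i)) \<longlonglongrightarrow> 0"
proof (rule tendsto_zero_of_power)
  have "(\<lambda>n. (1 - 1 / real r) ^ (r - 1) * fact (r - 1) * (1 / (real (N n i) * p n i)) ^ r) \<longlonglongrightarrow>
      (1 - 1 / real r) ^ (r - 1) * fact (r - 1) * 0 ^ r"
    by (intro tendsto_intros Np_tendsto)
  then have "(\<lambda>n. (1 - 1 / real r) ^ (r - 1) * fact (r - 1) * (1 / (real (N n i) * p n i)) ^ r) \<longlonglongrightarrow> 0" by (simp only: zero_power_r mult_zero_right)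
  then show "(\<lambda>n. (g n i / real (N n i)) ^ (r - 1)) \<longlonglongrightarrow> 0"
  proof (rule Lim_transform_eventually)
    show "\<forall>\<^sub>F n in sequentially. (1 - 1 / real r) ^ (r - 1) * fact (r - 1) * (1 / (real (N n i) * p n i)) ^ r = (g n i / real (N n i)) ^ (r - 1)"
      using ev_regular
    proof eventually_elim
      case (elim n)
      obtain k where k: "r = Suc k" using r by (cases r) auto
      show ?case unfolding power_divide g_power[OF elim] using regularD[OF elim, of i]
        by (simp add: k power_mult_distrib power_divide)
    qed
  qed
qed (use r in simp)

lemma g_ratio_tendsto: "(\<lambda>n. g n j / g n i) \<longlonglongrightarrow> scale i j"
proof -
  have pos: "0 < \<nu> i j * \<mu> i j ^ r" using nu(1)[of i j] mu(1)[of i j] by simp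
  have "(\<lambda>n. (real (N n i) / real (N n j) * (p n i / p n j) ^ r) powr (1 / (real r - 1))) \<longlonglongrightarrow> scale i j"
    unfolding scale_def
    by (intro tendsto_powr tendsto_mult tendsto_power tendsto_const nu mu) (use pos in linarith)
  then show ?thesis
  proof (rule Lim_transform_eventually)
    show "\<forall>\<^sub>F n in sequentially. (real (N n i) / real (N n j) * (p n i / p n j) ^ r) powr (1 / (real r - 1)) = g n j / g n i"
      using ev_regular
    proof eventually_elim
      case (elim n)
      have pos: "0 < real (N n i) * p n i ^ r" "0 < real (N n j) * p n j ^ r"
        using regularD[OF elim, of i] regularD[OF elim, of j] by auto
      have "g n j / g n i = (fact (r - 1) / (real (N n j) * p n j ^ r)) powr (1 / (real r - 1))
          / (fact (r - 1) / (real (N n i) * p n i ^ r)) powr (1 / (real r - 1))"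
        unfolding g_def crit_seeds_def using r by simp
      also have "\<dots> = ((fact (r - 1) / (real (N n j) * p n j ^ r)) / (fact (r - 1) / (real (N n i) * p n i ^ r))) powr (1 / (real r - 1))"
        by (rule powr_divide[symmetric])
      also have "(fact (r - 1) / (real (N n j) * p n j ^ r)) / (fact (r - 1) / (real (N n i) * p n i ^ r))
         = real (N n i) / real (N n j) * (p n i / p n j) ^ r"
        by (simp add: power_divide)
      finally show ?case by simp
    qed
  qed
qed

definition chi_n :: "nat \<Rightarrow> 'k \<Rightarrow> 'k \<Rightarrow> real" where
  "chi_n n i j = q n i j * g n j / (p n i * g n i)"

lemma chi_n_tendsto_gamma: "(\<lambda>n. chi_n n i j) \<longlonglongrightarrow> \<gamma> i j * scale i j"
  using tendsto_mult[OF gamma(2)[of i j] g_ratio_tendsto[of j i]] by (simp add: chi_n_def)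

lemma X_eq: "X $ i $ j = \<gamma> i j * scale i j"
  using limI[OF chi_n_tendsto_gamma[of i j]] by (simp add: X_def chi_matrix_def chi_n_def p_def)

lemma chi_n_tendsto: "(\<lambda>n. chi_n n i j) \<longlonglongrightarrow> X $ i $ j"
  using chi_n_tendsto_gamma by (simp add: X_eq)

lemma X_nonneg: "0 \<le> X $ i $ j"
  using gamma(1)[of i j] scale_pos[of i j] by (simp add: X_eq)

text \<open>Symmetry of \<open>q\<close> gives
  \<open>\<gamma> j i = \<gamma> i j * \<mu> i j\<close>, and \<open>\<mu>\<close> and
  \<open>scale\<close> are positive.\<close>

lemma X_sym:
  assumes "0 < X $ i $ j"
  shows "0 < X $ j $ i"
proof -
  have g: "0 < \<gamma> i j" using assms scale_pos[of i j] by (simp add: X_eq zero_less_mult_iff)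
  have "(\<lambda>n. q n i j / p n i * (p n i / p n j)) \<longlonglongrightarrow> \<gamma> i j * \<mu> i j"
    by (intro tendsto_intros gamma mu)
  then have "(\<lambda>n. q n j i / p n j) \<longlonglongrightarrow> \<gamma> i j * \<mu> i j"
  proof (rule Lim_transform_eventually)
    show "\<forall>\<^sub>F n in sequentially. q n i j / p n i * (p n i / p n j) = q n j i / p n j"
      using ev_regular
    proof eventually_elim
      case (elim n)
      then show ?case using regularD(1)[OF elim(1), of i] q_sym[OF regular_large[OF elim(1)], of j i] by simp
    qed
  qed
  then have "\<gamma> j i = \<gamma> i j * \<mu> i j" by (rule LIMSEQ_unique[OF gamma(2)])
  then show ?thesis using g mu(1)[of i j] scale_pos[of j i] by (simp add: X_eq)
qed

text \<open>For \<open>b j\<close> marking nodes of each community \<open>j\<close>, the left side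
  is the mean number of marks at a node of \<open>i\<close>. It is expressed in units of
  \<open>p n i * g n i\<close> and the rescaled counts \<open>b j / g n j\<close>.\<close>

lemma load_eq:
  assumes "regular n"
  shows "(\<Sum>j\<in>UNIV. b j * q n i j) = p n i * g n i * (\<Sum>j\<in>UNIV. chi_n n i j * (b j / g n j))"
  unfolding sum_distrib_left
proof (rule sum.cong)
  fix j
  show "b j * q n i j = p n i * g n i * (chi_n n i j * (b j / g n j))"
    using regularD(1,4)[OF assms, of i] regularD(4)[OF assms, of j] by (simp add: chi_n_def)
qed simp

end

section \<open>Concentration of the marked counts\<close>

lemma mult_max0_power:
  fixes b x y :: real
  assumes "0 \<le> b"
  shows "max 0 (b * x) ^ n = b ^ n * max 0 x ^ n"
proof -
  have "max 0 (b * x) = b * max 0 x"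
    using assms by (auto simp: max_def mult_le_0_iff zero_le_mult_iff)
  then show ?thesis by (simp add: power_mult_distrib)
qed

text \<open>The shift by \<open>\<sigma>\<close> costs at most \<open>r * \<sigma> * Y ^ r\<close>
  by the mean value bound, and the two factors \<open>1 - \<sigma>\<close> cost at most
  \<open>2 * \<sigma> * Y ^ r\<close>.\<close>

lemma shifted_power_ge:
  fixes y \<sigma> Y :: real
  assumes "0 \<le> y" "y \<le> Y" "1 \<le> Y" "0 \<le> \<sigma>" "\<sigma> \<le> 1 / 2" "0 < r"
  shows "y ^ r - (real r + 2) * \<sigma> * Y ^ r \<le> (1 - \<sigma>)\<^sup>2 * max 0 (y - \<sigma>) ^ r"
proof -
  obtain k where k: "r = Suc k" using \<open>0 < r\<close> by (cases r) auto
  define b where "b = max 0 (y - \<sigma>)"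
  have b: "0 \<le> b" "b \<le> y" "y - b \<le> \<sigma>" using assms by (auto simp: b_def)
  have bY: "b ^ r \<le> Y ^ r" using b assms by (intro power_mono) auto
  have "y ^ r - b ^ r \<le> real r * (y - b) * y ^ k" unfolding k by (rule power_Suc_diff_le[OF b(1,2)])
  also have "\<dots> \<le> real r * \<sigma> * Y ^ r"
  proof -
    have "y ^ k \<le> Y ^ k" using assms by (intro power_mono) auto
    also have "\<dots> \<le> Y ^ r" using assms k by (intro power_increasing) auto
    finally show ?thesis using assms b by (intro mult_mono) auto
  qed
  finally have "y ^ r - real r * \<sigma> * Y ^ r \<le> b ^ r" by simp
  moreover have "(1 - 2 * \<sigma>) * b ^ r \<le> (1 - \<sigma>)\<^sup>2 * b ^ r"
    using b by (intro mult_right_mono) (auto simp: power2_eq_square algebra_simps)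
  moreover have "2 * \<sigma> * b ^ r \<le> 2 * \<sigma> * Y ^ r" using bY assms by (intro mult_left_mono) auto
  ultimately show ?thesis unfolding b_def[symmetric] by (simp add: algebra_simps)
qed

context sbm_limit
begin

lemma act_prob_count_le:
  assumes reg: "regular n" and m: "\<And>j. real (m j) \<le> w j * g n j" and I: "card I = N n i - a n i"
  shows "real (card I) * act_prob r (q n) m i \<le> bp_const r * g n i * (\<Sum>j\<in>UNIV. chi_n n i j * w j) ^ r"
proof -
  note pos = regularD[OF reg]
  have q: "0 \<le> q n i j" "q n i j \<le> 1" for j using pos(5)[of i j] pos(6)[of i j] pos(2)[of i] by auto
  have "(\<Sum>j\<in>UNIV. real (m j) * q n i j) \<le> (\<Sum>j\<in>UNIV. (w j * g n j) * q n i j)"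
    by (intro sum_mono mult_right_mono m q)
  also have "\<dots> = p n i * g n i * (\<Sum>j\<in>UNIV. chi_n n i j * w j)"
    unfolding load_eq[OF reg] using pos(4) by (simp add: less_imp_neq[symmetric])
  finally have le: "(\<Sum>j\<in>UNIV. real (m j) * q n i j) \<le> p n i * g n i * (\<Sum>j\<in>UNIV. chi_n n i j * w j)" .
  have "real (card I) * act_prob r (q n) m i
      \<le> real (N n i) * ((p n i * g n i * (\<Sum>j\<in>UNIV. chi_n n i j * w j)) ^ r / fact r)"
  proof (intro mult_mono order_trans[OF act_prob_le] divide_right_mono power_mono le)
    show "0 \<le> (\<Sum>j\<in>UNIV. real (m j) * q n i j)" by (intro sum_nonneg mult_nonneg_nonneg q) auto
  qed (use I q act_prob_range in auto)
  also have "\<dots> = real (N n i) * ((p n i * g n i) ^ r / fact r) * (\<Sum>j\<in>UNIV. chi_n n i j * w j) ^ r"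
    by (simp add: power_mult_distrib)
  finally show ?thesis unfolding g_identity[OF reg] .
qed

lemma upper_estimate:
  assumes super: "drive r \<alpha> X w i < w $ i" and w: "\<And>j. 0 \<le> w $ j"
  shows "\<exists>\<kappa>>0. \<forall>\<^sub>F n in sequentially. \<forall>I. card I = N n i - a n i \<longrightarrow> finite I \<longrightarrow>
    measure (bcount I (\<lambda>_::nat. act_prob r (q n) (\<lambda>j. nat \<lfloor>w $ j * g n j\<rfloor>) i))
      {c. nat \<lfloor>w $ i * g n i\<rfloor> < a n i + c} \<le> exp (- \<kappa> * g n i)"
proof -
  \<comment> \<open>The gap between \<open>w $ i\<close> and its drive is divided into four: one
    part each for the seed count, the expected number of marked nodes and the deviation in the tail
    bound, with one to spare.\<close>
  define \<delta> where "\<delta> = (w $ i - drive r \<alpha> X w i) / 4"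
  define Y where "Y = (\<Sum>j\<in>UNIV. X $ i $ j * w $ j)"
  define M where "M = bp_const r * Y ^ r + \<delta>"
  have c0: "0 \<le> bp_const r" using r by (simp add: bp_const_def)
  have \<delta>: "0 < \<delta>" using super by (simp add: \<delta>_def)
  have Y: "0 \<le> Y" unfolding Y_def by (intro sum_nonneg mult_nonneg_nonneg X_nonneg w)
  have M: "0 \<le> M" using c0 Y \<delta> by (simp add: M_def)
  have "drive r \<alpha> X w i = \<alpha> $ i + bp_const r * Y ^ r" by (simp add: drive_def Y_def)
  then have wi: "w $ i = \<alpha> $ i + bp_const r * Y ^ r + 4 * \<delta>" by (simp add: \<delta>_def field_simps)
  have lim: "(\<lambda>n. bp_const r * (\<Sum>j\<in>UNIV. chi_n n i j * w $ j) ^ r) \<longlonglongrightarrow> bp_const r * Y ^ r"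
    unfolding Y_def by (intro tendsto_intros chi_n_tendsto)
  have e1: "\<forall>\<^sub>F n in sequentially. bp_const r * (\<Sum>j\<in>UNIV. chi_n n i j * w $ j) ^ r < M"
    by (rule order_tendstoD(2)[OF lim]) (use \<delta> in \<open>simp add: M_def\<close>)
  have e2: "\<forall>\<^sub>F n in sequentially. real (a n i) / g n i < \<alpha> $ i + \<delta>"
    by (rule order_tendstoD(2)[OF alpha(2)]) (use \<delta> in simp)
  show ?thesis
  proof (intro exI conjI)
    show "0 < \<delta>\<^sup>2 / (4 * (M + \<delta>))" using \<delta> M by (intro divide_pos_pos) auto
    show "\<forall>\<^sub>F n in sequentially. \<forall>I. card I = N n i - a n i \<longrightarrow> finite I \<longrightarrow>
      measure (bcount I (\<lambda>_::nat. act_prob r (q n) (\<lambda>j. nat \<lfloor>w $ j * g n j\<rfloor>) i))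
        {c. nat \<lfloor>w $ i * g n i\<rfloor> < a n i + c} \<le> exp (- (\<delta>\<^sup>2 / (4 * (M + \<delta>))) * g n i)"
      using ev_regular e1 e2
    proof eventually_elim
      case (elim n)
      note pos = regularD[OF elim(1)]
      let ?t = "\<lambda>j. nat \<lfloor>w $ j * g n j\<rfloor>"
      have t: "real (?t j) \<le> w $ j * g n j" for j
        using w[of j] pos(4)[of j] by (simp add: of_nat_nat)
      show ?case
      proof (intro allI impI)
        fix I :: "nat set" assume I: "card I = N n i - a n i" "finite I"
        have "measure (bcount I (\<lambda>_. act_prob r (q n) ?t i)) {c. ?t i < a n i + c}
            \<le> measure (bcount I (\<lambda>_. act_prob r (q n) ?t i)) {c. w $ i * g n i - real (a n i) \<le> real c}"
        proof (intro measure_pmf.finite_measure_mono subsetI CollectI)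
          fix c assume "c \<in> {c. ?t i < a n i + c}"
          \<comment> \<open>An integer above the floor of a number is above the number
            itself.\<close>
          then show "w $ i * g n i - real (a n i) \<le> real c" by (simp add: nat_less_iff) linarith
        qed simp
        also have "\<dots> \<le> exp (- (\<delta>\<^sup>2 / (4 * (M + \<delta>))) * g n i)"
        proof (rule bcount_upper_tail[OF I(2) _ M \<delta>])
          show "0 \<le> g n i" using pos(4)[of i] by simp
          have "(\<Sum>_\<in>I. act_prob r (q n) ?t i) \<le> bp_const r * g n i * (\<Sum>j\<in>UNIV. chi_n n i j * w $ j) ^ r"
            using act_prob_count_le[OF elim(1) t I(1)] by simp
          also have "\<dots> \<le> M * g n i"
            using mult_right_mono[OF less_imp_le[OF elim(2)], of "g n i"] pos(4)[of i] by (simp add: mult_ac)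
          finally show "(\<Sum>_\<in>I. act_prob r (q n) ?t i) \<le> M * g n i" .
          have "real (a n i) \<le> (\<alpha> $ i + \<delta>) * g n i" using elim(3) pos(4)[of i] by (simp add: pos_divide_less_eq)
          then have "(w $ i - (\<alpha> $ i + \<delta>)) * g n i \<le> w $ i * g n i - real (a n i)" by (simp add: algebra_simps)
          moreover have "(M + \<delta>) * g n i \<le> (w $ i - (\<alpha> $ i + \<delta>)) * g n i"
            using \<delta> pos(4)[of i] by (intro mult_right_mono) (auto simp: wi M_def)
          ultimately show "(M + \<delta>) * g n i \<le> w $ i * g n i - real (a n i)" by simp
        qed (simp_all add: act_prob_range)
        finally show "measure (bcount I (\<lambda>_. act_prob r (q n) ?t i)) {c. ?t i < a n i + c}
            \<le> exp (- (\<delta>\<^sup>2 / (4 * (M + \<delta>))) * g n i)" .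
      qed
    qed
  qed
qed

lemma seeds_vanish: "(\<lambda>n. real (a n i) / real (N n i)) \<longlonglongrightarrow> 0"
proof -
  have "(\<lambda>n. real (a n i) / g n i * (g n i / real (N n i))) \<longlonglongrightarrow> \<alpha> $ i * 0"
    by (intro tendsto_intros alpha gN_tendsto)
  then have "(\<lambda>n. real (a n i) / g n i * (g n i / real (N n i))) \<longlonglongrightarrow> 0" by simp
  then show ?thesis
  proof (rule Lim_transform_eventually)
    show "\<forall>\<^sub>F n in sequentially. real (a n i) / g n i * (g n i / real (N n i)) = real (a n i) / real (N n i)"
      using ev_regular
    proof eventually_elim
      case (elim n)
      then show ?case using regularD(4)[OF elim(1), of i] by simp
    qed
  qed
qed

text \<open>The single error \<open>\<sigma>\<close> covers four approximations:
  \<open>chi_n\<close> by \<open>X\<close>, the loss \<open>r * p n i\<close> in the sum of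
  probabilities, the factor one minus the load, and the fraction of nodes taken by seeds. The
  additional 1 in \<open>Y\<close> keeps the perturbed load below \<open>Y\<close>. None of these
  conditions involves \<open>s\<close> beyond the bound by \<open>w\<close>.\<close>

lemma act_prob_count_ge:
  assumes reg: "regular n" and s: "\<And>j. real (s j) \<le> w j * g n j" and w: "\<And>j. 0 \<le> w j"
    and I: "card I = N n i - a n i"
    and Y: "(\<Sum>j\<in>UNIV. X $ i $ j * w j) + 1 \<le> Y" and \<sigma>: "0 < \<sigma>" "\<sigma> \<le> 1 / 2"
    and chi: "(\<Sum>j\<in>UNIV. \<bar>chi_n n i j - X $ i $ j\<bar> * w j) \<le> \<sigma> / 2"
    and rg: "real r / g n i \<le> \<sigma> / 2" and pg: "p n i * g n i * Y \<le> \<sigma>" and aN: "real (a n i) / real (N n i) \<le> \<sigma>"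
  shows "g n i * (bp_const r * ((\<Sum>j\<in>UNIV. X $ i $ j * (real (s j) / g n j)) ^ r - (real r + 2) * \<sigma> * Y ^ r))
    \<le> real (card I) * act_prob r (q n) s i"
proof -
  note pos = regularD[OF reg]
  define x where "x j = real (s j) / g n j" for j
  define y where "y = (\<Sum>j\<in>UNIV. X $ i $ j * x j)"
  define y' where "y' = (\<Sum>j\<in>UNIV. chi_n n i j * x j)"
  have x: "0 \<le> x j" "x j \<le> w j" for j
    using s[of j] pos(4)[of j] by (simp_all add: x_def pos_divide_le_eq)
  have y0: "0 \<le> y" unfolding y_def by (intro sum_nonneg mult_nonneg_nonneg X_nonneg x)
  have yw: "y \<le> (\<Sum>j\<in>UNIV. X $ i $ j * w j)" unfolding y_def by (intro sum_mono mult_left_mono X_nonneg x)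
  have Y1: "1 \<le> Y" "y \<le> Y" using Y y0 yw by auto
  have "\<bar>y' - y\<bar> \<le> (\<Sum>j\<in>UNIV. \<bar>(chi_n n i j - X $ i $ j) * x j\<bar>)"
    unfolding y_def y'_def sum_subtractf[symmetric] left_diff_distrib[symmetric] by (rule sum_abs)
  also have "\<dots> \<le> (\<Sum>j\<in>UNIV. \<bar>chi_n n i j - X $ i $ j\<bar> * w j)"
    using x by (intro sum_mono) (simp add: abs_mult mult_left_mono)
  finally have yy: "\<bar>y' - y\<bar> \<le> \<sigma> / 2" using chi by simp
  define b where "b = p n i * g n i"
  have b: "0 < b" using pos(1)[of i] pos(4)[of i] by (simp add: b_def)
  have load: "(\<Sum>j\<in>UNIV. real (s j) * q n i j) = b * y'"
    unfolding load_eq[OF reg] b_def y'_def x_def ..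
  have q: "0 \<le> q n i j" "q n i j \<le> p n i" for j using pos(5)[of i j] pos(6)[of i j] by auto
  have "y' \<le> Y" using yy yw Y \<sigma> by linarith
  then have "b * y' \<le> b * Y" using b by (intro mult_left_mono) auto
  then have by': "b * y' \<le> \<sigma>" using pg by (simp add: b_def)
  have "p n i * real r = b * (real r / g n i)" using pos(4)[of i] by (simp add: b_def)
  moreover have "y - \<sigma> \<le> y' - real r / g n i" using yy rg by linarith
  then have "b * (y - \<sigma>) \<le> b * (y' - real r / g n i)" using b by (intro mult_left_mono) auto
  ultimately have "b * (y - \<sigma>) \<le> b * y' - real r * p n i" by (simp add: algebra_simps)
  then have shift: "b ^ r * max 0 (y - \<sigma>) ^ r \<le> max 0 (b * y' - real r * p n i) ^ r"
    unfolding mult_max0_power[OF less_imp_le[OF b], symmetric] by (intro power_mono) auto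
  have "(1 - \<sigma>) * (b ^ r * max 0 (y - \<sigma>) ^ r / fact r) \<le> (1 - b * y') * (max 0 (b * y' - real r * p n i) ^ r / fact r)"
    using by' shift \<sigma> b by (intro mult_mono divide_right_mono) auto
  also have "\<dots> \<le> act_prob r (q n) s i"
    using act_prob_ge[of "q n" i "p n i" s r] q pos(2)[of i] unfolding load by simp
  finally have act: "(1 - \<sigma>) * (b ^ r * max 0 (y - \<sigma>) ^ r / fact r) \<le> act_prob r (q n) s i" .
  have cardI: "(1 - \<sigma>) * real (N n i) \<le> real (card I)"
    using aN pos(3)[of i] I seeds_le[OF regular_large[OF reg], of i]
    by (simp add: of_nat_diff pos_divide_le_eq algebra_simps)
  have "g n i * (bp_const r * (y ^ r - (real r + 2) * \<sigma> * Y ^ r))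
      \<le> g n i * (bp_const r * ((1 - \<sigma>)\<^sup>2 * max 0 (y - \<sigma>) ^ r))"
    using y0 Y1 \<sigma> r pos(4)[of i] by (intro mult_left_mono shifted_power_ge) (auto simp: bp_const_def)
  also have "\<dots> = (1 - \<sigma>)\<^sup>2 * (bp_const r * g n i) * max 0 (y - \<sigma>) ^ r" by (simp add: mult_ac)
  also have "\<dots> = (1 - \<sigma>) * real (N n i) * ((1 - \<sigma>) * (b ^ r * max 0 (y - \<sigma>) ^ r / fact r))"
    unfolding g_identity[OF reg, symmetric] b_def[symmetric] by (simp add: power2_eq_square mult_ac)
  also have "\<dots> \<le> real (card I) * act_prob r (q n) s i"
    using cardI act \<sigma> b by (intro mult_mono) auto
  finally show ?thesis by (simp add: y_def x_def)
qed

text \<open>The quantifier over \<open>s\<close> stands inside the eventuality because the union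
  bound needs one threshold for all count vectors at once.\<close>

lemma lower_estimate:
  assumes \<eta>: "0 < \<eta>" and w: "\<And>j. 0 \<le> w j"
  shows "\<exists>\<kappa>>0. \<forall>\<^sub>F n in sequentially. \<forall>s I. (\<forall>j. real (s j) \<le> w j * g n j) \<longrightarrow>
    \<eta> \<le> drive r \<alpha> X (\<chi> j. real (s j) / g n j) i - real (s i) / g n i \<longrightarrow>
    card I = N n i - a n i \<longrightarrow> finite I \<longrightarrow>
    measure (bcount I (\<lambda>_::nat. act_prob r (q n) s i)) {c. a n i + c \<le> s i} \<le> exp (- \<kappa> * g n i)"
proof -
  define Y where "Y = (\<Sum>j\<in>UNIV. X $ i $ j * w j) + 1"
  have Y: "1 \<le> Y" unfolding Y_def by (simp add: sum_nonneg X_nonneg w)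
  have c0: "0 < bp_const r" unfolding bp_const_def using r by (intro mult_pos_pos zero_less_power) auto
  define Q where "Q = bp_const r * (real r + 2) * Y ^ r"
  have Q: "0 < Q" using c0 Y by (simp add: Q_def)
  \<comment> \<open>Of the excess \<open>\<eta>\<close>, a quarter goes to the mean through
    \<open>\<sigma> * Q\<close>, a quarter to the seed count, and half remains as deviation in the
    tail bound.\<close>
  define \<sigma> where "\<sigma> = min (1 / 2) (\<eta> / (4 * Q))"
  have \<sigma>: "0 < \<sigma>" "\<sigma> \<le> 1 / 2" "\<sigma> * Q \<le> \<eta> / 4"
    using \<eta> Q by (auto simp: \<sigma>_def min_def field_simps)
  have "(\<lambda>n. \<Sum>j\<in>UNIV. \<bar>chi_n n i j - X $ i $ j\<bar> * w j) \<longlonglongrightarrow> (\<Sum>j\<in>UNIV. \<bar>X $ i $ j - X $ i $ j\<bar> * w j)"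
    by (intro tendsto_intros chi_n_tendsto)
  then have "(\<lambda>n. \<Sum>j\<in>UNIV. \<bar>chi_n n i j - X $ i $ j\<bar> * w j) \<longlonglongrightarrow> 0" by simp
  then have e1: "\<forall>\<^sub>F n in sequentially. (\<Sum>j\<in>UNIV. \<bar>chi_n n i j - X $ i $ j\<bar> * w j) < \<sigma> / 2"
    by (rule order_tendstoD(2)) (use \<sigma> in simp)
  have e2: "\<forall>\<^sub>F n in sequentially. real r / g n i < \<sigma> / 2"
    by (rule order_tendstoD(2)[OF tendsto_divide_0[OF tendsto_const filterlim_at_top_imp_at_infinity[OF g_at_top]]])
       (use \<sigma> in simp)
  have "(\<lambda>n. p n i * g n i * Y) \<longlonglongrightarrow> 0 * Y" by (intro tendsto_intros pg_tendsto)
  then have e3: "\<forall>\<^sub>F n in sequentially. p n i * g n i * Y < \<sigma>"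
    by (rule order_tendstoD(2)) (use \<sigma> in simp)
  have e4: "\<forall>\<^sub>F n in sequentially. real (a n i) / real (N n i) < \<sigma>"
    by (rule order_tendstoD(2)[OF seeds_vanish]) (use \<sigma> in simp)
  have e5: "\<forall>\<^sub>F n in sequentially. \<alpha> $ i - \<eta> / 4 < real (a n i) / g n i"
    by (rule order_tendstoD(1)[OF alpha(2)]) (use \<eta> in simp)
  define M where "M = bp_const r * Y ^ r"
  have M: "0 \<le> M" using c0 Y by (simp add: M_def)
  show ?thesis
  proof (intro exI conjI)
    show "0 < (\<eta> / 2)\<^sup>2 / (4 * (M + \<eta> / 2))" using \<eta> M by (intro divide_pos_pos) auto
    show "\<forall>\<^sub>F n in sequentially. \<forall>s I. (\<forall>j. real (s j) \<le> w j * g n j) \<longrightarrow>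
      \<eta> \<le> drive r \<alpha> X (\<chi> j. real (s j) / g n j) i - real (s i) / g n i \<longrightarrow>
      card I = N n i - a n i \<longrightarrow> finite I \<longrightarrow>
      measure (bcount I (\<lambda>_::nat. act_prob r (q n) s i)) {c. a n i + c \<le> s i}
        \<le> exp (- ((\<eta> / 2)\<^sup>2 / (4 * (M + \<eta> / 2))) * g n i)"
      using ev_regular e1 e2 e3 e4 e5
    proof eventually_elim
      case (elim n)
      note pos = regularD[OF elim(1)]
      show ?case
      proof (intro allI impI)
        fix s and I :: "nat set"
        assume s: "\<forall>j. real (s j) \<le> w j * g n j"
          and excess: "\<eta> \<le> drive r \<alpha> X (\<chi> j. real (s j) / g n j) i - real (s i) / g n i"
          and I: "card I = N n i - a n i" "finite I"
        define y where "y = (\<Sum>j\<in>UNIV. X $ i $ j * (real (s j) / g n j))"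
        define m where "m = g n i * (bp_const r * y ^ r - \<eta> / 4)"
        have gi: "0 < g n i" by (rule pos)
        have y: "0 \<le> y" "y \<le> Y"
        proof -
          show "0 \<le> y" unfolding y_def
            using pos(4) by (intro sum_nonneg mult_nonneg_nonneg X_nonneg divide_nonneg_nonneg) (auto simp: less_imp_le)
          have "y \<le> (\<Sum>j\<in>UNIV. X $ i $ j * w j)" unfolding y_def
            using s pos(4) by (intro sum_mono mult_left_mono X_nonneg) (simp add: pos_divide_le_eq)
          then show "y \<le> Y" by (simp add: Y_def)
        qed
        have "m \<le> g n i * (bp_const r * (y ^ r - (real r + 2) * \<sigma> * Y ^ r))"
          unfolding m_def using gi \<sigma>(3) by (intro mult_left_mono) (auto simp: Q_def algebra_simps)
        also have "\<dots> \<le> real (card I) * act_prob r (q n) s i"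
          unfolding y_def using s w I \<sigma> elim
          by (intro act_prob_count_ge[where w = w]) (auto simp: Y_def)
        finally have mean: "m \<le> (\<Sum>_\<in>I. act_prob r (q n) s i)" by simp
        have "measure (bcount I (\<lambda>_. act_prob r (q n) s i)) {c. a n i + c \<le> s i}
          \<le> measure (bcount I (\<lambda>_. act_prob r (q n) s i)) {c. real c \<le> real (s i) - real (a n i)}"
          by (intro measure_pmf.finite_measure_mono) auto
        also have "\<dots> \<le> exp (- ((\<eta> / 2)\<^sup>2 / (4 * (M + \<eta> / 2))) * g n i)"
        proof (rule bcount_lower_tail[OF I(2) _ M _ _ mean])
          have "y ^ r \<le> Y ^ r" using y by (intro power_mono)
          then have "bp_const r * y ^ r \<le> M" using c0 by (simp add: M_def)
          then have "g n i * (bp_const r * y ^ r - \<eta> / 4) \<le> g n i * M" using gi \<eta> by (intro mult_left_mono) auto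
          then show "m \<le> M * g n i" by (simp add: m_def mult.commute)
          have "real (s i) / g n i \<le> \<alpha> $ i + bp_const r * y ^ r - \<eta>"
            using excess by (simp add: drive_def y_def)
          then have "real (s i) \<le> (\<alpha> $ i + bp_const r * y ^ r - \<eta>) * g n i" using gi by (simp add: pos_divide_le_eq)
          moreover have "(\<alpha> $ i - \<eta> / 4) * g n i \<le> real (a n i)" using elim(6) gi by (simp add: pos_less_divide_eq)
          ultimately show "real (s i) - real (a n i) \<le> m - \<eta> / 2 * g n i"
            by (simp add: m_def algebra_simps)
        qed (use \<eta> gi in \<open>simp_all add: act_prob_range\<close>)
        finally show "measure (bcount I (\<lambda>_. act_prob r (q n) s i)) {c. a n i + c \<le> s i}
          \<le> exp (- ((\<eta> / 2)\<^sup>2 / (4 * (M + \<eta> / 2))) * g n i)" .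
      qed
    qed
  qed
qed

end

section \<open>Deviation of the final size\<close>

text \<open>Take \<open>y \<le> exp y\<close> at \<open>y = x * c / k\<close> and raise it to the
  power \<open>k\<close>. This absorbs the number of count vectors into an arbitrarily small
  exponential rate.\<close>

lemma power_le_exp:
  fixes B c x :: real
  assumes "0 < B" "0 < c" "0 \<le> x"
  shows "(B * x) ^ k \<le> (B * real k / c) ^ k * exp (c * x)"
proof (cases "k = 0")
  case False
  then have k: "0 < real k" by simp
  have "x * c / real k \<le> exp (x * c / real k)" using exp_ge_add_one_self[of "x * c / real k"] by linarith
  then have "B * x \<le> B * real k / c * exp (x * c / real k)"
    using assms k by (simp add: field_simps)
  then have "(B * x) ^ k \<le> (B * real k / c * exp (x * c / real k)) ^ k"
    using assms by (intro power_mono) auto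
  also have "\<dots> = (B * real k / c) ^ k * exp (c * x)"
  proof -
    have "exp (x * c / real k) ^ k = exp (c * x)"
      using k by (simp add: exp_of_nat_mult[symmetric] mult.commute)
    then show ?thesis by (simp only: power_mult_distrib)
  qed
  finally show ?thesis .
qed (use assms in simp)

context sbm_limit
begin

lemma eventually_exp_scale:
  assumes "0 < (\<kappa> :: real)"
  shows "\<exists>c>0. \<forall>\<^sub>F n in sequentially. exp (- \<kappa> * g n i) \<le> exp (- c * g n j)"
proof (intro exI conjI)
  show "0 < \<kappa> * (scale j i / 2)" using assms scale_pos[of j i] by simp
  have "\<forall>\<^sub>F n in sequentially. scale j i / 2 < g n i / g n j"
    by (rule order_tendstoD(1)[OF g_ratio_tendsto]) (use scale_pos[of j i] in simp)
  then show "\<forall>\<^sub>F n in sequentially. exp (- \<kappa> * g n i) \<le> exp (- (\<kappa> * (scale j i / 2)) * g n j)"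
    using ev_regular
  proof eventually_elim
    case (elim n)
    have "scale j i / 2 * g n j \<le> g n i"
      using elim(1) regularD(4)[OF elim(2), of j] by (simp add: pos_less_divide_eq)
    then have "\<kappa> * (scale j i / 2 * g n j) \<le> \<kappa> * g n i" using assms by (intro mult_left_mono) auto
    then show ?case by (simp add: mult.assoc)
  qed
qed

text \<open>The scales of any two communities have a positive limiting ratio, so each rate can be
  restated in terms of \<open>g n j\<close>; the least of the finitely many resulting rates serves
  all communities.\<close>

lemma eventually_le_exp_all:
  fixes P :: "'k \<Rightarrow> nat \<Rightarrow> real \<Rightarrow> bool"
  assumes ex: "\<And>i. \<exists>\<kappa>>0. \<forall>\<^sub>F n in sequentially. P i n (exp (- \<kappa> * g n i))"
    and mono: "\<And>i n u u'. P i n u \<Longrightarrow> u \<le> u' \<Longrightarrow> P i n u'"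
  shows "\<exists>c>0. \<forall>\<^sub>F n in sequentially. \<forall>i. P i n (exp (- c * g n j))"
proof -
  have "\<exists>c>0. \<forall>\<^sub>F n in sequentially. P i n (exp (- c * g n j))" for i
  proof -
    obtain \<kappa> where \<kappa>: "\<kappa> > 0" "\<forall>\<^sub>F n in sequentially. P i n (exp (- \<kappa> * g n i))" using ex by blast
    obtain c where c: "c > 0" "\<forall>\<^sub>F n in sequentially. exp (- \<kappa> * g n i) \<le> exp (- c * g n j)"
      using eventually_exp_scale[OF \<kappa>(1)] by blast
    have "\<forall>\<^sub>F n in sequentially. P i n (exp (- c * g n j))"
      using \<kappa>(2) c(2) by eventually_elim (rule mono)
    then show ?thesis using c(1) by blast
  qed
  then obtain c where c: "\<And>i. c i > 0" "\<And>i. \<forall>\<^sub>F n in sequentially. P i n (exp (- c i * g n j))"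
    by metis
  define c0 where "c0 = Min (range c)"
  have "c0 > 0" using c(1) by (simp add: c0_def)
  moreover have "\<forall>\<^sub>F n in sequentially. \<forall>i. P i n (exp (- c0 * g n j))"
  proof (rule eventually_all_finite)
    fix i
    have "c0 \<le> c i" by (simp add: c0_def)
    show "\<forall>\<^sub>F n in sequentially. P i n (exp (- c0 * g n j))"
      using c(2)[of i] ev_regular
    proof eventually_elim
      case (elim n)
      have "c0 * g n j \<le> c i * g n j"
        using \<open>c0 \<le> c i\<close> regularD(4)[OF elim(2), of j] by (intro mult_right_mono) auto
      then show ?case by (intro mono[OF elim(1)]) simp
    qed
  qed
  ultimately show ?thesis by blast
qed

end

locale subcritical_sbm = sbm_limit r q a N p g \<nu> \<mu> \<gamma> \<alpha> X
  for r and q :: "nat \<Rightarrow> 'k::{finite,linorder} \<Rightarrow> 'k \<Rightarrow> real" and a N p g \<nu> \<mu> \<gamma> \<alpha> X +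
  fixes comm :: "nat \<Rightarrow> nat \<Rightarrow> 'k" and z :: "'k rvec"
  assumes N_def: "\<And>n i. N n i = card (community n (comm n) i)"
    and irred: "irreducible_mat X"
    and alpha1_pos: "0 < \<alpha> $ idx1"
    and z_dom: "z \<in> dom_D r X"
    and z_super: "\<And>i. drive r \<alpha> X z i < z $ i"
begin

sublocale subcritical_flow r \<alpha> X z
  by unfold_locales (use r X_nonneg X_sym alpha alpha1_pos irred z_dom z_super in auto)

lemma final_size_concentration:
  assumes \<epsilon>: "0 < \<epsilon>"
  defines "x_star \<equiv> \<Sum>i\<in>UNIV. limit_pt $ i * scale idx1 i"
  shows "\<exists>c>0. (\<lambda>n. measure_pmf.prob (final_size_pmf r n (comm n) (q n) (a n))
      {A. \<bar>real A / g n idx1 - x_star\<bar> > \<epsilon>}) \<in> O(\<lambda>n. exp (- c * g n idx1))"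
proof -
  let ?D = "\<lambda>n. {A. \<bar>real A / g n idx1 - x_star\<bar> > \<epsilon>}"
  define K where "K = (\<Sum>i\<in>UNIV. scale idx1 i)"
  have K: "0 < K" unfolding K_def by (intro sum_pos scale_pos) auto
  \<comment> \<open>A displacement of \<open>\<epsilon>'\<close> in every coordinate changes the
    weighted total by \<open>\<epsilon> / 2\<close>; the other half absorbs the convergence of the
    ratios \<open>g n i / g n idx1\<close>.\<close>
  define \<epsilon>' where "\<epsilon>' = \<epsilon> / (2 * K)"
  have \<epsilon>': "0 < \<epsilon>'" "\<epsilon>' * K = \<epsilon> / 2" using \<epsilon> K by (simp_all add: \<epsilon>'_def)
  obtain w where w: "\<And>i. limit_pt $ i \<le> w $ i" "\<And>i. w $ i \<le> limit_pt $ i + \<epsilon>'" "\<And>i. drv w i < w $ i"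
    using super_near_limit[OF \<epsilon>'(1)] by blast
  have w0: "0 \<le> w $ i" for i using w(1)[of i] limit_nonneg[of i] by simp
  obtain \<eta> where \<eta>: "0 < \<eta>" "\<And>v j. (\<And>i. 0 \<le> v $ i) \<Longrightarrow> (\<And>i. v $ i \<le> w $ i) \<Longrightarrow> v $ j \<le> limit_pt $ j - \<epsilon>' \<Longrightarrow>
      \<exists>i. \<eta> \<le> drv v i - v $ i"
    using excess_below_limit[OF \<epsilon>'(1), of w] by blast
  define t where "t n j = nat \<lfloor>w $ j * g n j\<rfloor>" for n j
  obtain c1 where c1: "0 < c1" "\<forall>\<^sub>F n in sequentially. \<forall>i I. card I = N n i - a n i \<longrightarrow> finite I \<longrightarrow>
      measure (bcount I (\<lambda>_::nat. act_prob r (q n) (t n) i)) {c. t n i < a n i + c} \<le> exp (- c1 * g n idx1)"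
    using eventually_le_exp_all[where j = idx1 and P = "\<lambda>i n u. \<forall>I. card I = N n i - a n i \<longrightarrow> finite I \<longrightarrow>
      measure (bcount I (\<lambda>_::nat. act_prob r (q n) (t n) i)) {c. t n i < a n i + c} \<le> u",
      OF upper_estimate[OF w(3) w0, folded t_def]] by (meson order_trans)
  obtain c2 where c2: "0 < c2" "\<forall>\<^sub>F n in sequentially. \<forall>i s I. (\<forall>j. real (s j) \<le> w $ j * g n j) \<longrightarrow>
      \<eta> \<le> drv (\<chi> j. real (s j) / g n j) i - real (s i) / g n i \<longrightarrow> card I = N n i - a n i \<longrightarrow> finite I \<longrightarrow>
      measure (bcount I (\<lambda>_::nat. act_prob r (q n) s i)) {c. a n i + c \<le> s i} \<le> exp (- c2 * g n idx1)"
    using eventually_le_exp_all[where j = idx1 and P = "\<lambda>i n u. \<forall>s I. (\<forall>j. real (s j) \<le> w $ j * g n j) \<longrightarrow>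
      \<eta> \<le> drv (\<chi> j. real (s j) / g n j) i - real (s i) / g n i \<longrightarrow> card I = N n i - a n i \<longrightarrow> finite I \<longrightarrow>
      measure (bcount I (\<lambda>_::nat. act_prob r (q n) s i)) {c. a n i + c \<le> s i} \<le> u",
      OF lower_estimate[OF \<eta>(1), of "\<lambda>j. w $ j", OF w0]] by (meson order_trans)
  have ratio: "(\<lambda>n. \<Sum>i\<in>UNIV. (limit_pt $ i + d) * (g n i / g n idx1)) \<longlonglongrightarrow> x_star + d * K" for d
  proof -
    have "(\<lambda>n. \<Sum>i\<in>UNIV. (limit_pt $ i + d) * (g n i / g n idx1)) \<longlonglongrightarrow> (\<Sum>i\<in>UNIV. (limit_pt $ i + d) * scale idx1 i)"
      by (intro tendsto_intros g_ratio_tendsto)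
    then show ?thesis by (simp add: x_star_def K_def sum_distrib_left sum.distrib distrib_right)
  qed
  have e1: "\<forall>\<^sub>F n in sequentially. (\<Sum>i\<in>UNIV. (limit_pt $ i + \<epsilon>') * (g n i / g n idx1)) < x_star + \<epsilon>"
    by (rule order_tendstoD(2)[OF ratio]) (use \<epsilon> \<epsilon>' in simp)
  have e2: "\<forall>\<^sub>F n in sequentially. x_star - \<epsilon> < (\<Sum>i\<in>UNIV. (limit_pt $ i + (- \<epsilon>')) * (g n i / g n idx1))"
    by (rule order_tendstoD(1)[OF ratio]) (use \<epsilon> \<epsilon>' in simp)
  \<comment> \<open>Once \<open>g n idx1\<close> is at least 1, each \<open>Suc (t n i)\<close> is
    at most \<open>B * g n idx1\<close>; the leading 1 accounts for the successor.\<close>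
  define B where "B = 1 + (\<Sum>i\<in>UNIV. w $ i * (scale idx1 i + 1))"
  have wB: "w $ i * (scale idx1 i + 1) \<le> B - 1" for i
    using member_le_sum[of i UNIV "\<lambda>i. w $ i * (scale idx1 i + 1)"] w0 scale_pos
    by (simp add: B_def less_imp_le add_nonneg_nonneg)
  have B: "1 \<le> B" unfolding B_def using w0 scale_pos by (simp add: sum_nonneg less_imp_le add_nonneg_nonneg)
  have e3: "\<forall>\<^sub>F n in sequentially. \<forall>i. g n i / g n idx1 < scale idx1 i + 1"
    by (intro eventually_all_finite order_tendstoD(2)[OF g_ratio_tendsto]) simp
  have e4: "\<forall>\<^sub>F n in sequentially. 1 \<le> g n idx1"
    using g_at_top[of idx1] by (simp add: filterlim_at_top)
  define C where "C = real CARD('k) + (B * real CARD('k) / (c2 / 2)) ^ CARD('k)"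
  \<comment> \<open>Half of the rate \<open>c2\<close> is spent on the number of count
    vectors.\<close>
  define c where "c = min c1 (c2 / 2)"
  have c: "0 < c" "c \<le> c1" "c \<le> c2 / 2" using c1 c2 by (auto simp: c_def)
  have "\<forall>\<^sub>F n in sequentially. norm (measure_pmf.prob (final_size_pmf r n (comm n) (q n) (a n)) (?D n))
      \<le> C * norm (exp (- c * g n idx1))"
    using ev_regular c1(2) c2(2) e1 e2 e3 e4
  proof eventually_elim
    case (elim n)
    note pos = regularD(4)[OF elim(1)]
    let ?G = "g n idx1"
    have G: "0 < ?G" by (rule pos)
    have large: "CARD('k) \<le> n" by (rule regular_large[OF elim(1)])
    have t: "real (t n j) \<le> w $ j * g n j" for j
      using w0[of j] pos[of j] by (simp add: t_def of_nat_nat)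
    have upper_total: "real (\<Sum>i\<in>UNIV. t n i) < (x_star + \<epsilon>) * ?G"
    proof -
      have "real (\<Sum>i\<in>UNIV. t n i) \<le> (\<Sum>i\<in>UNIV. (limit_pt $ i + \<epsilon>') * g n i)"
        unfolding of_nat_sum using pos
        by (intro sum_mono order_trans[OF t] mult_right_mono w less_imp_le)
      also have "\<dots> = (\<Sum>i\<in>UNIV. (limit_pt $ i + \<epsilon>') * (g n i / ?G)) * ?G"
        using G by (simp add: sum_distrib_right)
      also have "\<dots> < (x_star + \<epsilon>) * ?G" using elim(4) G by (intro mult_strict_right_mono)
      finally show ?thesis .
    qed
    have "measure_pmf.prob (final_size_pmf r n (comm n) (q n) (a n)) (?D n)
      \<le> real CARD('k) * exp (- c1 * ?G) + (\<Prod>i\<in>UNIV. real (Suc (t n i))) * exp (- c2 * ?G)"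
    proof (rule final_size_deviation[where lo = "(x_star - \<epsilon>) * ?G"])
      show "q n i j = q n j i" for i j by (rule q_sym[OF large])
      show "a n i \<le> card (community n (comm n) i)" for i
        using seeds_le[OF large, of i] by (simp add: N_def)
      fix A assume A: "A \<in> ?D n" "A \<le> (\<Sum>i\<in>UNIV. t n i)"
      have "real A < (x_star + \<epsilon>) * ?G" using A(2) upper_total by linarith
      then have "real A / ?G < x_star + \<epsilon>" using G by (simp add: pos_divide_less_eq)
      then have "real A / ?G < x_star - \<epsilon>" using A(1) by (auto simp: abs_less_iff not_le) 
      then show "real A < (x_star - \<epsilon>) * ?G" using G by (simp add: pos_divide_less_eq)
    next
      fix i and I :: "nat set"
      assume "card I = card (community n (comm n) i) - a n i" "finite I"
      then show "measure (bcount I (\<lambda>_. act_prob r (q n) (t n) i)) {c. t n i < a n i + c} \<le> exp (- c1 * ?G)"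
        using elim(2) by (simp add: N_def)
    next
      fix s assume s: "s \<le> t n" and low: "real (\<Sum>i\<in>UNIV. s i) < (x_star - \<epsilon>) * ?G"
      have sw: "real (s j) \<le> w $ j * g n j" for j
        using s t[of j] by (auto simp: le_fun_def intro: order_trans[rotated])
      define v where "v = (\<chi> j. real (s j) / g n j)"
      \<comment> \<open>If every coordinate were within \<open>\<epsilon>'\<close> of the limit from
        below, the total would be at least \<open>lo\<close>.\<close>
      have "\<exists>j. v $ j \<le> limit_pt $ j - \<epsilon>'"
      proof (rule ccontr)
        assume "\<not> ?thesis"
        then have ge: "limit_pt $ j + - \<epsilon>' \<le> v $ j" for j by (simp add: not_le less_imp_le)
        have "(x_star - \<epsilon>) * ?G \<le> (\<Sum>i\<in>UNIV. (limit_pt $ i + - \<epsilon>') * (g n i / ?G)) * ?G"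
          using elim(5) G by (intro mult_right_mono) auto
        also have "\<dots> = (\<Sum>i\<in>UNIV. (limit_pt $ i + - \<epsilon>') * g n i)"
          using G by (simp add: sum_distrib_right)
        also have "\<dots> \<le> (\<Sum>i\<in>UNIV. v $ i * g n i)"
          by (intro sum_mono mult_right_mono ge less_imp_le[OF pos])
        also have "\<dots> = real (\<Sum>i\<in>UNIV. s i)"
          unfolding of_nat_sum by (rule sum.cong) (use pos in \<open>simp_all add: v_def less_imp_neq[symmetric]\<close>)
        finally show False using low by simp
      qed
      then obtain j where "v $ j \<le> limit_pt $ j - \<epsilon>'" by blast
      moreover have "0 \<le> v $ i" "v $ i \<le> w $ i" for i
        using pos[of i] sw[of i] by (simp_all add: v_def pos_divide_le_eq)
      ultimately obtain i where "\<eta> \<le> drv v i - v $ i" using \<eta>(2) by blast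
      then have "\<eta> \<le> drv (\<chi> j. real (s j) / g n j) i - real (s i) / g n i" by (simp add: v_def)
      then show "\<exists>i. \<forall>I. card I = card (community n (comm n) i) - a n i \<longrightarrow> finite I \<longrightarrow>
          measure (bcount I (\<lambda>_::nat. act_prob r (q n) s i)) {c. a n i + c \<le> s i} \<le> exp (- c2 * ?G)"
        using elim(3) sw unfolding N_def by blast
    qed (use r in auto)
    also have "\<dots> \<le> real CARD('k) * exp (- c * ?G)
        + (B * real CARD('k) / (c2 / 2)) ^ CARD('k) * exp (c2 / 2 * ?G) * exp (- c2 * ?G)"
    proof (intro add_mono mult_left_mono mult_right_mono)
      show "exp (- c1 * ?G) \<le> exp (- c * ?G)" using c G by (simp add: mult_right_mono)
      have "(\<Prod>i\<in>UNIV. real (Suc (t n i))) \<le> (\<Prod>i\<in>(UNIV :: 'k set). B * ?G)"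
      proof (rule prod_mono)
        fix i
        have "w $ i * g n i = w $ i * (g n i / ?G) * ?G" using G by simp
        also have "\<dots> \<le> w $ i * (scale idx1 i + 1) * ?G"
          using w0[of i] G by (intro mult_right_mono mult_left_mono less_imp_le[OF elim(6)[rule_format]]) auto
        also have "\<dots> \<le> (B - 1) * ?G" using wB G by (intro mult_right_mono) auto
        finally show "0 \<le> real (Suc (t n i)) \<and> real (Suc (t n i)) \<le> B * ?G"
          using t[of i] elim(7) by (simp add: algebra_simps)
      qed
      also have "\<dots> = (B * ?G) ^ CARD('k)" by simp
      also have "\<dots> \<le> (B * real CARD('k) / (c2 / 2)) ^ CARD('k) * exp (c2 / 2 * ?G)"
        using B c2(1) G by (intro power_le_exp) auto
      finally show "(\<Prod>i\<in>UNIV. real (Suc (t n i)))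
          \<le> (B * real CARD('k) / (c2 / 2)) ^ CARD('k) * exp (c2 / 2 * ?G)" .
    qed simp_all
    also have "\<dots> = real CARD('k) * exp (- c * ?G) + (B * real CARD('k) / (c2 / 2)) ^ CARD('k) * exp (- (c2 / 2) * ?G)"
    proof -
      have "exp (c2 / 2 * ?G) * exp (- c2 * ?G) = exp (- (c2 / 2) * ?G)"
        by (simp add: exp_add[symmetric])
      then show ?thesis by (simp only: mult.assoc)
    qed
    also have "\<dots> \<le> C * exp (- c * ?G)"
    proof -
      have "exp (- (c2 / 2) * ?G) \<le> exp (- c * ?G)" using c G by (simp add: mult_right_mono)
      then have "(B * real CARD('k) / (c2 / 2)) ^ CARD('k) * exp (- (c2 / 2) * ?G)
        \<le> (B * real CARD('k) / (c2 / 2)) ^ CARD('k) * exp (- c * ?G)"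
        using B c2(1) by (intro mult_left_mono) auto
      then show ?thesis by (simp add: C_def distrib_right)
    qed
    finally show ?case by simp
  qed
  then show ?thesis using c(1) by (intro exI[of _ c] conjI bigoI)
qed

end

theorem theorem3p2:
  fixes r :: nat
    and comm :: "nat \<Rightarrow> nat \<Rightarrow> 'k::{finite,linorder}"
    and q :: "nat \<Rightarrow> 'k \<Rightarrow> 'k \<Rightarrow> real"
    and a :: "nat \<Rightarrow> 'k \<Rightarrow> nat"
    and N :: "nat \<Rightarrow> 'k \<Rightarrow> nat"
    and p g :: "nat \<Rightarrow> 'k \<Rightarrow> real"
    and \<nu> \<mu> \<gamma> :: "'k \<Rightarrow> 'k \<Rightarrow> real"
    and \<alpha> :: "'k rvec"
    and X :: "'k rmat"
    and y0 :: real and yp :: ereal and x :: "real \<Rightarrow> 'k rvec"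
    and x_star :: real
  assumes r: "r \<ge> 2"
    and N_def: "\<And>n i. N n i = card (community n (comm n) i)"
    and p_def: "\<And>n i. p n i = q n i i"
    and g_def: "\<And>n i. g n i = crit_seeds r (N n i) (p n i)"
    and N_pos: "\<And>n i. n \<ge> CARD('k) \<Longrightarrow> N n i \<ge> 1"
    and q_range: "\<And>n i j. n \<ge> CARD('k) \<Longrightarrow> 0 \<le> q n i j \<and> q n i j < 1"
    and q_sym: "\<And>n i j. n \<ge> CARD('k) \<Longrightarrow> q n i j = q n j i"
    and seeds_le: "\<And>n i. n \<ge> CARD('k) \<Longrightarrow> a n i \<le> N n i"
    and nu: "\<And>i j. 0 < \<nu> i j" "\<And>i j. (\<lambda>n. real (N n i) / real (N n j)) \<longlonglongrightarrow> \<nu> i j"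
    and p_lower: "\<And>i. (\<lambda>n. 1 / real (N n i)) \<in> o(\<lambda>n. p n i)"
    and p_upper: "\<And>i. (\<lambda>n. p n i) \<in> o(\<lambda>n. real (N n i) powr (- 1 / real r))"
    and q_le: "\<And>n i j. n \<ge> CARD('k) \<Longrightarrow> q n i j \<le> min (p n i) (p n j)"
    and gamma: "\<And>i j. 0 \<le> \<gamma> i j \<and> \<gamma> i j \<le> 1" "\<And>i j. (\<lambda>n. q n i j / p n i) \<longlonglongrightarrow> \<gamma> i j"
    and mu: "\<And>i j. 0 < \<mu> i j" "\<And>i j. (\<lambda>n. p n i / p n j) \<longlonglongrightarrow> \<mu> i j"
    and alpha: "\<And>i. 0 \<le> \<alpha> $ i" "\<And>i. (\<lambda>n. real (a n i) / g n i) \<longlonglongrightarrow> \<alpha> $ i"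
    and X_def: "X = chi_matrix q g"
    and X_irred: "irreducible_mat X"
    and alpha_mono: "\<And>i j. i \<le> j \<Longrightarrow> \<alpha> $ j \<le> \<alpha> $ i"
    and alpha1_pos: "0 < \<alpha> $ idx1"
    and subcrit: "subcritical r \<alpha> X"
    and sol: "cauchy_solution r \<alpha> X y0 yp x"
    and x_star_def: "x_star = (\<Sum>i\<in>UNIV. exit_point r \<alpha> X y0 yp x $ i
                       * (\<nu> idx1 i * \<mu> idx1 i ^ r) powr (1 / (real r - 1)))"
  shows "\<forall>\<epsilon>>0. \<exists>c>0.
           (\<lambda>n. measure_pmf.prob (final_size_pmf r n (comm n) (q n) (a n))
                  {A. \<bar>real A / g n idx1 - x_star\<bar> > \<epsilon>})
             \<in> O(\<lambda>n. exp (- c * g n idx1))"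
proof -
  obtain z where z: "z \<in> dom_D r X" "\<And>i. drive r \<alpha> X z i < z $ i"
    using subcritical_imp_super[OF subcrit] by blast
  have lim: "sbm_limit r q a N p g \<nu> \<mu> \<gamma> \<alpha> X"
    by (rule sbm_limit.intro) (fact assms)+
  interpret subcritical_sbm r q a N p g \<nu> \<mu> \<gamma> \<alpha> X comm z
    by (intro subcritical_sbm.intro lim subcritical_sbm_axioms.intro N_def X_irred alpha1_pos z)
  show ?thesis
    using final_size_concentration unfolding x_star_def exit_point_eq_limit[OF sol] scale_def by blast
qed

end
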